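(* Let $\{z_n\}_{n\ge 1}$ be a Blaschke sequence of distinct points in the open unit disc $\mathbb{D}$, with corresponding Blaschke product $B$. The following are equivalent: (1) $\{z_n\}$ is an $EIS_p$ sequence for some $p$ with $1\le p\le\infty$; (2) $\{z_n\}$ is thin; (3) $\{h_{z_n}\}$ is a complete AOB in $K_B$; (4) $\{z_n\}$ is a strong-$AIS_p$ sequence for some $p$ with $1\le p\le\infty$; (5) the measure $\mu_N=\sum_{k\ge N}(1-|z_k|^2)\,\boldsymbol{\delta}_{z_k}$ is a Carleson measure with Carleson embedding constant $\mathcal{C}(\mu_N)$ satisfying $\mathcal{C}(\mu_N)\to 1$ as $N\to\infty$; (6) the measure $\nu_N=\sum_{k\ge N}\frac{1-|z_k|^2}{\delta_k}\,\boldsymbol{\delta}_{z_k}$ is a Carleson measure with embedding constant on reproducing kernels $\mathcal{R}(\nu_N)$ satisfying $\mathcal{R}(\nu_N)\to 1$ as $N\to\infty$. Moreover, if $\{z_n\}$ is an $EIS_p$ (respectively strong-$AIS_p$) sequence for some $p$ with $1\le p\le\infty$, then it is an $EIS_p$ (respectively strong-$AIS_p$) sequence for all $p$ with $1\le p\le\infty$.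
   Context: $H^p$ ($1\le p\le\infty$) is the Hardy space on $\mathbb{D}$ with norm $\|\cdot\|_p$. For a sequence $a=\{a_n\}$ and a positive integer $N$, $\|a\|_{N,\ell^p}:=\|\{a_j\}_{j\ge N}\|_{\ell^p}$. For $p=\infty$ we read $1/p=0$. For a sequence $\{z_n\}$ in $\mathbb{D}$ put $\delta_j:=\prod_{k\ne j}\left|\frac{z_j-z_k}{1-\overline{z_k}z_j}\right|$. The sequence is thin if $\lim_{j\to\infty}\delta_j=1$. $EIS_p$: $\{z_n\}$ is an eventual $1$-interpolating sequence for $H^p$ ($EIS_p$) if for every $\varepsilon>0$ there exists $N$ such that for each $a=\{a_n\}\in\ell^p$ there exists $f_{N,a}\in H^p$ with $f_{N,a}(z_n)(1-|z_n|^2)^{1/p}=a_n$ for all $n\ge N$ and $\|f_{N,a}\|_p\le(1+\varepsilon)\|a\|_{N,\ell^p}$. Strong-$AIS_p$: $\{z_n\}$ is a strong-$AIS_p$ sequence if for every $\varepsilon>0$ there exists $N$ such that for every $a=\{a_j\}\in\ell^p$ there exists $G_{N,a}\in H^p$ with $\|G_{N,a}\|_p\le\|a\|_{N,\ell^p}$ and $\|\{G_{N,a}(z_j)(1-|z_j|^2)^{1/p}-a_j\}_j\|_{N,\ell^p}\le\varepsilon\|a\|_{N,\ell^p}$. $K_B=H^2\ominus BH^2$ is the model space. For $z_0\in\mathbb{D}$, $k_{z_0}(z)=\frac{1}{1-\overline{z_0}z}$ is the reproducing kernel of $H^2$ and $h_{z_0}(z)=\frac{\sqrt{1-|z_0|^2}}{1-\overline{z_0}z}$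 is the normalized reproducing kernel. A sequence $\{x_n\}_{n\ge1}$ in a Hilbert space $\mathcal{H}$ is complete if its closed linear span is $\mathcal{H}$. It is an AOB (asymptotically orthonormal basic sequence) if for every $N\ge1$ there are positive constants $c_N,C_N$ such that $c_N\sum_{n\ge N}|a_n|^2\le\left\|\sum_{n\ge N}a_nx_n\right\|_{\mathcal{H}}^2\le C_N\sum_{n\ge N}|a_n|^2$ for all complex sequences $\{a_n\}$ (finitely supported, equivalently in $\ell^2$), with $c_N\to1$ and $C_N\to1$ as $N\to\infty$. $\boldsymbol{\delta}_{z}$ denotes the unit point mass at $z$ (not to be confused with the numbers $\delta_k$). For a positive measure $\mu$ on $\mathbb{D}$, $\mathcal{C}(\mu)=\sup_{f\in H^2,\,f\ne0}\frac{\|f\|^2_{L^2(\mathbb{D},\mu)}}{\|f\|_2^2}$ and $\mathcal{R}(\mu)=\sup_{z\in\mathbb{D}}\frac{\|k_z\|_{L^2(\mathbb{D},\mu)}}{\|k_z\|_2}$ (possibly infinite); $\mu$ is a Carleson measure if $\mathcal{C}(\mu)<\infty$ (equivalently, by the Carleson Embedding Theorem, $\mathcal{R}(\mu)<\infty$). *)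

theory Defs
  imports "HOL-Complex_Analysis.Complex_Analysis"
begin

text \<open>
  Exponents \<open>p\<close> with \<open>1 \<le> p \<le> \<infinity>\<close> have type \<^typ>\<open>ennreal\<close>; \<open>1 / p = 0\<close> for \<open>p = \<infinity>\<close>.
  Norms that may be infinite are \<^typ>\<open>ennreal\<close>-valued, so that every norm inequality with a
  finite right-hand side also asserts finiteness of its left-hand side.
  Sequences are indexed by \<^typ>\<open>nat\<close> starting at 0; all notions below are
  insensitive to the shift of the index by one.
  Functions on the disc are total functions on \<^typ>\<open>complex\<close> whose values outside the disc
  never matter.
\<close>

abbreviation unit_disc :: "complex set" where
  "unit_disc \<equiv> ball 0 1"

definition integral_mean :: "real \<Rightarrow> (complex \<Rightarrow> complex) \<Rightarrow> real \<Rightarrow> real" where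
  "integral_mean q f r =
     (1 / (2 * pi) * integral {0..2 * pi} (\<lambda>t. norm (f (of_real r * cis t)) powr q)) powr (1 / q)"

definition hardy_norm :: "ennreal \<Rightarrow> (complex \<Rightarrow> complex) \<Rightarrow> ennreal" where
  "hardy_norm p f =
     (if p = \<infinity> then SUP w\<in>unit_disc. ennreal (norm (f w))
      else SUP r\<in>{0<..<1}. ennreal (integral_mean (enn2real p) f r))"

definition hardy_space :: "ennreal \<Rightarrow> (complex \<Rightarrow> complex) set" where
  "hardy_space p = {f. f holomorphic_on unit_disc \<and> hardy_norm p f < \<infinity>}"

text \<open>The polarised form of \<open>hardy_norm 2\<close>: the integral means are increasing in the radius,
  so their supremum is their limit at radius 1.\<close>

definition hardy_inner :: "(complex \<Rightarrow> complex) \<Rightarrow> (complex \<Rightarrow> complex) \<Rightarrow> complex" where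
  "hardy_inner f g =
     Lim (at_left 1) (\<lambda>r::real. 1 / (2 * pi) *
       integral {0..2 * pi} (\<lambda>t. f (of_real r * cis t) * cnj (g (of_real r * cis t))))"

definition tail_lp_norm :: "ennreal \<Rightarrow> nat \<Rightarrow> (nat \<Rightarrow> complex) \<Rightarrow> ennreal" where
  "tail_lp_norm p N a =
     (if p = \<infinity> then SUP j\<in>{N..}. ennreal (norm (a j))
      else if summable (\<lambda>j. norm (a j) powr enn2real p)
      then ennreal ((\<Sum>j. norm (a (j + N)) powr enn2real p) powr (1 / enn2real p))
      else \<infinity>)"

definition lp_space :: "ennreal \<Rightarrow> (nat \<Rightarrow> complex) set" where
  "lp_space p = {a. tail_lp_norm p 0 a < \<infinity>}"

definition blaschke_sequence :: "(nat \<Rightarrow> complex) \<Rightarrow> bool" where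
  "blaschke_sequence z \<longleftrightarrow> (\<forall>n. z n \<in> unit_disc) \<and> summable (\<lambda>n. 1 - norm (z n))"

definition blaschke_factor :: "complex \<Rightarrow> complex \<Rightarrow> complex" where
  "blaschke_factor a w =
     (if a = 0 then w else of_real (norm a) / a * ((a - w) / (1 - cnj a * w)))"

definition blaschke_product :: "(nat \<Rightarrow> complex) \<Rightarrow> complex \<Rightarrow> complex" where
  "blaschke_product z w = (\<Prod>n. blaschke_factor (z n) w)"

text \<open>\<^const>\<open>prodinf\<close> is unspecified for products diverging to 0, where the limit of the
  (decreasing) partial products is still the intended value.\<close>

definition separation :: "(nat \<Rightarrow> complex) \<Rightarrow> nat \<Rightarrow> real" where
  "separation z j =
     lim (\<lambda>n. \<Prod>k\<in>{..<n} - {j}. norm ((z j - z k) / (1 - cnj (z k) * z j)))"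

definition thin :: "(nat \<Rightarrow> complex) \<Rightarrow> bool" where
  "thin z \<longleftrightarrow> separation z \<longlonglongrightarrow> 1"

definition weighted_values :: "ennreal \<Rightarrow> (nat \<Rightarrow> complex) \<Rightarrow> (complex \<Rightarrow> complex) \<Rightarrow> nat \<Rightarrow> complex" where
  "weighted_values p z f n = f (z n) * of_real ((1 - (norm (z n))\<^sup>2) powr enn2real (1 / p))"

definition EIS :: "ennreal \<Rightarrow> (nat \<Rightarrow> complex) \<Rightarrow> bool" where
  "EIS p z \<longleftrightarrow>
     (\<forall>\<epsilon>>0::real. \<exists>N. \<forall>a\<in>lp_space p. \<exists>f\<in>hardy_space p.
        (\<forall>n\<ge>N. weighted_values p z f n = a n) \<and>
        hardy_norm p f \<le> ennreal (1 + \<epsilon>) * tail_lp_norm p N a)"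

definition strong_AIS :: "ennreal \<Rightarrow> (nat \<Rightarrow> complex) \<Rightarrow> bool" where
  "strong_AIS p z \<longleftrightarrow>
     (\<forall>\<epsilon>>0::real. \<exists>N. \<forall>a\<in>lp_space p. \<exists>G\<in>hardy_space p.
        hardy_norm p G \<le> tail_lp_norm p N a \<and>
        tail_lp_norm p N (\<lambda>j. weighted_values p z G j - a j) \<le> ennreal \<epsilon> * tail_lp_norm p N a)"

definition model_space :: "(complex \<Rightarrow> complex) \<Rightarrow> (complex \<Rightarrow> complex) set" where
  "model_space B =
     {f \<in> hardy_space 2. \<forall>g\<in>hardy_space 2. hardy_inner f (\<lambda>w. B w * g w) = 0}"

definition szego_kernel :: "complex \<Rightarrow> complex \<Rightarrow> complex" where
  "szego_kernel z0 w = 1 / (1 - cnj z0 * w)"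

definition normalized_kernel :: "complex \<Rightarrow> complex \<Rightarrow> complex" where
  "normalized_kernel z0 w = of_real (sqrt (1 - (norm z0)\<^sup>2)) / (1 - cnj z0 * w)"

definition closed_span :: "(nat \<Rightarrow> complex \<Rightarrow> complex) \<Rightarrow> (complex \<Rightarrow> complex) set" where
  "closed_span x =
     {f \<in> hardy_space 2. \<forall>e>0::real. \<exists>M (c :: nat \<Rightarrow> complex).
        hardy_norm 2 (\<lambda>w. f w - (\<Sum>n<M. c n * x n w)) < ennreal e}"

definition AOB :: "(nat \<Rightarrow> complex \<Rightarrow> complex) \<Rightarrow> bool" where
  "AOB x \<longleftrightarrow>
     (\<exists>c C :: nat \<Rightarrow> real.
        (\<forall>N. 0 < c N \<and> 0 < C N \<and>
           (\<forall>a :: nat \<Rightarrow> complex. finite {n. a n \<noteq> 0} \<longrightarrow>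
              (let S = {n. N \<le> n \<and> a n \<noteq> 0}; s = (\<Sum>n\<in>S. (norm (a n))\<^sup>2) in
               ennreal (c N * s) \<le> (hardy_norm 2 (\<lambda>w. \<Sum>n\<in>S. a n * x n w))\<^sup>2 \<and>
               (hardy_norm 2 (\<lambda>w. \<Sum>n\<in>S. a n * x n w))\<^sup>2 \<le> ennreal (C N * s)))) \<and>
        c \<longlonglongrightarrow> 1 \<and> C \<longlonglongrightarrow> 1)"

text \<open>For closed subspaces \<open>K\<close> of \<open>H\<^sup>2\<close>, which carry the \<open>H\<^sup>2\<close> norm.\<close>

definition complete_AOB_in ::
    "(complex \<Rightarrow> complex) set \<Rightarrow> (nat \<Rightarrow> complex \<Rightarrow> complex) \<Rightarrow> bool" where
  "complete_AOB_in K x \<longleftrightarrow> (\<forall>n. x n \<in> K) \<and> AOB x \<and> closed_span x = K"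

definition L2_norm :: "complex measure \<Rightarrow> (complex \<Rightarrow> complex) \<Rightarrow> ennreal" where
  "L2_norm \<mu> f =
     (let I = (\<integral>\<^sup>+ w. ennreal ((norm (f w))\<^sup>2) \<partial>\<mu>)
      in if I = \<infinity> then \<infinity> else ennreal (sqrt (enn2real I)))"

text \<open>The condition \<open>hardy_norm 2 f \<noteq> 0\<close> excludes the zero element of \<open>H\<^sup>2\<close>, i.e. all functions
  vanishing on the disc.\<close>

definition carleson_constant :: "complex measure \<Rightarrow> ennreal" where
  "carleson_constant \<mu> =
     (SUP f\<in>{f \<in> hardy_space 2. hardy_norm 2 f \<noteq> 0}. (L2_norm \<mu> f)\<^sup>2 / (hardy_norm 2 f)\<^sup>2)"

definition kernel_constant :: "complex measure \<Rightarrow> ennreal" where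
  "kernel_constant \<mu> =
     (SUP w\<in>unit_disc. L2_norm \<mu> (szego_kernel w) / hardy_norm 2 (szego_kernel w))"

definition carleson_measure :: "complex measure \<Rightarrow> bool" where
  "carleson_measure \<mu> \<longleftrightarrow> carleson_constant \<mu> < \<infinity>"

text \<open>The measure on the disc that is the sum over \<open>k \<ge> N\<close> of the point masses of weight \<open>m k\<close>
  at \<open>z k\<close>, as the image under \<open>z\<close> of a weighted counting measure.\<close>

definition tail_point_masses :: "(nat \<Rightarrow> real) \<Rightarrow> (nat \<Rightarrow> complex) \<Rightarrow> nat \<Rightarrow> complex measure" where
  "tail_point_masses m z N =
     distr (point_measure {N..} (\<lambda>k. ennreal (m k))) (restrict_space borel unit_disc) z"

lemma emeasure_tail_point_masses:
  assumes "\<And>k. z k \<in> unit_disc" "A \<in> sets borel" "A \<subseteq> unit_disc"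
  shows "emeasure (tail_point_masses m z N) A = (\<Sum>k. ennreal (m (k + N)) * indicator A (z (k + N)))"
proof -
  let ?P = "point_measure {N..} (\<lambda>k. ennreal (m k))"
  have meas: "z \<in> measurable ?P (restrict_space borel unit_disc)"
    using assms(1) by (auto simp: measurable_def point_measure_def space_restrict_space)
  have A: "A \<in> sets (restrict_space borel unit_disc)"
    using assms(2,3) by (auto simp: sets_restrict_space)
  have "emeasure (tail_point_masses m z N) A = emeasure ?P (z -` A \<inter> {N..})"
    using meas A by (simp add: tail_point_masses_def emeasure_distr space_point_measure)
  also have "\<dots> = (\<integral>\<^sup>+ k. ennreal (m k) * indicator A (z k) \<partial>count_space {N..})"
    unfolding point_measure_def
    by (subst emeasure_density) (auto intro!: nn_integral_cong simp: indicator_def)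
  also have "\<dots> = (\<integral>\<^sup>+ k. ennreal (m (k + N)) * indicator A (z (k + N)) \<partial>count_space UNIV)"
    by (rule nn_integral_bij_count_space[symmetric])
       (rule bij_betwI[where g = "\<lambda>k. k - N"], auto)
  finally show ?thesis
    by (simp add: nn_integral_count_space_nat)
qed

end

theory Submission
  imports Defs "HOL-Real_Asymp.Real_Asymp"
begin

text \<open>
  For \<open>a\<close> in the disc the map \<open>h\<^sub>a(w) = (1 - |a|\<^sup>2) (1 + cnj a w) / (1 - cnj a w)\<close> has positive real
  part, so \<open>u\<^sub>a = n h\<^sub>a / (1 + n h\<^sub>a)\<close> and \<open>v\<^sub>a = 1 / (1 + n h\<^sub>a)\<close> satisfy \<open>|u\<^sub>a|\<^sup>2 + |v\<^sub>a|\<^sup>2 \<le> 1\<close>.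
  Multiplying \<open>u\<^sub>a\<close> by all \<open>v\<^sub>b\<close> with \<open>|b| \<ge> |a|\<close> gives functions \<open>q\<^sub>a\<close> with \<open>\<Sum> |q\<^sub>a|\<^sup>2 \<le> 1\<close> on the disc,
  and \<open>|q\<^sub>a(a)|\<close> is close to 1 if the points are nearly as separated as possible. Point
  evaluation of \<open>f q\<^sub>a\<close> gives the Carleson embedding with constant near 1, and the functions
  \<open>q\<^sub>a\<^sup>2\<close> times Blaschke products interpolate in every \<open>H\<^sup>p\<close> with constant near 1; normal families
  pass from finitely many to infinitely many points. Duality turns these two estimates into the
  upper and lower bounds for the Gram matrix of the normalised kernels. Conversely, each condition
  forces thinness when it is tested on a unit vector, on a single kernel, or on a row of the
  Gram matrix.
\<close>

section \<open>Means over circles\<close>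

text \<open>Classical constructions of interpolating functions lose an absolute factor, while here
  every constant has to tend to 1; this dictates \<open>u\<close> and \<open>v\<close>. At its own
  point \<open>h_a(a) = 1 + |a|^2 \<ge> 1\<close>, so \<open>|u_a(a)| \<ge> n / (n + 1)\<close>. At
  a point \<open>a\<close> with \<open>|a| \<le> |b|\<close> both \<open>Re h_b(a)\<close> and
  \<open>|h_b(a)|^2\<close> are at most a multiple of \<open>1 - \<rho>^2\<close>,
  \<open>\<rho>\<close> being the pseudohyperbolic distance of \<open>a\<close> and
  \<open>b\<close>, so that the factor \<open>v_b\<close> costs no more than a fixed power of
  \<open>\<rho>\<close>. For \<open>|b| < |a|\<close> no uniform bound of this kind holds, whence
  the ordering by modulus. The power grows with \<open>n\<close>, so \<open>n\<close> is made large
  first and the separation is brought close to 1 afterwards. Only the separation of the points of a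
  tail from each other enters: finitely many initial points form a finite Blaschke product, whose
  modulus tends to 1 along the sequence. Boundary values are never formed. Norms and pairings are
  suprema or limits over circles of radius \<open>r < 1\<close>; evaluation on such a circle takes
  place at \<open>r^2 w\<close> instead of \<open>w\<close>, and \<open>r\<close> tends to 1 at the
  end.\<close>

definition circ_mean :: "real \<Rightarrow> (complex \<Rightarrow> 'a::euclidean_space) \<Rightarrow> 'a" where
  "circ_mean r F = (1 / (2 * pi)) *\<^sub>R integral {0..2 * pi} (\<lambda>t. F (of_real r * cis t))"

lemma continuous_on_circle_param:
  assumes "0 \<le> r" "continuous_on (sphere 0 r) F"
  shows "continuous_on A (\<lambda>t. F (of_real r * cis t))"
  by (rule continuous_on_compose2[OF assms(2)])
     (use assms(1) in \<open>auto intro!: continuous_intros simp: norm_mult\<close>)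

lemma circle_integrable:
  fixes F :: "complex \<Rightarrow> 'a::euclidean_space"
  assumes "0 \<le> r" "continuous_on (sphere 0 r) F"
  shows "(\<lambda>t. F (of_real r * cis t)) integrable_on {0..2 * pi}"
  by (intro integrable_continuous_interval continuous_on_circle_param assms)

lemma circ_mean_cong:
  assumes "0 \<le> r" "\<And>u. norm u = r \<Longrightarrow> F u = G u"
  shows "circ_mean r F = circ_mean r G"
  using assms unfolding circ_mean_def by (simp add: norm_mult)

lemma circ_mean_const [simp]: "circ_mean r (\<lambda>u. c) = c"
  by (simp add: circ_mean_def)

lemma circ_mean_mono:
  fixes F G :: "complex \<Rightarrow> real"
  assumes "0 \<le> r" "continuous_on (sphere 0 r) F" "continuous_on (sphere 0 r) G"
    and "\<And>u. norm u = r \<Longrightarrow> F u \<le> G u"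
  shows "circ_mean r F \<le> circ_mean r G"
  unfolding circ_mean_def real_scaleR_def
  by (intro mult_left_mono integral_le circle_integrable assms) (use assms(1) in \<open>auto simp: norm_mult\<close>)

lemma circ_mean_nonneg:
  fixes F :: "complex \<Rightarrow> real"
  assumes "0 \<le> r" "continuous_on (sphere 0 r) F" "\<And>u. norm u = r \<Longrightarrow> 0 \<le> F u"
  shows "0 \<le> circ_mean r F"
  using circ_mean_mono[of r "\<lambda>_. 0" F] assms by simp

lemma circ_mean_le_const:
  fixes F :: "complex \<Rightarrow> real"
  assumes "0 \<le> r" "continuous_on (sphere 0 r) F" "\<And>u. norm u = r \<Longrightarrow> F u \<le> c"
  shows "circ_mean r F \<le> c"
  using circ_mean_mono[of r F "\<lambda>_. c"] assms by simp

lemma circ_mean_add: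
  assumes "0 \<le> r" "continuous_on (sphere 0 r) F" "continuous_on (sphere 0 r) G"
  shows "circ_mean r (\<lambda>u. F u + G u) = circ_mean r F + circ_mean r G"
  unfolding circ_mean_def
  by (simp add: integral_add[OF circle_integrable circle_integrable] assms scaleR_right_distrib)

lemma circ_mean_diff:
  assumes "0 \<le> r" "continuous_on (sphere 0 r) F" "continuous_on (sphere 0 r) G"
  shows "circ_mean r (\<lambda>u. F u - G u) = circ_mean r F - circ_mean r G"
  unfolding circ_mean_def
  by (simp add: integral_diff[OF circle_integrable circle_integrable] assms scaleR_right_diff_distrib)

lemma circ_mean_sum:
  assumes "0 \<le> r" "finite I" "\<And>i. i \<in> I \<Longrightarrow> continuous_on (sphere 0 r) (F i)"
  shows "circ_mean r (\<lambda>u. \<Sum>i\<in>I. F i u) = (\<Sum>i\<in>I. circ_mean r (F i))"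
proof -
  have "integral {0..2 * pi} (\<lambda>t. \<Sum>i\<in>I. F i (of_real r * cis t)) =
      (\<Sum>i\<in>I. integral {0..2 * pi} (\<lambda>t. F i (of_real r * cis t)))"
    by (rule integral_sum[OF assms(2)]) (rule circle_integrable[OF assms(1,3)])
  then show ?thesis
    by (simp add: circ_mean_def scaleR_sum_right)
qed

lemma circ_mean_bounded_linear:
  assumes "bounded_linear h" "0 \<le> r" "continuous_on (sphere 0 r) F"
  shows "circ_mean r (\<lambda>u. h (F u)) = h (circ_mean r F)"
proof -
  have "integral {0..2 * pi} (h \<circ> (\<lambda>t. F (of_real r * cis t))) =
      h (integral {0..2 * pi} (\<lambda>t. F (of_real r * cis t)))"
    by (rule integral_linear[OF circle_integrable[OF assms(2,3)] assms(1)])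
  then show ?thesis
    unfolding circ_mean_def by (simp add: o_def linear_simps[OF assms(1)])
qed

lemma circ_mean_mult_left:
  fixes F :: "complex \<Rightarrow> 'a::{euclidean_space, real_normed_algebra}"
  assumes "0 \<le> r" "continuous_on (sphere 0 r) F"
  shows "circ_mean r (\<lambda>u. c * F u) = c * circ_mean r F"
  by (rule circ_mean_bounded_linear[OF bounded_linear_mult_right assms])

lemma norm_circ_mean_le:
  assumes "0 \<le> r" "continuous_on (sphere 0 r) F"
  shows "norm (circ_mean r F) \<le> circ_mean r (\<lambda>u. norm (F u))"
proof -
  have "norm (integral {0..2 * pi} (\<lambda>t. F (of_real r * cis t))) \<le>
      integral {0..2 * pi} (\<lambda>t. norm (F (of_real r * cis t)))"
    by (intro integral_norm_bound_integral circle_integrable[OF assms]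
        circle_integrable[OF assms(1) continuous_on_norm[OF assms(2)]]) simp
  then show ?thesis
    unfolding circ_mean_def by (simp add: divide_right_mono)
qed

section \<open>Circle means as Cauchy integrals\<close>

lemma circ_mean_eq_contour_integral:
  assumes "0 < r"
  shows "contour_integral (circlepath 0 r) (\<lambda>u. F u / u) = 2 * of_real pi * \<i> * circ_mean r F"
proof -
  have "contour_integral (circlepath 0 r) (\<lambda>u. F u / u) =
      integral {0..2 * pi} (\<lambda>t. F (r * cis t) / (r * cis t) * r * \<i> * cis t)"
    unfolding circlepath_def using contour_integral_part_circlepath_eq[of 0 "2 * pi" 0 r "\<lambda>u. F u / u"]
    by simp
  also have "\<dots> = integral {0..2 * pi} (\<lambda>t. F (r * cis t) * \<i>)"
    using assms by (intro integral_cong) (simp add: field_simps)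
  also have "\<dots> = integral {0..2 * pi} (\<lambda>t. F (r * cis t)) * \<i>"
    by simp
  finally show ?thesis
    by (simp add: circ_mean_def scaleR_conv_of_real)
qed

lemma holomorphic_on_disc_subsets:
  assumes "f holomorphic_on unit_disc" "r < 1"
  shows "continuous_on (cball 0 r) f" "continuous_on (sphere 0 r) f" "f holomorphic_on ball 0 r"
proof -
  have *: "cball 0 r \<subseteq> unit_disc" "sphere 0 r \<subseteq> unit_disc" "ball 0 r \<subseteq> unit_disc"
    using assms(2) by auto
  then show "continuous_on (cball 0 r) f" "continuous_on (sphere 0 r) f" "f holomorphic_on ball 0 r"
    using assms(1) holomorphic_on_imp_continuous_on holomorphic_on_subset continuous_on_subset by blast+
qed

text \<open>On \<open>norm u = r\<close> one has \<open>cnj u = r^2 / u\<close>, so the conjugated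
  kernel equals \<open>u / (u - r^2 w)\<close> and the mean is Cauchy's integral at
  \<open>r^2 w\<close>. The hypothesis \<open>norm w * r < 1\<close> places this point inside the
  circle.\<close>

lemma circ_mean_reproducing:
  assumes f: "f holomorphic_on unit_disc" and r: "0 < r" "r < 1" and w: "norm w * r < 1"
  shows "circ_mean r (\<lambda>u. f u * cnj (szego_kernel w u)) = f (of_real (r\<^sup>2) * w)"
proof -
  let ?v = "of_real (r\<^sup>2) * w"
  have nv: "norm (?v - 0) < r"
    using r w by (simp add: norm_mult power2_eq_square mult.commute)
  have "((\<lambda>u. f u / (u - ?v)) has_contour_integral 2 * of_real pi * \<i> * f ?v) (circlepath 0 r)"
    by (rule Cauchy_integral_circlepath[OF holomorphic_on_disc_subsets(1,3)[OF f r(2)] nv])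
  then have "contour_integral (circlepath 0 r) (\<lambda>u. f u / (u - ?v)) = 2 * of_real pi * \<i> * f ?v"
    by (rule contour_integral_unique)
  moreover have "contour_integral (circlepath 0 r) (\<lambda>u. f u / (u - ?v)) =
      contour_integral (circlepath 0 r) (\<lambda>u. (f u * u / (u - ?v)) / u)"
  proof (rule contour_integral_eq)
    fix u assume "u \<in> path_image (circlepath 0 r)"
    then have "u \<noteq> 0" using r by auto
    then show "f u / (u - ?v) = (f u * u / (u - ?v)) / u" by simp
  qed
  ultimately have "contour_integral (circlepath 0 r) (\<lambda>u. (f u * u / (u - ?v)) / u) = 2 * of_real pi * \<i> * f ?v"
    by simp
  then have "circ_mean r (\<lambda>u. f u * u / (u - ?v)) = f ?v"
    unfolding circ_mean_eq_contour_integral[OF r(1)] by simp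
  also have "circ_mean r (\<lambda>u. f u * u / (u - ?v)) = circ_mean r (\<lambda>u. f u * cnj (szego_kernel w u))"
  proof (rule circ_mean_cong)
    fix u :: complex assume u: "norm u = r"
    have "u * cnj u = of_real (r\<^sup>2)"
      by (simp add: u complex_norm_square[symmetric] flip: of_real_power)
    then have "u - ?v = u * (1 - w * cnj u)" by (simp add: algebra_simps)
    moreover have "u \<noteq> 0" using u r by auto
    moreover have "1 - w * cnj u \<noteq> 0"
      using w u by (metis complex_mod_cnj eq_iff_diff_eq_0 less_irrefl norm_mult norm_one)
    ultimately show "f u * u / (u - ?v) = f u * cnj (szego_kernel w u)"
      by (simp add: szego_kernel_def)
  qed (use r in simp)
  finally show ?thesis .
qed

text \<open>The same substitution \<open>cnj u = r^2 / u\<close> leads to Cauchy's formula for the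
  \<open>n\<close>-th derivative at 0. This is the termwise ingredient of Parseval's
  identity.\<close>

lemma circ_mean_power:
  assumes f: "f holomorphic_on unit_disc" and r: "0 < r" "r < 1"
  shows "circ_mean r (\<lambda>u. f u * cnj u ^ n) = (deriv ^^ n) f 0 / fact n * of_real (r ^ (2 * n))"
proof -
  have "contour_integral (circlepath 0 r) (\<lambda>u. f u / (u - 0) ^ Suc n) = 2 * pi * \<i> * (deriv ^^ n) f 0 / fact n"
    by (rule Cauchy_contour_integral_circlepath[OF holomorphic_on_disc_subsets(1,3)[OF f r(2)]])
       (use r in simp)
  then have "contour_integral (circlepath 0 r) (\<lambda>u. (f u / u ^ n) / u) = 2 * pi * \<i> * ((deriv ^^ n) f 0 / fact n)"
    by (simp add: mult.commute)
  then have *: "circ_mean r (\<lambda>u. f u / u ^ n) = (deriv ^^ n) f 0 / fact n"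
    unfolding circ_mean_eq_contour_integral[OF r(1)] by (simp add: field_simps)
  have "circ_mean r (\<lambda>u. f u * cnj u ^ n) = circ_mean r (\<lambda>u. of_real (r ^ (2 * n)) * (f u / u ^ n))"
  proof (rule circ_mean_cong)
    fix u :: complex assume u: "norm u = r"
    have "u * cnj u = of_real (r\<^sup>2)"
      by (simp add: u complex_norm_square[symmetric] flip: of_real_power)
    then have "u ^ n * cnj u ^ n = of_real (r ^ (2 * n))"
      by (metis of_real_power power_mult power_mult_distrib)
    moreover have "u ^ n \<noteq> 0" using u r by auto
    ultimately show "f u * cnj u ^ n = of_real (r ^ (2 * n)) * (f u / u ^ n)"
      by (simp add: field_simps)
  qed (use r in simp)
  also have "\<dots> = of_real (r ^ (2 * n)) * circ_mean r (\<lambda>u. f u / u ^ n)"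
    using r by (intro circ_mean_mult_left continuous_on_divide continuous_on_power continuous_on_id
        holomorphic_on_disc_subsets(2)[OF f]) auto
  finally show ?thesis using * by simp
qed

section \<open>Convexity of the Hardy norms\<close>

text \<open>The supporting line of the convex function \<open>x powr q\<close> at \<open>m\<close>.
  Summed or averaged against a weight, with \<open>m\<close> the weighted mean, it yields both forms
  of Jensen's inequality below.\<close>

lemma powr_above_tangent:
  fixes x m q :: real
  assumes "0 \<le> x" "0 < m" "1 \<le> q"
  shows "m powr q + q * m powr (q - 1) * (x - m) \<le> x powr q"
proof (cases "x = 0")
  \<comment> \<open>The convexity argument on the open half-line does not reach the endpoint; there
    the left-hand side is \<open>m powr q * (1 - q)\<close>.\<close>
  case True
  have "m powr q = m powr (q - 1) * m"
    using assms by (simp add: powr_diff)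
  then have "m powr q + q * m powr (q - 1) * (x - m) = m powr q * (1 - q)"
    using True by (simp add: algebra_simps)
  also have "\<dots> \<le> 0"
    using assms by (simp add: mult_nonneg_nonpos)
  finally show ?thesis using True by simp
next
  case False
  have "((\<lambda>x. x powr q) has_real_derivative q * m powr (q - 1)) (at m within {0<..})"
    by (rule has_field_derivative_at_within[OF has_real_derivative_powr[OF assms(2)]])
  from convex_on_imp_above_tangent[OF powr_convex[OF assms(3)] _ _ _ this, of x]
  have "x powr q - m powr q \<ge> q * m powr (q - 1) * (x - m)"
    using assms False by (simp add: interior_open)
  then show ?thesis by simp
qed

lemma sum_powr_Jensen:
  fixes w x :: "'i \<Rightarrow> real"
  assumes "finite I" "\<And>i. i \<in> I \<Longrightarrow> 0 \<le> w i" "\<And>i. i \<in> I \<Longrightarrow> 0 \<le> x i"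
    and "(\<Sum>i\<in>I. w i) \<le> M" "0 < M" "1 \<le> q"
  shows "(\<Sum>i\<in>I. w i * x i) powr q \<le> M powr (q - 1) * (\<Sum>i\<in>I. w i * x i powr q)"
proof -
  define s where "s = (\<Sum>i\<in>I. w i * x i)"
  define m where "m = s / M"
  have s0: "0 \<le> s" unfolding s_def using assms by (intro sum_nonneg) auto
  have rhs0: "0 \<le> M powr (q - 1) * (\<Sum>i\<in>I. w i * x i powr q)"
    using assms by (intro mult_nonneg_nonneg sum_nonneg) auto
  show ?thesis
  proof (cases "s = 0")
    case True then show ?thesis using rhs0 unfolding s_def by simp
  next
    case False
    with s0 assms have m: "0 < m" unfolding m_def by simp
    have mq: "m powr q = m powr (q - 1) * m"
      using m by (simp add: powr_diff)
    \<comment> \<open>The added term is nonnegative by the bound on the weights; with it the next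
      step is an identity, because \<open>s = M * m\<close>.\<close>
    have "M * m powr q \<le> M * m powr q + (q - 1) * m powr q * (M - (\<Sum>i\<in>I. w i))"
      using assms by simp
    also have "\<dots> = (\<Sum>i\<in>I. w i) * m powr q + q * m powr (q - 1) * (s - m * (\<Sum>i\<in>I. w i))"
      using assms unfolding mq by (simp add: m_def field_simps)
    also have "\<dots> = (\<Sum>i\<in>I. w i * (m powr q + q * m powr (q - 1) * (x i - m)))"
      unfolding s_def by (simp add: algebra_simps sum.distrib sum_subtractf sum_distrib_left sum_distrib_right)
    also have "\<dots> \<le> (\<Sum>i\<in>I. w i * x i powr q)"
      using assms m by (intro sum_mono mult_left_mono powr_above_tangent) auto
    finally have "M powr (q - 1) * (M * m powr q) \<le> M powr (q - 1) * (\<Sum>i\<in>I. w i * x i powr q)"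
      by (intro mult_left_mono) auto
    moreover have "M powr (q - 1) * (M * m powr q) = s powr q"
      using assms s0 by (simp add: m_def powr_divide powr_diff)
    ultimately show ?thesis unfolding s_def by simp
  qed
qed

text \<open>Jensen's inequality for the points \<open>x / A\<close> and \<open>y / B\<close> with
  weights \<open>A\<close> and \<open>B\<close>. Equality holds when \<open>x / A = y / B\<close>,
  which is why its integral gives Minkowski's inequality with the sharp constant.\<close>

lemma add_powr_le:
  fixes x y A B :: real
  assumes "0 \<le> x" "0 \<le> y" "0 < A" "0 < B" "1 \<le> q"
  shows "(x + y) powr q \<le> (A + B) powr (q - 1) * (A powr (1 - q) * x powr q + B powr (1 - q) * y powr q)"
proof -
  have "(\<Sum>i\<in>{True,False}. (if i then A else B) * (if i then x / A else y / B)) powr q \<le>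
     (A + B) powr (q - 1) * (\<Sum>i\<in>{True,False}. (if i then A else B) * (if i then x / A else y / B) powr q)"
    using assms by (intro sum_powr_Jensen) auto
  then show ?thesis
    using assms by (simp add: powr_divide powr_diff)
qed

lemma continuous_on_powr_const:
  fixes X :: "'a::topological_space \<Rightarrow> real"
  assumes "continuous_on S X" "\<And>u. u \<in> S \<Longrightarrow> 0 \<le> X u" "0 < q"
  shows "continuous_on S (\<lambda>u. X u powr q)"
  using assms by (intro continuous_on_powr') auto

lemma continuous_on_norm_powr:
  assumes "continuous_on S f" "0 < q"
  shows "continuous_on S (\<lambda>u. norm (f u) powr q)"
  using assms by (intro continuous_on_powr_const continuous_on_norm) auto

text \<open>Averages the supporting line at \<open>m = s / c\<close>, the weighted mean of
  \<open>X\<close>. In the growth estimate \<open>W\<close> is the squared modulus of a Szego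
  kernel, whose total mass \<open>c\<close> is known exactly.\<close>

lemma circ_mean_powr_Jensen:
  fixes W X :: "complex \<Rightarrow> real"
  assumes r: "0 \<le> r" and W: "continuous_on (sphere 0 r) W" and X: "continuous_on (sphere 0 r) X"
    and "\<And>u. norm u = r \<Longrightarrow> 0 \<le> W u" "\<And>u. norm u = r \<Longrightarrow> 0 \<le> X u"
    and c: "circ_mean r W = c" "0 < c" and q: "1 \<le> q"
  shows "circ_mean r (\<lambda>u. W u * X u) powr q \<le> c powr (q - 1) * circ_mean r (\<lambda>u. W u * X u powr q)"
proof -
  define s where "s = circ_mean r (\<lambda>u. W u * X u)"
  define m where "m = s / c"
  have Xq: "continuous_on (sphere 0 r) (\<lambda>u. X u powr q)"
    using assms by (intro continuous_on_powr_const) auto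
  have WX: "continuous_on (sphere 0 r) (\<lambda>u. W u * X u)" "continuous_on (sphere 0 r) (\<lambda>u. W u * X u powr q)"
    using W X Xq by (auto intro: continuous_on_mult)
  have s0: "0 \<le> s" unfolding s_def using assms by (intro circ_mean_nonneg WX) auto
  have rhs0: "0 \<le> c powr (q - 1) * circ_mean r (\<lambda>u. W u * X u powr q)"
    using assms by (intro mult_nonneg_nonneg circ_mean_nonneg WX) auto
  show ?thesis
  proof (cases "s = 0")
    case True then show ?thesis using rhs0 unfolding s_def by simp
  next
    case False
    with s0 c have m: "0 < m" unfolding m_def by simp
    let ?a = "m powr q - q * m powr (q - 1) * m" and ?b = "q * m powr (q - 1)"
    have "c * m powr q = ?a * c + ?b * s"
      using c by (simp add: m_def field_simps)
    also have "\<dots> = circ_mean r (\<lambda>u. ?a * W u) + circ_mean r (\<lambda>u. ?b * (W u * X u))"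
      unfolding s_def using r W WX c(1) by (simp add: circ_mean_mult_left)
    also have "\<dots> = circ_mean r (\<lambda>u. ?a * W u + ?b * (W u * X u))"
      by (intro circ_mean_add[symmetric] r continuous_on_mult_left W WX)
    also have "\<dots> \<le> circ_mean r (\<lambda>u. W u * X u powr q)"
    proof (rule circ_mean_mono[OF r _ WX(2)])
      show "continuous_on (sphere 0 r) (\<lambda>u. ?a * W u + ?b * (W u * X u))"
        by (intro continuous_on_add continuous_on_mult_left W WX)
      fix u :: complex assume u: "norm u = r"
      have "?a * W u + ?b * (W u * X u) = W u * (m powr q + q * m powr (q - 1) * (X u - m))"
        by (simp add: algebra_simps)
      also have "\<dots> \<le> W u * X u powr q"
        using assms m u by (intro mult_left_mono powr_above_tangent) auto
      finally show "?a * W u + ?b * (W u * X u) \<le> W u * X u powr q" .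
    qed
    finally have "c powr (q - 1) * (c * m powr q) \<le> c powr (q - 1) * circ_mean r (\<lambda>u. W u * X u powr q)"
      by (intro mult_left_mono) auto
    moreover have "c powr (q - 1) * (c * m powr q) = s powr q"
      using c s0 by (simp add: m_def powr_divide powr_diff)
    ultimately show ?thesis unfolding s_def by simp
  qed
qed

text \<open>\<open>add_powr_le\<close> integrated with the two norm bounds as \<open>A\<close> and
  \<open>B\<close>, instead of a detour through Hoelder's inequality. The division by
  \<open>A\<close> and \<open>B\<close> asks for positive bounds, so later uses enlarge them by a
  small \<open>e\<close>.\<close>

lemma circ_mean_Minkowski:
  assumes r: "0 \<le> r" and f: "continuous_on (sphere 0 r) f" and g: "continuous_on (sphere 0 r) g"
    and q: "1 \<le> q" and AB: "0 < A" "0 < B"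
    and fA: "circ_mean r (\<lambda>u. norm (f u) powr q) \<le> A powr q"
    and gB: "circ_mean r (\<lambda>u. norm (g u) powr q) \<le> B powr q"
  shows "circ_mean r (\<lambda>u. norm (f u + g u) powr q) \<le> (A + B) powr q"
proof -
  let ?a = "(A + B) powr (q - 1) * A powr (1 - q)" and ?b = "(A + B) powr (q - 1) * B powr (1 - q)"
  have cf: "continuous_on (sphere 0 r) (\<lambda>u. norm (f u) powr q)"
    and cg: "continuous_on (sphere 0 r) (\<lambda>u. norm (g u) powr q)"
    and cfg: "continuous_on (sphere 0 r) (\<lambda>u. norm (f u + g u) powr q)"
    using q f g by (auto intro!: continuous_on_norm_powr continuous_on_add)
  have "circ_mean r (\<lambda>u. norm (f u + g u) powr q) \<le>
      circ_mean r (\<lambda>u. ?a * norm (f u) powr q + ?b * norm (g u) powr q)"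
  proof (rule circ_mean_mono[OF r cfg])
    show "continuous_on (sphere 0 r) (\<lambda>u. ?a * norm (f u) powr q + ?b * norm (g u) powr q)"
      by (intro continuous_on_add continuous_on_mult_left cf cg)
    fix u
    have "norm (f u + g u) powr q \<le> (norm (f u) + norm (g u)) powr q"
      using q by (intro powr_mono2 norm_triangle_ineq) auto
    also have "\<dots> \<le> (A + B) powr (q - 1) * (A powr (1 - q) * norm (f u) powr q + B powr (1 - q) * norm (g u) powr q)"
      by (rule add_powr_le[OF norm_ge_zero norm_ge_zero AB q])
    finally show "norm (f u + g u) powr q \<le> ?a * norm (f u) powr q + ?b * norm (g u) powr q"
      by (simp add: algebra_simps)
  qed
  also have "\<dots> = ?a * circ_mean r (\<lambda>u. norm (f u) powr q) + ?b * circ_mean r (\<lambda>u. norm (g u) powr q)"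
    by (simp only: circ_mean_add circ_mean_mult_left r cf cg continuous_on_mult_left)
  also have "\<dots> \<le> ?a * A powr q + ?b * B powr q"
    by (intro add_mono mult_left_mono fA gB) auto
  also have "\<dots> = (A + B) powr (q - 1) * (A powr (1 - q) * A powr q + B powr (1 - q) * B powr q)"
    by (simp add: algebra_simps)
  also have "\<dots> = (A + B) powr q"
    using AB by (simp add: powr_diff flip: powr_add)
  finally show ?thesis .
qed

section \<open>The Hardy norms as bounds on circle means\<close>

lemma hardy_norm_le_iff:
  assumes p: "1 \<le> p" and K: "0 \<le> K" and f: "f holomorphic_on unit_disc"
  shows "hardy_norm p f \<le> ennreal K \<longleftrightarrow>
    (if p = \<infinity> then \<forall>w\<in>unit_disc. norm (f w) \<le> K
     else \<forall>r\<in>{0<..<1}. circ_mean r (\<lambda>u. norm (f u) powr enn2real p) \<le> K powr enn2real p)"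
proof (cases "p = \<infinity>")
  case True
  then show ?thesis using K by (auto simp: hardy_norm_def SUP_le_iff)
next
  case False
  define q where "q = enn2real p"
  have q: "1 \<le> q"
    using False p unfolding q_def by (cases p) (auto simp flip: ennreal_1)
  have "integral_mean q f r \<le> K \<longleftrightarrow> circ_mean r (\<lambda>u. norm (f u) powr q) \<le> K powr q"
    if r: "r \<in> {0<..<1}" for r
  proof -
    define c where "c = circ_mean r (\<lambda>u. norm (f u) powr q)"
    have "0 \<le> c" unfolding c_def
      using r q by (intro circ_mean_nonneg continuous_on_norm_powr holomorphic_on_disc_subsets(2)[OF f]) auto
    moreover have "integral_mean q f r = c powr (1 / q)"
      by (simp add: integral_mean_def c_def circ_mean_def)
    ultimately have "integral_mean q f r \<le> K \<longleftrightarrow> (c powr (1 / q)) powr q \<le> K powr q"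
      using q K by (smt (verit) powr_ge_zero powr_less_mono2 powr_mono2)
    also have "(c powr (1 / q)) powr q = c"
      using q \<open>0 \<le> c\<close> by (simp add: powr_powr)
    finally show ?thesis by (simp add: c_def)
  qed
  then show ?thesis
    using False K by (auto simp: hardy_norm_def SUP_le_iff q_def)
qed

lemma hardy_norm_mono:
  assumes p: "1 \<le> p" and f: "f holomorphic_on unit_disc" and g: "g holomorphic_on unit_disc"
    and le: "\<And>w. w \<in> unit_disc \<Longrightarrow> norm (f w) \<le> norm (g w)" and K: "0 \<le> K" "hardy_norm p g \<le> ennreal K"
  shows "hardy_norm p f \<le> ennreal K"
proof (cases "p = \<infinity>")
  case True
  then show ?thesis using K le hardy_norm_le_iff[OF p K(1) f] hardy_norm_le_iff[OF p K(1) g]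
    by (force intro: order_trans)
next
  case False
  then have q: "1 \<le> enn2real p"
    using p by (cases p) (auto simp flip: ennreal_1)
  have "circ_mean r (\<lambda>u. norm (f u) powr enn2real p) \<le> K powr enn2real p" if r: "0 < r" "r < 1" for r
  proof -
    have "circ_mean r (\<lambda>u. norm (f u) powr enn2real p) \<le> circ_mean r (\<lambda>u. norm (g u) powr enn2real p)"
      using r q le
      by (intro circ_mean_mono continuous_on_norm_powr holomorphic_on_disc_subsets(2)[OF f]
          holomorphic_on_disc_subsets(2)[OF g] powr_mono2) auto
    then show ?thesis
      using hardy_norm_le_iff[OF p K(1) g] K False r by force
  qed
  then show ?thesis
    using hardy_norm_le_iff[OF p K(1) f] False by simp
qed

lemma hardy_norm_cmult_le:
  assumes p: "1 \<le> p" and f: "f holomorphic_on unit_disc" and K: "0 \<le> K" "hardy_norm p f \<le> ennreal K"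
  shows "hardy_norm p (\<lambda>w. c * f w) \<le> ennreal (norm c * K)"
proof -
  have cf: "(\<lambda>w. c * f w) holomorphic_on unit_disc"
    using f by (intro holomorphic_intros)
  have cK: "0 \<le> norm c * K" using K by simp
  show ?thesis
  proof (cases "p = \<infinity>")
    case True
    then show ?thesis using K hardy_norm_le_iff[OF p K(1) f] hardy_norm_le_iff[OF p cK cf]
      by (auto simp: norm_mult mult_left_mono)
  next
    case False
    then have q: "1 \<le> enn2real p"
      using p by (cases p) (auto simp flip: ennreal_1)
    have "circ_mean r (\<lambda>u. norm (c * f u) powr enn2real p) \<le> (norm c * K) powr enn2real p" if r: "0 < r" "r < 1" for r
    proof -
      have "circ_mean r (\<lambda>u. norm (c * f u) powr enn2real p) =
         norm c powr enn2real p * circ_mean r (\<lambda>u. norm (f u) powr enn2real p)"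
        unfolding norm_mult powr_mult using r q
        by (intro circ_mean_mult_left continuous_on_norm_powr holomorphic_on_disc_subsets(2)[OF f]) auto
      also have "\<dots> \<le> norm c powr enn2real p * K powr enn2real p"
        using hardy_norm_le_iff[OF p K(1) f] K False r by (intro mult_left_mono) auto
      finally show ?thesis using K by (simp add: powr_mult)
    qed
    then show ?thesis
      using hardy_norm_le_iff[OF p cK cf] False by simp
  qed
qed

lemma hardy_norm_add_le:
  assumes p: "1 \<le> p" and f: "f holomorphic_on unit_disc" and g: "g holomorphic_on unit_disc"
    and A: "0 \<le> A" "hardy_norm p f \<le> ennreal A" and B: "0 \<le> B" "hardy_norm p g \<le> ennreal B"
  shows "hardy_norm p (\<lambda>w. f w + g w) \<le> ennreal (A + B)"
proof -
  have fg: "(\<lambda>w. f w + g w) holomorphic_on unit_disc"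
    using f g by (intro holomorphic_intros)
  have AB: "0 \<le> A + B" using A B by simp
  show ?thesis
  proof (cases "p = \<infinity>")
    case True
    then show ?thesis
      using A B hardy_norm_le_iff[OF p A(1) f] hardy_norm_le_iff[OF p B(1) g] hardy_norm_le_iff[OF p AB fg]
      by (auto intro!: norm_triangle_mono)
  next
    case False
    define q where "q = enn2real p"
    have q: "1 \<le> q" unfolding q_def
      using p False by (cases p) (auto simp flip: ennreal_1)
    have "circ_mean r (\<lambda>u. norm (f u + g u) powr q) \<le> (A + B) powr q" if r: "0 < r" "r < 1" for r
    proof -
      \<comment> \<open>Both bounds are made positive by adding \<open>e\<close>, which then tends
        to 0; this covers \<open>A = 0\<close> and \<open>B = 0\<close>.\<close>
      have *: "circ_mean r (\<lambda>u. norm (f u + g u) powr q) \<le> ((A + e) + (B + e)) powr q" if e: "e > 0" for e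
      proof (rule circ_mean_Minkowski[OF _ holomorphic_on_disc_subsets(2)[OF f r(2)]
            holomorphic_on_disc_subsets(2)[OF g r(2)]])
        have "A powr q \<le> (A + e) powr q" "B powr q \<le> (B + e) powr q"
          using A B e q by (auto intro!: powr_mono2)
        moreover have "circ_mean r (\<lambda>u. norm (f u) powr q) \<le> A powr q"
          "circ_mean r (\<lambda>u. norm (g u) powr q) \<le> B powr q"
          using hardy_norm_le_iff[OF p A(1) f] hardy_norm_le_iff[OF p B(1) g] A B False r
          unfolding q_def by simp_all
        ultimately show "circ_mean r (\<lambda>u. norm (f u) powr q) \<le> (A + e) powr q"
          "circ_mean r (\<lambda>u. norm (g u) powr q) \<le> (B + e) powr q"
          by linarith+
      qed (use r A B e q in simp_all)
      have "((\<lambda>e. ((A + e) + (B + e)) powr q) \<longlongrightarrow> ((A + 0) + (B + 0)) powr q) (at_right 0)"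
        using q A B by (intro tendsto_powr' tendsto_add tendsto_const tendsto_ident_at)
          (auto intro!: eventually_at_rightI[of 0 1])
      then have "circ_mean r (\<lambda>u. norm (f u + g u) powr q) \<le> ((A + 0) + (B + 0)) powr q"
        by (rule tendsto_lowerbound) (use * in \<open>auto intro!: eventually_at_rightI[of 0 1]\<close>)
      then show ?thesis by simp
    qed
    then show ?thesis
      using hardy_norm_le_iff[OF p AB fg] False q_def by simp
  qed
qed

section \<open>Blaschke factors and point evaluation\<close>

lemma Re_szego_denominator_pos:
  assumes "norm a < 1" "norm w \<le> 1"
  shows "0 < Re (1 - cnj a * w)"
proof -
  have "norm (cnj a * w) < 1"
    using assms by (simp add: norm_mult) (metis mult_left_le norm_ge_zero order_le_less_trans)
  then show ?thesis
    using complex_Re_le_cmod[of "cnj a * w"] by simp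
qed

lemma szego_denominator_nonzero:
  assumes "norm a < 1" "norm w \<le> 1"
  shows "1 - cnj a * w \<noteq> 0"
  using Re_szego_denominator_pos[OF assms] by (metis less_irrefl zero_complex.sel(1))

lemma norm_blaschke_factor: "norm (blaschke_factor a w) = norm ((w - a) / (1 - cnj a * w))"
  by (auto simp: blaschke_factor_def norm_mult norm_divide norm_minus_commute)

lemma norm_blaschke_factor_commute: "norm (blaschke_factor a w) = norm (blaschke_factor w a)"
proof -
  have "cnj (1 - cnj a * w) = 1 - cnj w * a" by simp
  then have "norm (1 - cnj a * w) = norm (1 - cnj w * a)" by (metis complex_mod_cnj)
  then show ?thesis by (simp add: norm_blaschke_factor norm_divide norm_minus_commute)
qed

lemma blaschke_factor_holomorphic:
  assumes "a \<in> unit_disc"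
  shows "blaschke_factor a holomorphic_on unit_disc"
proof -
  have "1 - cnj a * w \<noteq> 0" if "w \<in> unit_disc" for w
    using szego_denominator_nonzero[of a w] that assms by simp
  then show ?thesis
    unfolding blaschke_factor_def by (cases "a = 0") (auto intro!: holomorphic_intros)
qed

text \<open>The identity behind all quantitative statements on Blaschke factors. Its right-hand side
  is also the squared modulus of an entry of the Gram matrix of the normalised kernels.\<close>

lemma one_minus_blaschke_factor_square:
  assumes "norm a < 1" "norm w \<le> 1"
  shows "1 - (norm (blaschke_factor a w))\<^sup>2 =
    (1 - (norm a)\<^sup>2) * (1 - (norm w)\<^sup>2) / (norm (1 - cnj a * w))\<^sup>2"
proof -
  have "complex_of_real ((norm (1 - cnj a * w))\<^sup>2 - (norm (w - a))\<^sup>2) =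
      of_real ((1 - (norm a)\<^sup>2) * (1 - (norm w)\<^sup>2))"
    unfolding of_real_diff of_real_mult complex_norm_square by (simp add: algebra_simps)
  then have "(norm (1 - cnj a * w))\<^sup>2 - (norm (w - a))\<^sup>2 = (1 - (norm a)\<^sup>2) * (1 - (norm w)\<^sup>2)"
    by (simp only: of_real_eq_iff)
  moreover have "norm (1 - cnj a * w) \<noteq> 0"
    using szego_denominator_nonzero[OF assms] by simp
  ultimately show ?thesis
    by (simp add: norm_blaschke_factor norm_divide power_divide field_simps)
qed

lemma norm_blaschke_factor_le_1:
  assumes "norm a < 1" "norm w \<le> 1"
  shows "norm (blaschke_factor a w) \<le> 1"
proof -
  have "0 \<le> 1 - (norm (blaschke_factor a w))\<^sup>2"
    unfolding one_minus_blaschke_factor_square[OF assms] using assms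
    by (intro divide_nonneg_nonneg mult_nonneg_nonneg) (auto simp: abs_square_le_1)
  then show ?thesis by (simp add: abs_square_le_1)
qed

lemma blaschke_factor_eq_0_iff:
  assumes "norm a < 1" "norm w \<le> 1"
  shows "blaschke_factor a w = 0 \<longleftrightarrow> w = a"
  using szego_denominator_nonzero[OF assms] norm_blaschke_factor[of a w]
  by (auto simp: norm_divide)

text \<open>From \<open>norm (1 - cnj a * w) \<ge> 1 - norm a\<close>. The constant depends on
  \<open>a\<close> alone, so a fixed factor tends to modulus 1 uniformly at the circle.\<close>

lemma one_minus_blaschke_factor_square_le:
  assumes "norm a < 1" "norm w \<le> 1"
  shows "1 - (norm (blaschke_factor a w))\<^sup>2 \<le> (1 - (norm a)\<^sup>2) / (1 - norm a)\<^sup>2 * (1 - (norm w)\<^sup>2)"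
proof -
  have "norm (cnj a * w) \<le> norm a"
    using assms by (simp add: norm_mult mult_left_le)
  then have "1 - norm a \<le> norm (1 - cnj a * w)"
    using norm_triangle_ineq2[of 1 "cnj a * w"] by simp
  then have "(1 - norm a)\<^sup>2 \<le> (norm (1 - cnj a * w))\<^sup>2"
    using assms by (intro power_mono) auto
  then show ?thesis
    unfolding one_minus_blaschke_factor_square[OF assms] times_divide_eq_left
    using assms by (intro divide_left_mono mult_nonneg_nonneg mult_pos_pos)
      (auto simp: abs_square_le_1 szego_denominator_nonzero zero_less_power2)
qed

text \<open>Weierstrass' product inequality for the squares, followed by \<open>x^2 \<le> x\<close>.
  Squares appear because \<open>1 - x^2\<close> is the quantity with an exact formula.\<close>

lemma prod_ge_one_minus_sum_square:
  fixes x :: "'i \<Rightarrow> real"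
  assumes "\<And>i. i \<in> I \<Longrightarrow> 0 \<le> x i \<and> x i \<le> 1"
  shows "1 - (\<Sum>i\<in>I. 1 - (x i)\<^sup>2) \<le> (\<Prod>i\<in>I. x i)"
proof -
  have "1 - (\<Sum>i\<in>I. 1 - (x i)\<^sup>2) \<le> (\<Prod>i\<in>I. 1 - (1 - (x i)\<^sup>2))"
    using assms by (intro Weierstrass_prod_ineq) (auto simp: abs_square_le_1)
  also have "\<dots> \<le> (\<Prod>i\<in>I. x i)"
    using assms by (intro prod_mono) (auto simp: power2_eq_square mult_left_le)
  finally show ?thesis .
qed

text \<open>A finite product approaches modulus 1 at the circle with a linear rate. This has two
  uses: zeros can be divided out without raising a norm, and the initial points of a sequence do not
  affect thinness.\<close>

lemma finite_blaschke_lower_bound: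
  assumes "finite A" "A \<subseteq> unit_disc"
  obtains C where "0 \<le> C" "\<And>w. norm w \<le> 1 \<Longrightarrow> 1 - C * (1 - (norm w)\<^sup>2) \<le> (\<Prod>a\<in>A. norm (blaschke_factor a w))"
proof
  let ?C = "\<Sum>a\<in>A. (1 - (norm a)\<^sup>2) / (1 - norm a)\<^sup>2"
  show "0 \<le> ?C" using assms by (intro sum_nonneg) (auto simp: abs_square_le_1 subset_eq less_imp_le)
  fix w :: complex assume w: "norm w \<le> 1"
  have "(\<Sum>a\<in>A. 1 - (norm (blaschke_factor a w))\<^sup>2) \<le> ?C * (1 - (norm w)\<^sup>2)"
    unfolding sum_distrib_right using assms w
    by (intro sum_mono one_minus_blaschke_factor_square_le) auto
  moreover have "1 - (\<Sum>a\<in>A. 1 - (norm (blaschke_factor a w))\<^sup>2) \<le> (\<Prod>a\<in>A. norm (blaschke_factor a w))"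
    using assms w by (intro prod_ge_one_minus_sum_square) (auto simp: subset_eq norm_blaschke_factor_le_1)
  ultimately show "1 - ?C * (1 - (norm w)\<^sup>2) \<le> (\<Prod>a\<in>A. norm (blaschke_factor a w))"
    by linarith
qed

lemma prod_blaschke_factor_le_1:
  assumes "A \<subseteq> unit_disc" "norm w \<le> 1"
  shows "(\<Prod>a\<in>A. norm (blaschke_factor a w)) \<le> 1"
  using assms by (intro prod_le_1) (auto simp: subset_eq norm_blaschke_factor_le_1)

text \<open>One zero at a time. The product over the earlier zeros does not vanish at the new zero
  \<open>a\<close>, so the quotient found so far does, and its difference quotient at
  \<open>a\<close> is holomorphic.\<close>

lemma holomorphic_divide_blaschke:
  assumes "finite A" "A \<subseteq> unit_disc" "f holomorphic_on unit_disc" "\<And>a. a \<in> A \<Longrightarrow> f a = 0"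
  obtains g where "g holomorphic_on unit_disc"
    "\<And>w. w \<in> unit_disc \<Longrightarrow> f w = (\<Prod>a\<in>A. blaschke_factor a w) * g w"
proof -
  have "\<exists>g. g holomorphic_on unit_disc \<and> (\<forall>w\<in>unit_disc. f w = (\<Prod>a\<in>A. blaschke_factor a w) * g w)"
    using assms
  proof (induction A rule: finite_induct)
    case empty
    then show ?case by auto
  next
    case (insert a A)
    then obtain g where g: "g holomorphic_on unit_disc"
      and fg: "\<And>w. w \<in> unit_disc \<Longrightarrow> f w = (\<Prod>a\<in>A. blaschke_factor a w) * g w"
      by auto
    have a: "norm a < 1" using insert by simp
    have "(\<Prod>b\<in>A. blaschke_factor b a) \<noteq> 0"
      using insert by (auto simp: blaschke_factor_eq_0_iff subset_eq)
    then have ga: "g a = 0"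
      using fg[of a] insert by auto
    define g1 where "g1 = (\<lambda>w. if w = a then deriv g a else (g w - g a) / (w - a))"
    have g1: "g1 holomorphic_on unit_disc"
      unfolding g1_def by (rule pole_lemma_open[OF g]) auto
    \<comment> \<open>Inverts the constant in \<open>blaschke_factor\<close>, including the sign
      between \<open>a - w\<close> and \<open>w - a\<close>:
      \<open>blaschke_factor a w * (c * (1 - cnj a * w)) = w - a\<close>.\<close>
    define c where "c = (if a = 0 then 1 else - (a / of_real (norm a)))"
    define h where "h = (\<lambda>w. c * (1 - cnj a * w) * g1 w)"
    have "h holomorphic_on unit_disc"
      unfolding h_def by (intro holomorphic_intros g1)
    moreover have "g w = blaschke_factor a w * h w" if "w \<in> unit_disc" for w
    proof (cases "w = a")
      case True
      then show ?thesis using ga a blaschke_factor_eq_0_iff[of a a] by simp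
    next
      case False
      have "1 - cnj a * w \<noteq> 0"
        using szego_denominator_nonzero[OF a] that by simp
      then have "blaschke_factor a w * (c * (1 - cnj a * w)) = w - a"
        by (auto simp: blaschke_factor_def c_def)
      then have "blaschke_factor a w * h w = (w - a) * g1 w"
        by (simp add: h_def flip: mult.assoc)
      then show ?thesis using False ga by (simp add: g1_def)
    qed
    ultimately show ?case
      using insert fg by (intro exI[of _ h]) simp
  qed
  then show ?thesis using that by blast
qed

section \<open>Szego kernels and the sharp growth estimate\<close>

lemma szego_kernel_holomorphic: "norm a < 1 \<Longrightarrow> szego_kernel a holomorphic_on unit_disc"
  unfolding szego_kernel_def using szego_denominator_nonzero
  by (auto intro!: holomorphic_intros)

lemma circ_mean_of_real:
  assumes "0 \<le> r" "continuous_on (sphere 0 r) F"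
  shows "circ_mean r (\<lambda>u. complex_of_real (F u)) = of_real (circ_mean r F)"
  by (rule circ_mean_bounded_linear[OF bounded_linear_of_real assms])

lemma circ_mean_szego_kernel_square:
  assumes r: "0 < r" "r < 1" and w: "norm w < 1"
  shows "circ_mean r (\<lambda>u. (norm (szego_kernel w u))\<^sup>2) = 1 / (1 - r\<^sup>2 * (norm w)\<^sup>2)"
proof -
  have hol: "szego_kernel w holomorphic_on unit_disc"
    by (rule szego_kernel_holomorphic[OF w])
  have "norm w * r < 1"
    using mult_strict_mono[of "norm w" 1 r 1] r w by simp
  then have "circ_mean r (\<lambda>u. szego_kernel w u * cnj (szego_kernel w u)) = szego_kernel w (of_real (r\<^sup>2) * w)"
    by (rule circ_mean_reproducing[OF hol r])
  also have "cnj w * (of_real (r\<^sup>2) * w) = of_real (r\<^sup>2 * (norm w)\<^sup>2)"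
    unfolding of_real_mult complex_norm_square by simp
  then have "szego_kernel w (of_real (r\<^sup>2) * w) = of_real (1 / (1 - r\<^sup>2 * (norm w)\<^sup>2))"
    unfolding szego_kernel_def by simp
  finally have "circ_mean r (\<lambda>u. complex_of_real ((norm (szego_kernel w u))\<^sup>2)) = of_real (1 / (1 - r\<^sup>2 * (norm w)\<^sup>2))"
    by (simp only: complex_norm_square)
  moreover have "circ_mean r (\<lambda>u. complex_of_real ((norm (szego_kernel w u))\<^sup>2)) =
      of_real (circ_mean r (\<lambda>u. (norm (szego_kernel w u))\<^sup>2))"
    using r by (intro circ_mean_of_real continuous_on_power continuous_on_norm holomorphic_on_disc_subsets(2)[OF hol]) auto
  ultimately show ?thesis by (simp only: of_real_eq_iff)
qed

text \<open>The real power \<open>c\<close> of \<open>1 - cnj a * u\<close>, taken with the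
  principal logarithm; it is holomorphic on the disc because \<open>1 - cnj a * u\<close> stays in
  the right half-plane.\<close>

definition szego_power :: "real \<Rightarrow> complex \<Rightarrow> complex \<Rightarrow> complex" where
  "szego_power c a u = exp (of_real c * Ln (1 - cnj a * u))"

lemma szego_power_holomorphic:
  assumes "norm a < 1"
  shows "szego_power c a holomorphic_on unit_disc"
proof -
  have "1 - cnj a * u \<notin> \<real>\<^sub>\<le>\<^sub>0" if "u \<in> unit_disc" for u
    using Re_szego_denominator_pos[OF assms, of u] that complex_nonpos_Reals_iff by force
  then show ?thesis
    unfolding szego_power_def by (auto intro!: holomorphic_intros)
qed

lemma norm_szego_power:
  assumes "norm a < 1" "norm u \<le> 1"
  shows "norm (szego_power c a u) = norm (1 - cnj a * u) powr c"
  using szego_denominator_nonzero[OF assms]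
  by (simp add: szego_power_def powr_def)

lemma szego_power_diagonal:
  assumes "norm a < 1"
  shows "szego_power c a a = of_real ((1 - (norm a)\<^sup>2) powr c)"
proof -
  have pos: "0 < 1 - (norm a)\<^sup>2" using assms by (simp add: abs_square_less_1)
  have "1 - cnj a * a = of_real (1 - (norm a)\<^sup>2)"
    unfolding of_real_diff complex_norm_square by (simp add: mult.commute)
  then show ?thesis
    using pos by (simp add: szego_power_def powr_def Ln_of_real exp_of_real flip: of_real_mult del: of_real_diff)
qed

text \<open>The reproducing formula is applied to \<open>f (1 - cnj w u)\<^bsup>2/q - 1\<^esup>\<close>; Jensen's inequality for the
  weight \<open>|k\<^sub>w|\<^sup>2\<close> then gives the sharp constant.\<close>

lemma norm_powr_le_circ_mean:
  assumes f: "f holomorphic_on unit_disc" and r: "0 < r" "r < 1" and w: "norm w < 1" and q: "1 \<le> q"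
  shows "norm (f (of_real (r\<^sup>2) * w)) powr q * (1 - r\<^sup>2 * (norm w)\<^sup>2) \<le> circ_mean r (\<lambda>u. norm (f u) powr q)"
proof -
  define v where "v = of_real (r\<^sup>2) * w"
  define D where "D = 1 - r\<^sup>2 * (norm w)\<^sup>2"
  have rw: "norm w * r < 1"
    using mult_strict_mono[of "norm w" 1 r 1] r w by simp
  then have D: "0 < D" unfolding D_def
    using r by (simp add: abs_square_less_1 mult.commute abs_mult flip: power_mult_distrib)
  have v: "norm v < 1"
    using rw r mult_strict_mono[of "norm w * r" 1 r 1] by (simp add: v_def norm_mult power2_eq_square mult_ac)
  have Dv: "1 - cnj w * v = of_real D"
    unfolding v_def D_def of_real_diff of_real_mult complex_norm_square by simp
  have hol: "(\<lambda>u. f u * szego_power (2 / q - 1) w u) holomorphic_on unit_disc"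
    by (intro holomorphic_on_mult f szego_power_holomorphic w)
  have hk: "szego_kernel w holomorphic_on unit_disc"
    by (rule szego_kernel_holomorphic[OF w])
  have spos: "norm (1 - cnj w * u) > 0" if "norm u = r" for u
    using szego_denominator_nonzero[OF w, of u] that r by simp
  \<comment> \<open>The exponent \<open>2 / q\<close> is placed in \<open>X\<close> so that
    \<open>W * X powr q\<close> is exactly \<open>|f| powr q\<close>, while \<open>W * X\<close> is
    the modulus of the integrand in the reproducing formula.\<close>
  define W where "W = (\<lambda>u. (norm (szego_kernel w u))\<^sup>2)"
  define X where "X = (\<lambda>u. norm (f u) * norm (1 - cnj w * u) powr (2 / q))"
  have cW: "continuous_on (sphere 0 r) W" unfolding W_def
    by (intro continuous_intros holomorphic_on_disc_subsets(2)[OF hk] r)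
  have cX: "continuous_on (sphere 0 r) X" unfolding X_def
    using q by (intro continuous_on_mult continuous_on_norm holomorphic_on_disc_subsets(2)[OF f] r
      continuous_on_powr_const continuous_intros) auto
  have "norm (f v * szego_power (2 / q - 1) w v) =
      norm (circ_mean r (\<lambda>u. (f u * szego_power (2 / q - 1) w u) * cnj (szego_kernel w u)))"
    unfolding v_def circ_mean_reproducing[OF hol r rw] ..
  also have "\<dots> \<le> circ_mean r (\<lambda>u. norm ((f u * szego_power (2 / q - 1) w u) * cnj (szego_kernel w u)))"
    using r by (intro norm_circ_mean_le continuous_on_mult continuous_on_cnj
        holomorphic_on_disc_subsets(2)[OF hk] holomorphic_on_disc_subsets(2)[OF hol]
        holomorphic_on_disc_subsets(2)[OF f] holomorphic_on_disc_subsets(2)[OF szego_power_holomorphic[OF w]]) auto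
  also have "\<dots> = circ_mean r (\<lambda>u. W u * X u)"
  proof (rule circ_mean_cong)
    fix u :: complex assume u: "norm u = r"
    show "norm ((f u * szego_power (2 / q - 1) w u) * cnj (szego_kernel w u)) = W u * X u"
      using spos[OF u] norm_szego_power[OF w, of u "2 / q - 1"] u r
      unfolding norm_mult complex_mod_cnj
      by (simp add: W_def X_def norm_mult szego_kernel_def norm_divide powr_diff power2_eq_square)
  qed (use r in simp)
  finally have "norm (f v) * D powr (2 / q - 1) \<le> circ_mean r (\<lambda>u. W u * X u)"
    using norm_szego_power[OF w, of v "2 / q - 1"] v D by (simp add: norm_mult Dv)
  then have "(norm (f v) * D powr (2 / q - 1)) powr q \<le> circ_mean r (\<lambda>u. W u * X u) powr q"
    using q by (intro powr_mono2) auto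
  also have "\<dots> \<le> (1 / D) powr (q - 1) * circ_mean r (\<lambda>u. W u * X u powr q)"
    using r q D circ_mean_szego_kernel_square[OF r w]
    by (intro circ_mean_powr_Jensen cW cX) (auto simp: W_def X_def D_def)
  also have "circ_mean r (\<lambda>u. W u * X u powr q) = circ_mean r (\<lambda>u. norm (f u) powr q)"
  proof (rule circ_mean_cong)
    fix u :: complex assume u: "norm u = r"
    show "W u * X u powr q = norm (f u) powr q"
      using spos[OF u] q
      by (simp add: W_def X_def powr_mult powr_powr szego_kernel_def norm_divide power_divide)
  qed (use r in simp)
  also have "(norm (f v) * D powr (2 / q - 1)) powr q = (1 / D) powr (q - 1) * (norm (f v) powr q * D)"
  proof -
    have e: "(2 / q - 1) * q = 1 + (1 - q)"
      using q by (simp add: field_simps)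
    have "(D powr (2 / q - 1)) powr q = D powr (1 + (1 - q))"
      unfolding powr_powr e ..
    also have "\<dots> = D powr (1 - q) * D"
      unfolding powr_add using D by simp
    finally have "(norm (f v) * D powr (2 / q - 1)) powr q = norm (f v) powr q * (D powr (1 - q) * D)"
      by (simp add: powr_mult)
    also have "D powr (1 - q) = (1 / D) powr (q - 1)"
      using D by (simp add: powr_divide powr_diff)
    finally show ?thesis by (simp add: mult_ac)
  qed
  finally show ?thesis
    using D by (simp add: v_def D_def)
qed

lemma one_le_enn2real: "1 \<le> p \<Longrightarrow> p \<noteq> \<infinity> \<Longrightarrow> 1 \<le> enn2real p"
  by (cases p) (auto simp flip: ennreal_1)

lemma enn2real_inverse_exponent:
  "1 \<le> p \<Longrightarrow> enn2real (1 / p) = (if p = \<infinity> then 0 else 1 / enn2real p)"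
  by (cases p) (auto simp: divide_ennreal simp flip: ennreal_1)

text \<open>The argument \<open>r^2 w\<close> is the point at which means over the circle of radius
  \<open>r\<close> evaluate; this is how estimates on circles turn into estimates at
  \<open>w\<close>.\<close>

lemma tendsto_dilation:
  assumes "g holomorphic_on unit_disc" "w \<in> unit_disc"
  shows "((\<lambda>r. g (of_real (r\<^sup>2) * w)) \<longlongrightarrow> g w) (at_left (1::real))"
proof -
  have "isCont g w"
    using assms holomorphic_on_imp_continuous_on continuous_on_eq_continuous_at[OF open_ball] by blast
  then show ?thesis
    by (rule isCont_tendsto_compose) (auto intro!: tendsto_eq_intros)
qed

text \<open>Writing \<open>f = B g\<close> with \<open>B\<close> the finite Blaschke product over
  \<open>A\<close>, the modulus of \<open>B\<close> tends to 1 at the circle, so \<open>g\<close>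
  obeys the bound \<open>K\<close> as well; the growth estimate for \<open>g\<close> at
  \<open>w\<close> then gains the factor \<open>|B w|\<close>. With \<open>A\<close> empty it bounds
  Hardy functions locally uniformly.\<close>

theorem hardy_point_evaluation:
  assumes p: "1 \<le> p" and f: "f holomorphic_on unit_disc"
    and K: "0 \<le> K" "hardy_norm p f \<le> ennreal K"
    and A: "finite A" "A \<subseteq> unit_disc" "\<And>a. a \<in> A \<Longrightarrow> f a = 0" and w: "w \<in> unit_disc"
  shows "norm (f w) * (1 - (norm w)\<^sup>2) powr enn2real (1 / p) \<le> K * (\<Prod>a\<in>A. norm (blaschke_factor a w))"
proof -
  obtain g where g: "g holomorphic_on unit_disc"
    and fg: "\<And>w. w \<in> unit_disc \<Longrightarrow> f w = (\<Prod>a\<in>A. blaschke_factor a w) * g w"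
    using holomorphic_divide_blaschke[OF A(1,2) f A(3)] by blast
  obtain C where C: "0 \<le> C" and bC: "\<And>w. norm w \<le> 1 \<Longrightarrow> 1 - C * (1 - (norm w)\<^sup>2) \<le> (\<Prod>a\<in>A. norm (blaschke_factor a w))"
    using finite_blaschke_lower_bound[OF A(1,2)] by blast
  have lim: "((\<lambda>r. 1 - C * (1 - r\<^sup>2)) \<longlongrightarrow> 1 - C * (1 - 1\<^sup>2)) (at_left (1::real))"
    by (intro tendsto_intros)
  then have ev: "eventually (\<lambda>r. 0 < r \<and> r < 1 \<and> 1 - C * (1 - r\<^sup>2) > 0) (at_left (1::real))"
    using order_tendstoD(1)[OF lim, of 0] eventually_at_left_real[of 0 "1::real"]
    by (auto elim: eventually_elim2)
  have gle: "norm (g u) \<le> norm (f u) / (1 - C * (1 - r\<^sup>2))"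
    if "norm u = r" "0 < r" "r < 1" "1 - C * (1 - r\<^sup>2) > 0" for u :: complex and r
  proof -
    have "(1 - C * (1 - r\<^sup>2)) * norm (g u) \<le> (\<Prod>a\<in>A. norm (blaschke_factor a u)) * norm (g u)"
      using bC[of u] that by (intro mult_right_mono) auto
    then show ?thesis using fg[of u] that by (simp add: norm_mult prod_norm field_simps)
  qed
  have "norm (g w) * (1 - (norm w)\<^sup>2) powr enn2real (1 / p) \<le> K"
  proof (cases "p = \<infinity>")
    case True
    then have fK: "norm (f u) \<le> K" if "u \<in> unit_disc" for u
      using hardy_norm_le_iff[OF p K(1) f] K that by simp
    have "norm w < 1" using w by simp
    \<comment> \<open>For \<open>p = \<infinity>\<close> the maximum principle on
      \<open>cball 0 r\<close> takes the place of the growth estimate, so \<open>r\<close> has to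
      exceed \<open>norm w\<close>.\<close>
    from ev eventually_at_left_real[OF this]
    have "eventually (\<lambda>r. norm (g w) \<le> K / (1 - C * (1 - r\<^sup>2))) (at_left (1::real))"
    proof eventually_elim
      case 1: (elim r)
      show ?case
      proof (rule maximum_modulus_frontier[of g "cball 0 r"])
        show "g holomorphic_on interior (cball 0 r)" "continuous_on (closure (cball 0 r)) g"
          using holomorphic_on_disc_subsets[OF g, of r] 1 by auto
        fix u :: complex assume "u \<in> frontier (cball 0 r)"
        then have u: "norm u = r" by simp
        have "norm (g u) \<le> norm (f u) / (1 - C * (1 - r\<^sup>2))" using gle u 1 by blast
        also have "\<dots> \<le> K / (1 - C * (1 - r\<^sup>2))"
          using fK[of u] u 1 by (intro divide_right_mono) auto
        finally show "norm (g u) \<le> K / (1 - C * (1 - r\<^sup>2))" .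
      qed (use 1 in auto)
    qed
    moreover have "((\<lambda>r. K / (1 - C * (1 - r\<^sup>2))) \<longlongrightarrow> K / (1 - C * (1 - 1\<^sup>2))) (at_left (1::real))"
      by (intro tendsto_intros) auto
    ultimately have "norm (g w) \<le> K / (1 - C * (1 - 1\<^sup>2))"
      by (intro tendsto_lowerbound[where F = "at_left (1::real)"]) auto
    then show ?thesis using True w K by (simp add: enn2real_inverse_exponent[OF p])
  next
    case False
    define q where "q = enn2real p"
    have q: "1 \<le> q" unfolding q_def using p False by (rule one_le_enn2real)
    have "eventually (\<lambda>r. norm (g (of_real (r\<^sup>2) * w)) powr q * (1 - r\<^sup>2 * (norm w)\<^sup>2) \<le> (K / (1 - C * (1 - r\<^sup>2))) powr q) (at_left (1::real))"
      using ev
    proof eventually_elim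
      case (elim r)
      let ?c = "1 - C * (1 - r\<^sup>2)"
      have "norm (g (of_real (r\<^sup>2) * w)) powr q * (1 - r\<^sup>2 * (norm w)\<^sup>2) \<le> circ_mean r (\<lambda>u. norm (g u) powr q)"
        using elim w q by (intro norm_powr_le_circ_mean g) auto
      also have "\<dots> \<le> circ_mean r (\<lambda>u. (1 / ?c) powr q * norm (f u) powr q)"
      proof (rule circ_mean_mono)
        fix u :: complex assume "norm u = r"
        then have "norm (g u) powr q \<le> (norm (f u) / ?c) powr q"
          using gle elim q by (intro powr_mono2) auto
        then show "norm (g u) powr q \<le> (1 / ?c) powr q * norm (f u) powr q"
          using elim by (simp add: powr_divide)
      qed (use elim q in \<open>auto intro!: continuous_on_mult_left continuous_on_norm_powr
          holomorphic_on_disc_subsets(2)[OF f] holomorphic_on_disc_subsets(2)[OF g]\<close>)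
      also have "\<dots> = (1 / ?c) powr q * circ_mean r (\<lambda>u. norm (f u) powr q)"
        using elim q by (intro circ_mean_mult_left continuous_on_norm_powr holomorphic_on_disc_subsets(2)[OF f]) auto
      also have "\<dots> \<le> (1 / ?c) powr q * K powr q"
        using hardy_norm_le_iff[OF p K(1) f] K False elim by (intro mult_left_mono) (auto simp: q_def)
      also have "\<dots> = (K / ?c) powr q"
        using elim K by (simp add: powr_divide)
      finally show ?case .
    qed
    moreover have "((\<lambda>r. (K / (1 - C * (1 - r\<^sup>2))) powr q) \<longlongrightarrow> (K / (1 - C * (1 - 1\<^sup>2))) powr q) (at_left (1::real))"
      using q K ev by (intro tendsto_powr' tendsto_intros) (auto elim: eventually_mono)
    moreover have "((\<lambda>r. norm (g (of_real (r\<^sup>2) * w)) powr q * (1 - r\<^sup>2 * (norm w)\<^sup>2)) \<longlongrightarrow>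
        norm (g (of_real (1\<^sup>2) * w)) powr q * (1 - 1\<^sup>2 * (norm w)\<^sup>2)) (at_left (1::real))"
    proof -
      have "((\<lambda>r. g (of_real (r\<^sup>2) * w)) \<longlongrightarrow> g w) (at_left (1::real))"
        by (rule tendsto_dilation[OF g w])
      then show ?thesis
        using q by (intro tendsto_powr' tendsto_intros) auto
    qed
    ultimately have "norm (g (of_real (1\<^sup>2) * w)) powr q * (1 - 1\<^sup>2 * (norm w)\<^sup>2) \<le> (K / (1 - C * (1 - 1\<^sup>2))) powr q"
      by (intro tendsto_le[where F = "at_left (1::real)"]) auto
    then have le: "norm (g w) powr q * (1 - (norm w)\<^sup>2) \<le> K powr q" by simp
    have "0 < 1 - (norm w)\<^sup>2" using w by (simp add: abs_square_less_1)
    then have "(norm (g w) * (1 - (norm w)\<^sup>2) powr (1 / q)) powr q = norm (g w) powr q * (1 - (norm w)\<^sup>2)"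
      using q by (simp add: powr_mult powr_powr)
    with le have "(norm (g w) * (1 - (norm w)\<^sup>2) powr (1 / q)) powr q \<le> K powr q" by simp
    then have "norm (g w) * (1 - (norm w)\<^sup>2) powr (1 / q) \<le> K"
      using q K by (smt (verit) powr_less_mono2)
    then show ?thesis using False by (simp add: enn2real_inverse_exponent[OF p] q_def)
  qed
  then have "(\<Prod>a\<in>A. norm (blaschke_factor a w)) * (norm (g w) * (1 - (norm w)\<^sup>2) powr enn2real (1 / p)) \<le>
      (\<Prod>a\<in>A. norm (blaschke_factor a w)) * K"
    by (intro mult_left_mono prod_nonneg) auto
  then show ?thesis using fg[OF w] by (simp add: norm_mult prod_norm mult_ac)
qed

section \<open>Normal families with norm bounds\<close>

lemma hardy_norm_limit:
  assumes p: "1 \<le> p" and f: "\<And>n. f n holomorphic_on unit_disc" and g: "g holomorphic_on unit_disc"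
    and K: "0 \<le> K" "\<And>n::nat. hardy_norm p (f n) \<le> ennreal K"
    and lim: "\<And>X. compact X \<Longrightarrow> X \<subseteq> unit_disc \<Longrightarrow> uniform_limit X f g sequentially"
  shows "hardy_norm p g \<le> ennreal K"
proof (cases "p = \<infinity>")
  case True
  have "norm (g w) \<le> K" if "w \<in> unit_disc" for w
  proof -
    have "(\<lambda>n. f n w) \<longlonglongrightarrow> g w"
      using lim[of "{w}"] that by (intro tendsto_uniform_limitI[where S = "{w}"]) auto
    then show ?thesis
      using K hardy_norm_le_iff[OF p K(1) f] True that
      by (intro tendsto_upperbound[OF tendsto_norm]) auto
  qed
  then show ?thesis using hardy_norm_le_iff[OF p K(1) g] True by simp
next
  case False
  define q where "q = enn2real p"
  have q: "1 \<le> q" unfolding q_def using p False by (rule one_le_enn2real)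
  have "circ_mean r (\<lambda>u. norm (g u) powr q) \<le> K powr q" if r: "0 < r" "r < 1" for r
  proof -
    have cont: "continuous_on (sphere 0 r) (\<lambda>u. g u - f n u)" for n
      by (intro continuous_on_diff holomorphic_on_disc_subsets(2)[OF f] holomorphic_on_disc_subsets(2)[OF g] r)
    \<comment> \<open>Convergence is uniform on the circle, so some \<open>f n\<close> differs from
      \<open>g\<close> by less than \<open>e\<close> there, and Minkowski's inequality adds the two
      bounds; this replaces Fatou's lemma.\<close>
    have *: "circ_mean r (\<lambda>u. norm (g u) powr q) \<le> ((K + e) + e) powr q" if e: "e > 0" for e
    proof -
      have "uniform_limit (sphere 0 r) f g sequentially"
        using r by (intro lim) auto
      from eventually_happens'[OF sequentially_bot uniform_limitD[OF this e]]
      obtain n where n: "\<forall>u\<in>sphere 0 r. dist (f n u) (g u) < e" by blast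
      have "circ_mean r (\<lambda>u. norm (f n u + (g u - f n u)) powr q) \<le> ((K + e) + e) powr q"
      proof (rule circ_mean_Minkowski[OF _ holomorphic_on_disc_subsets(2)[OF f r(2)] cont])
        have "K powr q \<le> (K + e) powr q"
          using K e q by (auto intro!: powr_mono2)
        moreover have "circ_mean r (\<lambda>u. norm (f n u) powr q) \<le> K powr q"
          using hardy_norm_le_iff[OF p K(1) f] K(2)[of n] False r unfolding q_def by simp
        ultimately show "circ_mean r (\<lambda>u. norm (f n u) powr q) \<le> (K + e) powr q" by linarith
        show "circ_mean r (\<lambda>u. norm (g u - f n u) powr q) \<le> e powr q"
          using r q n
          by (intro circ_mean_le_const continuous_on_norm_powr cont powr_mono2)
             (auto simp: dist_norm norm_minus_commute less_imp_le)
      qed (use r K e q in simp_all)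
      then show ?thesis by simp
    qed
    have "((\<lambda>e. ((K + e) + e) powr q) \<longlongrightarrow> ((K + 0) + 0) powr q) (at_right 0)"
      using q K by (intro tendsto_powr' tendsto_add tendsto_const tendsto_ident_at)
        (auto intro!: eventually_at_rightI[of 0 1])
    then have "circ_mean r (\<lambda>u. norm (g u) powr q) \<le> ((K + 0) + 0) powr q"
      by (rule tendsto_lowerbound) (use * in \<open>auto intro!: eventually_at_rightI[of 0 1]\<close>)
    then show ?thesis by simp
  qed
  then show ?thesis
    using hardy_norm_le_iff[OF p K(1) g] False q_def by simp
qed

text \<open>Point evaluation bounds the sequence on compact sets, so Montel's theorem applies. The
  limit inherits the bound with the same \<open>K\<close>, which keeps the interpolation constants
  sharp.\<close>

lemma hardy_norm_Montel:
  fixes f :: "nat \<Rightarrow> complex \<Rightarrow> complex"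
  assumes p: "1 \<le> p" and f: "\<And>n. f n holomorphic_on unit_disc"
    and K: "0 \<le> K" "\<And>n. hardy_norm p (f n) \<le> ennreal K"
  obtains g r where "g holomorphic_on unit_disc" "strict_mono (r :: nat \<Rightarrow> nat)"
    "\<And>w. w \<in> unit_disc \<Longrightarrow> (\<lambda>n. f (r n) w) \<longlonglongrightarrow> g w"
    "\<And>X. compact X \<Longrightarrow> X \<subseteq> unit_disc \<Longrightarrow> uniform_limit X (\<lambda>n. f (r n)) g sequentially"
    "hardy_norm p g \<le> ennreal K"
proof -
  have bdd: "\<exists>B. \<forall>h\<in>range f. \<forall>w\<in>X. norm (h w) \<le> B" if X: "compact X" "X \<subseteq> unit_disc" for X
  proof -
    let ?F = "\<lambda>w. K / (1 - (norm w)\<^sup>2) powr enn2real (1 / p)"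
    have pos: "0 < 1 - (norm w)\<^sup>2" if "w \<in> X" for w
      using that X by (auto simp: abs_square_less_1 subset_eq)
    have "continuous_on X ?F"
      using pos by (intro continuous_intros) fastforce+
    then obtain B where B: "\<And>w. w \<in> X \<Longrightarrow> ?F w \<le> B"
      using compact_imp_bounded[OF compact_continuous_image[OF _ X(1), of ?F]]
      unfolding bounded_iff by (metis abs_le_D1 imageI real_norm_def)
    have "norm (f n w) \<le> B" if w: "w \<in> X" for n w
    proof -
      have "norm (f n w) * (1 - (norm w)\<^sup>2) powr enn2real (1 / p) \<le> K * (\<Prod>a\<in>{}. norm (blaschke_factor a w))"
        using X w K by (intro hardy_point_evaluation p f) auto
      then have "norm (f n w) \<le> ?F w"
        using pos[OF w] by (simp add: field_simps)
      with B[OF w] show ?thesis by simp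
    qed
    then show ?thesis by blast
  qed
  obtain g r where *: "g holomorphic_on unit_disc" "strict_mono (r :: nat \<Rightarrow> nat)"
    "\<And>w. w \<in> unit_disc \<Longrightarrow> (\<lambda>n. f (r n) w) \<longlonglongrightarrow> g w"
    "\<And>X. compact X \<Longrightarrow> X \<subseteq> unit_disc \<Longrightarrow> uniform_limit X (f \<circ> r) g sequentially"
    using Montel[OF open_ball _ bdd subset_refl] f by blast
  have lim: "uniform_limit X (\<lambda>n. f (r n)) g sequentially" if "compact X" "X \<subseteq> unit_disc" for X
    using *(4)[OF that] by (simp add: o_def)
  have "hardy_norm p g \<le> ennreal K"
    by (rule hardy_norm_limit[OF p f *(1) K lim])
  with * lim show ?thesis using that by blast
qed

section \<open>The telescoping family\<close>

text \<open>A Cayley transform of \<open>cnj a * w\<close>, hence with nonnegative real part on the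
  disc. The factor \<open>1 - |a|^2\<close> normalises its value at \<open>a\<close> to
  \<open>1 + |a|^2\<close>.\<close>

definition half_plane_map :: "complex \<Rightarrow> complex \<Rightarrow> complex" where
  "half_plane_map a w = of_real (1 - (norm a)\<^sup>2) * ((1 + cnj a * w) / (1 - cnj a * w))"

lemma Re_half_plane_map:
  assumes "norm a < 1" "norm w < 1"
  shows "Re (half_plane_map a w) =
    (1 - (norm a)\<^sup>2) * (1 - (norm a)\<^sup>2 * (norm w)\<^sup>2) / (norm (1 - cnj a * w))\<^sup>2"
proof -
  let ?t = "cnj a * w"
  have "Re ((1 + ?t) / (1 - ?t)) = Re ((1 + ?t) * cnj (1 - ?t)) / (norm (1 - ?t))\<^sup>2"
    by (simp add: Re_complex_div_eq_0 complex_div_cnj[of "1 + ?t"] flip: of_real_power)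
  also have "Re ((1 + ?t) * cnj (1 - ?t)) = 1 - (norm ?t)\<^sup>2"
    unfolding cmod_power2 by (simp add: algebra_simps power2_eq_square)
  also have "(norm ?t)\<^sup>2 = (norm a)\<^sup>2 * (norm w)\<^sup>2"
    by (simp add: norm_mult power_mult_distrib)
  finally have *: "Re ((1 + ?t) / (1 - ?t)) = (1 - (norm a)\<^sup>2 * (norm w)\<^sup>2) / (norm (1 - ?t))\<^sup>2" .
  have "Re (of_real c * h) = c * Re h" for c h by simp
  from this[of "1 - (norm a)\<^sup>2"] show ?thesis
    unfolding half_plane_map_def * by (simp only: * times_divide_eq_right[symmetric])
qed

lemma Re_half_plane_map_nonneg:
  assumes "norm a < 1" "norm w < 1"
  shows "0 \<le> Re (half_plane_map a w)"
proof -
  have "(norm a)\<^sup>2 * (norm w)\<^sup>2 \<le> 1"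
    using assms by (intro mult_le_one) (auto simp: abs_square_le_1)
  then show ?thesis
    unfolding Re_half_plane_map[OF assms] using assms
    by (intro divide_nonneg_nonneg mult_nonneg_nonneg) (auto simp: abs_square_le_1)
qed

lemma half_plane_map_holomorphic:
  assumes "norm a < 1"
  shows "half_plane_map a holomorphic_on unit_disc"
  unfolding half_plane_map_def using szego_denominator_nonzero[OF assms]
  by (auto intro!: holomorphic_intros)

lemma one_plus_scaled_nonzero:
  assumes "0 \<le> Re h" "0 \<le> c"
  shows "1 + of_real c * h \<noteq> 0"
proof -
  have "0 < Re (1 + of_real c * h)"
    using mult_nonneg_nonneg[OF assms(2,1)] by simp
  then show ?thesis by (metis less_irrefl zero_complex.sel(1))
qed

lemma norm_one_plus_scaled_square:
  "(norm (1 + of_real c * h))\<^sup>2 = 1 + 2 * c * Re h + c\<^sup>2 * (norm h)\<^sup>2"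
  unfolding cmod_power2 by (simp add: power2_eq_square algebra_simps)

text \<open>In \<open>|1 + c h|^2 = 1 + 2 c Re h + c^2 |h|^2\<close> the mixed term is nonnegative,
  so the two numerators \<open>c^2 |h|^2\<close> and 1 fit below the denominator.\<close>

lemma partition_of_unity_half_plane:
  assumes "0 \<le> Re h" "0 \<le> c"
  shows "(norm (of_real c * h / (1 + of_real c * h)))\<^sup>2 + (norm (1 / (1 + of_real c * h)))\<^sup>2 \<le> 1"
proof -
  have pos: "0 < (norm (1 + of_real c * h))\<^sup>2"
    using one_plus_scaled_nonzero[OF assms] by simp
  have "c\<^sup>2 * (norm h)\<^sup>2 + 1 \<le> (norm (1 + of_real c * h))\<^sup>2"
    unfolding norm_one_plus_scaled_square using assms by simp
  then have "(c\<^sup>2 * (norm h)\<^sup>2 + 1) / (norm (1 + of_real c * h))\<^sup>2 \<le> 1"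
    using pos by simp
  then show ?thesis
    by (simp add: norm_divide norm_mult power_divide power_mult_distrib add_divide_distrib)
qed

text \<open>With \<open>x = 1 - \<rho>^2\<close> one has \<open>Re h \<le> 2 x\<close> and
  \<open>|h|^2 \<le> 4 x\<close>, hence \<open>|1 + n h|^2 \<le> 1 + (4 n + 4 n^2) x\<close>.
  Bernoulli's inequality bounds this by the power \<open>4 n + 4 n^2\<close> of
  \<open>1 + x\<close>, and the product with the same power of \<open>1 - x = \<rho>^2\<close> is at
  most 1. This is the origin of the exponent.\<close>

lemma damping_factor_lower_bound:
  assumes a: "norm a < 1" and wa: "norm w \<le> norm a"
  shows "norm (blaschke_factor a w) ^ (4 * n + 4 * n\<^sup>2) \<le> norm (1 / (1 + of_nat n * half_plane_map a w))"
proof -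
  let ?h = "half_plane_map a w" and ?K = "4 * n + 4 * n\<^sup>2" and ?D = "(norm (1 - cnj a * w))\<^sup>2"
  define \<rho> where "\<rho> = norm (blaschke_factor a w)"
  define x where "x = 1 - \<rho>\<^sup>2"
  have w: "norm w < 1" using a wa by simp
  have D: "0 < ?D" using szego_denominator_nonzero[OF a, of w] w by simp
  have xD: "x = (1 - (norm a)\<^sup>2) * (1 - (norm w)\<^sup>2) / ?D"
    unfolding x_def \<rho>_def using one_minus_blaschke_factor_square[OF a, of w] w by simp
  have sq: "0 \<le> 1 - (norm a)\<^sup>2" "(norm w)\<^sup>2 \<le> (norm a)\<^sup>2" "(norm w)\<^sup>2 \<le> 1"
    using a w wa by (auto simp: abs_square_le_1)
  \<comment> \<open>Here \<open>norm w \<le> norm a\<close> enters: \<open>1 - |a|^2 |w|^2\<close>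
    is replaced by the larger \<open>1 - |w|^4\<close>.\<close>
  have "(norm w)\<^sup>2 * (norm w)\<^sup>2 \<le> (norm a)\<^sup>2 * (norm w)\<^sup>2"
    using sq by (intro mult_right_mono) auto
  then have "1 - (norm a)\<^sup>2 * (norm w)\<^sup>2 \<le> (1 - (norm w)\<^sup>2) * (1 + (norm w)\<^sup>2)"
    by (simp add: algebra_simps)
  also have "\<dots> \<le> (1 - (norm w)\<^sup>2) * 2"
    using sq by (intro mult_left_mono) auto
  finally have "Re ?h \<le> (1 - (norm a)\<^sup>2) * ((1 - (norm w)\<^sup>2) * 2) / ?D"
    unfolding Re_half_plane_map[OF a w] using sq by (intro divide_right_mono mult_left_mono) auto
  then have Re: "Re ?h \<le> 2 * x"
    unfolding xD by (simp only: times_divide_eq_right mult_ac)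
  have "norm (1 + cnj a * w) \<le> 2"
    using norm_triangle_ineq[of 1 "cnj a * w"] a w mult_le_one[of "norm a" "norm w"] by (simp add: norm_mult)
  then have "(norm (1 + cnj a * w))\<^sup>2 \<le> 2\<^sup>2" by (intro power_mono) auto
  \<comment> \<open>The second use of \<open>norm w \<le> norm a\<close>, in the form
    \<open>1 - |a|^2 \<le> 1 - |w|^2\<close>.\<close>
  then have "(1 - (norm a)\<^sup>2)\<^sup>2 * (norm (1 + cnj a * w))\<^sup>2 \<le> ((1 - (norm a)\<^sup>2) * (1 - (norm w)\<^sup>2)) * 2\<^sup>2"
    unfolding power2_eq_square[of "1 - (norm a)\<^sup>2"] using sq by (intro mult_mono) auto
  moreover have "(norm ?h)\<^sup>2 = (1 - (norm a)\<^sup>2)\<^sup>2 * (norm (1 + cnj a * w))\<^sup>2 / ?D"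
    unfolding half_plane_map_def norm_mult norm_divide norm_of_real power_mult_distrib power_divide power2_abs by simp
  ultimately have h2: "(norm ?h)\<^sup>2 \<le> 4 * x"
    unfolding xD using D by (simp add: divide_right_mono)
  have x01: "0 \<le> x" "x \<le> 1"
    unfolding x_def \<rho>_def using norm_blaschke_factor_le_1[OF a, of w] w by (auto simp: abs_square_le_1)
  have "(norm (1 + of_nat n * ?h))\<^sup>2 = 1 + 2 * n * Re ?h + (real n)\<^sup>2 * (norm ?h)\<^sup>2"
    using norm_one_plus_scaled_square[of "real n" ?h] by simp
  also have "\<dots> \<le> 1 + 2 * n * (2 * x) + (real n)\<^sup>2 * (4 * x)"
    by (intro add_mono mult_left_mono Re h2) auto
  also have "\<dots> = 1 + ?K * x" by (simp add: algebra_simps)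
  also have "\<dots> \<le> (1 + x) ^ ?K"
    using x01 by (intro Bernoulli_inequality) auto
  finally have le: "(norm (1 + of_nat n * ?h))\<^sup>2 \<le> (1 + x) ^ ?K" .
  have "(\<rho> ^ ?K * norm (1 + of_nat n * ?h))\<^sup>2 = (1 - x) ^ ?K * (norm (1 + of_nat n * ?h))\<^sup>2"
    unfolding x_def by (simp add: power_mult_distrib mult.commute flip: power_mult)
  also have "\<dots> \<le> (1 - x) ^ ?K * (1 + x) ^ ?K"
    using x01 by (intro mult_left_mono le) auto
  also have "\<dots> = (1 - x\<^sup>2) ^ ?K"
    by (simp add: power_mult_distrib[symmetric] power2_eq_square algebra_simps)
  also have "\<dots> \<le> 1" using x01 by (intro power_le_one) (auto simp: abs_square_le_1)
  finally have "\<rho> ^ ?K * norm (1 + of_nat n * ?h) \<le> 1"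
    by (simp add: abs_square_le_1 \<rho>_def)
  moreover have "norm (1 + of_nat n * ?h) > 0"
    using one_plus_scaled_nonzero[OF Re_half_plane_map_nonneg[OF a w], of "real n"] by simp
  ultimately show ?thesis unfolding \<rho>_def by (simp add: norm_divide field_simps)
qed

text \<open>The points are added in order of increasing modulus; since \<open>|u\<^sub>x|\<^sup>2 \<le> 1 - |v\<^sub>x|\<^sup>2\<close>, the sum of
  squares telescopes.\<close>

lemma telescoping_family:
  assumes "finite A" "A \<subseteq> unit_disc"
  shows "\<exists>q. (\<forall>a\<in>A. q a holomorphic_on unit_disc) \<and>
    (\<forall>w\<in>unit_disc. (\<Sum>a\<in>A. (norm (q a w))\<^sup>2) \<le> 1) \<and>
    (\<forall>a\<in>A. real n / (real n + 1) * (\<Prod>b\<in>A - {a}. norm (blaschke_factor b a)) ^ (4 * n + 4 * n\<^sup>2) \<le> norm (q a a))"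
  using assms
proof (induction A rule: finite_ranking_induct[where f = norm])
  case empty
  then show ?case by simp
next
  case (insert x A)
  let ?K = "4 * n + 4 * n\<^sup>2"
  show ?case
  proof (cases "x \<in> A")
    case True
    then show ?thesis using insert by (simp add: insert_absorb)
  next
    case False
    have x: "norm x < 1" and A: "A \<subseteq> unit_disc" using insert.prems by auto
    from insert.IH[OF A] obtain q where q: "(\<forall>a\<in>A. q a holomorphic_on unit_disc) \<and>
      (\<forall>w\<in>unit_disc. (\<Sum>a\<in>A. (norm (q a w))\<^sup>2) \<le> 1) \<and>
      (\<forall>a\<in>A. real n / (real n + 1) * (\<Prod>b\<in>A - {a}. norm (blaschke_factor b a)) ^ ?K \<le> norm (q a a))" ..
    note hol = q[THEN conjunct1, rule_format]
      and le1 = q[THEN conjunct2, THEN conjunct1, rule_format]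
      and ge = q[THEN conjunct2, THEN conjunct2, rule_format]
    define v where "v = (\<lambda>w. 1 / (1 + of_nat n * half_plane_map x w))"
    define u where "u = (\<lambda>w. of_nat n * half_plane_map x w / (1 + of_nat n * half_plane_map x w))"
    have nz: "1 + of_nat n * half_plane_map x w \<noteq> 0" if "w \<in> unit_disc" for w
      using one_plus_scaled_nonzero[OF Re_half_plane_map_nonneg[OF x, of w], of "real n"] that by simp
    have hol_uv: "u holomorphic_on unit_disc" "v holomorphic_on unit_disc"
      unfolding u_def v_def using nz half_plane_map_holomorphic[OF x]
      by (auto intro!: holomorphic_intros)
    have uv: "(norm (u w))\<^sup>2 + (norm (v w))\<^sup>2 \<le> 1" if "w \<in> unit_disc" for w
      using partition_of_unity_half_plane[OF Re_half_plane_map_nonneg[OF x, of w], of "real n"] that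
      unfolding u_def v_def by simp
    \<comment> \<open>The ranking induction adds \<open>x\<close> as a point of largest modulus, as
      the damping estimate requires.\<close>
    have va: "norm (blaschke_factor x a) ^ ?K \<le> norm (v a)" if "a \<in> A" for a
      unfolding v_def by (rule damping_factor_lower_bound[OF x insert(2)[OF that]])
    have ux: "real n / (real n + 1) \<le> norm (u x)"
    proof -
      have nz1: "1 - (norm x)\<^sup>2 \<noteq> 0" using x by (simp add: abs_square_less_1 less_imp_neq)
      have t: "1 + cnj x * x = of_real (1 + (norm x)\<^sup>2)" "1 - cnj x * x = of_real (1 - (norm x)\<^sup>2)"
        unfolding of_real_add of_real_diff complex_norm_square by (simp_all add: mult.commute)
      have h: "half_plane_map x x = of_real (1 + (norm x)\<^sup>2)"
        unfolding half_plane_map_def t of_real_divide[symmetric] of_real_mult[symmetric] using nz1 by simp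
      define y where "y = real n * (1 + (norm x)\<^sup>2)"
      have y: "real n \<le> y" "0 \<le> y" unfolding y_def by (simp_all add: algebra_simps)
      have "u x = of_real (y / (1 + y))"
        unfolding u_def h y_def by simp
      then have "norm (u x) = y / (1 + y)"
        using y by (simp only: norm_of_real) simp
      moreover have "real n / (real n + 1) \<le> y / (1 + y)"
        using y by (simp add: field_simps)
      ultimately show ?thesis by simp
    qed
    \<comment> \<open>The new function \<open>u\<close> is not damped, while every older one
      receives the factor \<open>v\<close>; thus \<open>|u|^2\<close> takes up only what the factor
      \<open>|v|^2\<close> has set free.\<close>
    define q' where "q' = (\<lambda>a. if a = x then u else (\<lambda>w. q a w * v w))"
    have q'A: "q' a = (\<lambda>w. q a w * v w)" if "a \<in> A" for a
      using that False by (auto simp: q'_def)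
    have q'x: "q' x = u" by (simp add: q'_def)
    have "\<forall>a\<in>insert x A. q' a holomorphic_on unit_disc"
      using hol hol_uv by (auto simp: q'_def intro!: holomorphic_on_mult)
    moreover have "(\<Sum>a\<in>insert x A. (norm (q' a w))\<^sup>2) \<le> 1" if w: "w \<in> unit_disc" for w
    proof -
      have "(\<Sum>a\<in>insert x A. (norm (q' a w))\<^sup>2) = (norm (u w))\<^sup>2 + (\<Sum>a\<in>A. (norm (q a w))\<^sup>2) * (norm (v w))\<^sup>2"
        using insert.hyps False by (simp add: q'x q'A norm_mult power_mult_distrib sum_distrib_right)
      also have "\<dots> \<le> (norm (u w))\<^sup>2 + 1 * (norm (v w))\<^sup>2"
        using le1[OF w] by (intro add_left_mono mult_right_mono) auto
      finally show ?thesis using uv[OF w] by simp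
    qed
    moreover have "real n / (real n + 1) * (\<Prod>b\<in>insert x A - {a}. norm (blaschke_factor b a)) ^ ?K \<le> norm (q' a a)"
      if a: "a \<in> insert x A" for a
    proof (cases "a = x")
      case True
      have "(\<Prod>b\<in>insert x A - {x}. norm (blaschke_factor b x)) \<le> 1"
        using A x by (intro prod_blaschke_factor_le_1) auto
      then have "(\<Prod>b\<in>insert x A - {x}. norm (blaschke_factor b x)) ^ ?K \<le> 1"
        by (intro power_le_one prod_nonneg) auto
      then have "real n / (real n + 1) * (\<Prod>b\<in>insert x A - {x}. norm (blaschke_factor b x)) ^ ?K \<le> real n / (real n + 1) * 1"
        by (intro mult_left_mono) auto
      then show ?thesis using ux True by (simp add: q'x)
    next
      case neq: False
      then have aA: "a \<in> A" and eq: "insert x A - {a} = insert x (A - {a})" using a by auto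
      have "real n / (real n + 1) * (\<Prod>b\<in>insert x A - {a}. norm (blaschke_factor b a)) ^ ?K =
          (real n / (real n + 1) * (\<Prod>b\<in>A - {a}. norm (blaschke_factor b a)) ^ ?K) * norm (blaschke_factor x a) ^ ?K"
        unfolding eq using insert.hyps False by (simp add: power_mult_distrib)
      also have "\<dots> \<le> norm (q a a) * norm (v a)"
        using ge[OF aA] va[OF aA] by (intro mult_mono) auto
      finally show ?thesis by (simp add: q'A[OF aA] norm_mult)
    qed
    ultimately show ?thesis by blast
  qed
qed

section \<open>The constants and their limit 1\<close>

definition telescoping_bound :: "nat \<Rightarrow> real \<Rightarrow> real" where
  "telescoping_bound n d = real n / (real n + 1) * d ^ (4 * n + 4 * n\<^sup>2)"

text \<open>The interpolating functions contain \<open>q a\<close> twice and a Blaschke product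
  once, each divided by its value at \<open>a\<close>; the lower bounds for these values multiply to
  the denominator. The Carleson estimate yields \<open>1 / (telescoping_bound n d)^2\<close>, which
  is no larger for \<open>d \<le> 1\<close>, and is stated with the same constant for
  uniformity.\<close>

definition interpolation_constant :: "nat \<Rightarrow> real \<Rightarrow> real" where
  "interpolation_constant n d = 1 / ((telescoping_bound n d)\<^sup>2 * d)"

definition separated_by :: "real \<Rightarrow> complex set \<Rightarrow> bool" where
  "separated_by d A \<longleftrightarrow> A \<subseteq> unit_disc \<and> (\<forall>a\<in>A. d \<le> (\<Prod>b\<in>A - {a}. norm (blaschke_factor b a)))"

lemma telescoping_bound_pos: "0 < n \<Longrightarrow> 0 < d \<Longrightarrow> 0 < telescoping_bound n d"
  by (simp add: telescoping_bound_def)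

lemma interpolation_constant_pos: "0 < n \<Longrightarrow> 0 < d \<Longrightarrow> 0 < interpolation_constant n d"
  by (simp add: interpolation_constant_def telescoping_bound_pos less_imp_neq[symmetric])

text \<open>At \<open>d = 1\<close> only \<open>((n + 1) / n)^2\<close> is left, which determines
  \<open>n\<close>; for this fixed \<open>n\<close> the constant depends continuously on
  \<open>d\<close>.\<close>

lemma interpolation_constant_tends_to_1:
  assumes "0 < \<epsilon>"
  obtains n d where "0 < n" "0 < d" "d < 1" "interpolation_constant n d < 1 + \<epsilon>"
proof -
  have "((\<lambda>n. 1 / ((real n / (real n + 1))\<^sup>2 * 1)) \<longlongrightarrow> 1) sequentially"
    by real_asymp
  then have "eventually (\<lambda>n. 1 / ((real n / (real n + 1))\<^sup>2 * 1) < 1 + \<epsilon>) sequentially"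
    using assms by (intro order_tendstoD(2)) auto
  then obtain n where n: "0 < n" "1 / ((real n / (real n + 1))\<^sup>2 * 1) < 1 + \<epsilon>"
    using eventually_gt_at_top[of 0] by (metis (mono_tags, lifting) eventually_at_top_linorder eventually_conj order_refl)
  have "((\<lambda>d. interpolation_constant n d) \<longlongrightarrow> interpolation_constant n 1) (at_left 1)"
    unfolding interpolation_constant_def telescoping_bound_def
    using n by (intro tendsto_intros) auto
  moreover have "interpolation_constant n 1 < 1 + \<epsilon>"
    using n by (simp add: interpolation_constant_def telescoping_bound_def)
  ultimately have "eventually (\<lambda>d. interpolation_constant n d < 1 + \<epsilon>) (at_left 1)"
    by (rule order_tendstoD(2))
  then have "eventually (\<lambda>d. interpolation_constant n d < 1 + \<epsilon> \<and> d \<in> {0<..<1}) (at_left 1)"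
    using eventually_at_left_real[of 0 "1::real"] by (auto elim: eventually_elim2)
  then obtain d where "interpolation_constant n d < 1 + \<epsilon> \<and> d \<in> {0<..<1}"
    using eventually_happens'[OF trivial_limit_at_left_real] by blast
  then show ?thesis using that n by auto
qed

section \<open>Carleson embedding and interpolation on finite sets\<close>

lemma telescoping_family_separated:
  assumes "finite A" "separated_by d A" "0 < d"
  obtains q where "\<And>a. a \<in> A \<Longrightarrow> q a holomorphic_on unit_disc"
    "\<And>w. w \<in> unit_disc \<Longrightarrow> (\<Sum>a\<in>A. (norm (q a w))\<^sup>2) \<le> 1"
    "\<And>a. a \<in> A \<Longrightarrow> telescoping_bound n d \<le> norm (q a a)"
proof -
  have A: "A \<subseteq> unit_disc" using assms by (simp add: separated_by_def)
  obtain q where q: "\<forall>a\<in>A. q a holomorphic_on unit_disc"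
    "\<forall>w\<in>unit_disc. (\<Sum>a\<in>A. (norm (q a w))\<^sup>2) \<le> 1"
    "\<forall>a\<in>A. real n / (real n + 1) * (\<Prod>b\<in>A - {a}. norm (blaschke_factor b a)) ^ (4 * n + 4 * n\<^sup>2) \<le> norm (q a a)"
    using telescoping_family[OF assms(1) A, of n] by blast
  have "telescoping_bound n d \<le> norm (q a a)" if "a \<in> A" for a
  proof -
    have "d \<le> (\<Prod>b\<in>A - {a}. norm (blaschke_factor b a))"
      using assms that by (simp add: separated_by_def)
    then have "telescoping_bound n d \<le> real n / (real n + 1) * (\<Prod>b\<in>A - {a}. norm (blaschke_factor b a)) ^ (4 * n + 4 * n\<^sup>2)"
      unfolding telescoping_bound_def using assms by (intro mult_left_mono power_mono) auto
    also have "\<dots> \<le> norm (q a a)" using q that by blast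
    finally show ?thesis .
  qed
  with q that show ?thesis by blast
qed

text \<open>The growth estimate for \<open>f * q a\<close> at the point \<open>a\<close> is summed
  over \<open>a\<close> on a fixed circle. There the pointwise bound
  \<open>\<Sum> |q a|^2 \<le> 1\<close> collapses the right-hand sides to the mean of
  \<open>|f|^2\<close>; on the left \<open>|q a a|\<close> is bounded below.\<close>

theorem carleson_embedding_finite:
  assumes A: "finite A" "separated_by d A" and d: "0 < d" "d \<le> 1" and n: "0 < n"
    and f: "f holomorphic_on unit_disc" and K: "0 \<le> K" "hardy_norm 2 f \<le> ennreal K"
  shows "(\<Sum>a\<in>A. (1 - (norm a)\<^sup>2) * (norm (f a))\<^sup>2) \<le> interpolation_constant n d * K\<^sup>2"
proof -
  let ?m = "telescoping_bound n d"
  have Ad: "A \<subseteq> unit_disc" using A by (simp add: separated_by_def)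
  have m: "0 < ?m" by (rule telescoping_bound_pos[OF n d(1)])
  obtain q where hol: "\<And>a. a \<in> A \<Longrightarrow> q a holomorphic_on unit_disc"
    and le1: "\<And>w. w \<in> unit_disc \<Longrightarrow> (\<Sum>a\<in>A. (norm (q a w))\<^sup>2) \<le> 1"
    and ge: "\<And>a. a \<in> A \<Longrightarrow> ?m \<le> norm (q a a)"
    using telescoping_family_separated[OF A d(1)] by blast
  have fq: "(\<lambda>u. f u * q a u) holomorphic_on unit_disc" if "a \<in> A" for a
    using hol[OF that] f by (intro holomorphic_intros)
  have fK: "circ_mean r (\<lambda>u. (norm (f u))\<^sup>2) \<le> K\<^sup>2" if "0 < r" "r < 1" for r
    using hardy_norm_le_iff[of 2 K f] K f that by (simp add: powr_numeral)
  have "(\<Sum>a\<in>A. (norm (f (of_real (r\<^sup>2) * a) * q a (of_real (r\<^sup>2) * a)))\<^sup>2 * (1 - r\<^sup>2 * (norm a)\<^sup>2)) \<le> K\<^sup>2"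
    if r: "0 < r" "r < 1" for r
  proof -
    have c: "continuous_on (sphere 0 r) (\<lambda>u. (norm (f u * q a u))\<^sup>2)" if "a \<in> A" for a
      by (intro continuous_on_power continuous_on_norm holomorphic_on_disc_subsets(2)[OF fq[OF that]] r)
    have "(\<Sum>a\<in>A. (norm (f (of_real (r\<^sup>2) * a) * q a (of_real (r\<^sup>2) * a)))\<^sup>2 * (1 - r\<^sup>2 * (norm a)\<^sup>2)) \<le>
        (\<Sum>a\<in>A. circ_mean r (\<lambda>u. (norm (f u * q a u))\<^sup>2))"
    proof (intro sum_mono)
      fix a assume a: "a \<in> A"
      show "(norm (f (of_real (r\<^sup>2) * a) * q a (of_real (r\<^sup>2) * a)))\<^sup>2 * (1 - r\<^sup>2 * (norm a)\<^sup>2) \<le>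
          circ_mean r (\<lambda>u. (norm (f u * q a u))\<^sup>2)"
        using norm_powr_le_circ_mean[OF fq[OF a] r, of a 2] Ad a by (auto simp: powr_numeral subset_eq)
    qed
    also have "\<dots> = circ_mean r (\<lambda>u. \<Sum>a\<in>A. (norm (f u * q a u))\<^sup>2)"
      using r c A by (intro circ_mean_sum[symmetric]) auto
    also have "\<dots> \<le> circ_mean r (\<lambda>u. (norm (f u))\<^sup>2)"
    proof (rule circ_mean_mono)
      fix u :: complex assume "norm u = r"
      then have "(norm (f u))\<^sup>2 * (\<Sum>a\<in>A. (norm (q a u))\<^sup>2) \<le> (norm (f u))\<^sup>2 * 1"
        using le1[of u] r by (intro mult_left_mono) auto
      then show "(\<Sum>a\<in>A. (norm (f u * q a u))\<^sup>2) \<le> (norm (f u))\<^sup>2"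
        by (simp add: norm_mult power_mult_distrib sum_distrib_left)
    qed (use r in \<open>auto intro!: continuous_on_sum[OF c] continuous_on_power[OF continuous_on_norm]
        holomorphic_on_disc_subsets(2)[OF f]\<close>)
    also have "\<dots> \<le> K\<^sup>2" by (rule fK[OF r])
    finally show ?thesis .
  qed
  then have "eventually (\<lambda>r. (\<Sum>a\<in>A. (norm (f (of_real (r\<^sup>2) * a) * q a (of_real (r\<^sup>2) * a)))\<^sup>2 * (1 - r\<^sup>2 * (norm a)\<^sup>2)) \<le> K\<^sup>2) (at_left (1::real))"
    using eventually_at_left_real[of 0 "1::real"] by (auto elim: eventually_mono)
  moreover have "((\<lambda>r. \<Sum>a\<in>A. (norm (f (of_real (r\<^sup>2) * a) * q a (of_real (r\<^sup>2) * a)))\<^sup>2 * (1 - r\<^sup>2 * (norm a)\<^sup>2)) \<longlongrightarrow>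
      (\<Sum>a\<in>A. (norm (f a * q a a))\<^sup>2 * (1 - 1\<^sup>2 * (norm a)\<^sup>2))) (at_left (1::real))"
    using Ad by (intro tendsto_sum tendsto_mult tendsto_power tendsto_norm tendsto_diff tendsto_const
        tendsto_dilation[OF f] tendsto_dilation[OF hol] tendsto_ident_at) auto
  ultimately have lim: "(\<Sum>a\<in>A. (norm (f a * q a a))\<^sup>2 * (1 - 1\<^sup>2 * (norm a)\<^sup>2)) \<le> K\<^sup>2"
    by (intro tendsto_upperbound[where F = "at_left (1::real)"]) auto
  have "?m\<^sup>2 * (\<Sum>a\<in>A. (1 - (norm a)\<^sup>2) * (norm (f a))\<^sup>2) \<le> (\<Sum>a\<in>A. (norm (f a * q a a))\<^sup>2 * (1 - 1\<^sup>2 * (norm a)\<^sup>2))"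
    unfolding sum_distrib_left
  proof (intro sum_mono)
    fix a assume a: "a \<in> A"
    have "?m\<^sup>2 \<le> (norm (q a a))\<^sup>2" using ge[OF a] m by (intro power_mono) auto
    moreover have "0 \<le> 1 - (norm a)\<^sup>2" using a Ad by (auto simp: abs_square_le_1 subset_eq less_imp_le)
    ultimately have "?m\<^sup>2 * ((1 - (norm a)\<^sup>2) * (norm (f a))\<^sup>2) \<le> (norm (q a a))\<^sup>2 * ((1 - (norm a)\<^sup>2) * (norm (f a))\<^sup>2)"
      by (intro mult_right_mono) auto
    then show "?m\<^sup>2 * ((1 - (norm a)\<^sup>2) * (norm (f a))\<^sup>2) \<le> (norm (f a * q a a))\<^sup>2 * (1 - 1\<^sup>2 * (norm a)\<^sup>2)"
      by (simp add: norm_mult power_mult_distrib mult_ac)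
  qed
  with lim have "?m\<^sup>2 * (\<Sum>a\<in>A. (1 - (norm a)\<^sup>2) * (norm (f a))\<^sup>2) \<le> K\<^sup>2" by linarith
  then have "(\<Sum>a\<in>A. (1 - (norm a)\<^sup>2) * (norm (f a))\<^sup>2) \<le> 1 / ?m\<^sup>2 * K\<^sup>2"
    using m by (simp add: field_simps)
  also have "\<dots> \<le> interpolation_constant n d * K\<^sup>2"
    unfolding interpolation_constant_def using m d
    by (intro mult_right_mono divide_left_mono) (auto simp: mult_left_le)
  finally show ?thesis .
qed

text \<open>Squaring turns \<open>\<Sum> |q a|^2 \<le> 1\<close> into a bound for a sum of moduli,
  and the Blaschke products over \<open>A - {a}\<close> produce the zeros. In the theory of
  interpolation such functions are known as P. Beurling's functions: they interpolate bounded data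
  linearly.\<close>

lemma beurling_functions:
  assumes A: "finite A" "separated_by d A" and d: "0 < d" "d \<le> 1" and n: "0 < n"
  obtains \<phi> where "\<And>a. a \<in> A \<Longrightarrow> \<phi> a holomorphic_on unit_disc"
    "\<And>a b. a \<in> A \<Longrightarrow> b \<in> A \<Longrightarrow> \<phi> a b = (if a = b then 1 else 0)"
    "\<And>w. w \<in> unit_disc \<Longrightarrow> (\<Sum>a\<in>A. norm (\<phi> a w)) \<le> interpolation_constant n d"
proof -
  let ?m = "telescoping_bound n d"
  have Ad: "A \<subseteq> unit_disc" using A by (simp add: separated_by_def)
  have m: "0 < ?m" by (rule telescoping_bound_pos[OF n d(1)])
  obtain q where hol: "\<And>a. a \<in> A \<Longrightarrow> q a holomorphic_on unit_disc"
    and le1: "\<And>w. w \<in> unit_disc \<Longrightarrow> (\<Sum>a\<in>A. (norm (q a w))\<^sup>2) \<le> 1"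
    and ge: "\<And>a. a \<in> A \<Longrightarrow> ?m \<le> norm (q a a)"
    using telescoping_family_separated[OF A d(1)] by blast
  define B where "B = (\<lambda>a w. \<Prod>b\<in>A - {a}. blaschke_factor b w)"
  have B: "d \<le> norm (B a a)" if "a \<in> A" for a
    using A that by (simp add: B_def prod_norm separated_by_def)
  define \<phi> where "\<phi> = (\<lambda>a w. (q a w / q a a)\<^sup>2 * (B a w / B a a))"
  have nz: "q a a \<noteq> 0" "B a a \<noteq> 0" if "a \<in> A" for a
    using ge[OF that] B[OF that] m d by auto
  have "\<phi> a holomorphic_on unit_disc" if "a \<in> A" for a
    unfolding \<phi>_def B_def using Ad hol[OF that] nz[OF that]
    by (intro holomorphic_intros holomorphic_on_prod blaschke_factor_holomorphic) (auto simp: B_def)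
  moreover have "\<phi> a b = (if a = b then 1 else 0)" if "a \<in> A" "b \<in> A" for a b
  proof (cases "a = b")
    case False
    have "blaschke_factor b b = 0"
      using Ad that by (subst blaschke_factor_eq_0_iff) auto
    then have "B a b = 0"
      unfolding B_def using A that False by (intro prod_zero) auto
    with False show ?thesis by (simp add: \<phi>_def)
  qed (use nz that in \<open>simp add: \<phi>_def\<close>)
  moreover have "(\<Sum>a\<in>A. norm (\<phi> a w)) \<le> interpolation_constant n d" if w: "w \<in> unit_disc" for w
  proof -
    have "(\<Sum>a\<in>A. norm (\<phi> a w)) \<le> (\<Sum>a\<in>A. (norm (q a w))\<^sup>2 * interpolation_constant n d)"
    proof (intro sum_mono)
      fix a assume a: "a \<in> A"
      have "norm (B a w) \<le> 1"
        unfolding B_def prod_norm[symmetric] using Ad w by (intro prod_blaschke_factor_le_1) auto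
      then have "norm (\<phi> a w) \<le> (norm (q a w))\<^sup>2 * (1 / ((norm (q a a))\<^sup>2 * norm (B a a)))"
        unfolding \<phi>_def norm_mult norm_divide norm_power power_divide
        using nz[OF a] mult_left_le[of "norm (B a w)" "(norm (q a w))\<^sup>2"] by (simp add: field_simps)
      also have "\<dots> \<le> (norm (q a w))\<^sup>2 * (1 / (?m\<^sup>2 * d))"
        using ge[OF a] B[OF a] m d nz[OF a]
        by (intro mult_left_mono divide_left_mono mult_mono power_mono) auto
      finally show "norm (\<phi> a w) \<le> (norm (q a w))\<^sup>2 * interpolation_constant n d"
        by (simp add: interpolation_constant_def)
    qed
    also have "\<dots> = (\<Sum>a\<in>A. (norm (q a w))\<^sup>2) * interpolation_constant n d"
      by (simp add: sum_distrib_right)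
    also have "\<dots> \<le> 1 * interpolation_constant n d"
      using le1[OF w] interpolation_constant_pos[OF n d(1)] by (intro mult_right_mono) auto
    finally show ?thesis by simp
  qed
  ultimately show ?thesis using that by blast
qed

text \<open>Each term of the interpolant carries \<open>e a\<close>, the power \<open>1 / p\<close>
  of \<open>(1 - |a|^2) / (1 - cnj a w)^2\<close>. For finite \<open>p\<close> the circle means of
  \<open>|e a|^p\<close> are at most 1, and Jensen's inequality with the weights
  \<open>norm (\<phi> a w)\<close> gives a constant that does not depend on \<open>p\<close>; for
  \<open>p = \<infinity>\<close> the factor \<open>e a\<close> is 1.\<close>

theorem hardy_interpolation_finite:
  fixes c :: "complex \<Rightarrow> complex"
  assumes A: "finite A" "separated_by d A" and d: "0 < d" "d \<le> 1" and n: "0 < n" and p: "1 \<le> p"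
    and T: "0 \<le> T" "if p = \<infinity> then \<forall>a\<in>A. norm (c a) \<le> T
      else (\<Sum>a\<in>A. norm (c a) powr enn2real p) \<le> T powr enn2real p"
  obtains f where "f holomorphic_on unit_disc"
    "\<And>a. a \<in> A \<Longrightarrow> f a * of_real ((1 - (norm a)\<^sup>2) powr enn2real (1 / p)) = c a"
    "hardy_norm p f \<le> ennreal (interpolation_constant n d * T)"
proof -
  let ?M = "interpolation_constant n d"
  define s where "s = enn2real (1 / p)"
  have M: "0 < ?M" by (rule interpolation_constant_pos[OF n d(1)])
  have MT: "0 \<le> ?M * T" using M T by simp
  have Ad: "A \<subseteq> unit_disc" using A by (simp add: separated_by_def)
  have a1: "norm a < 1" if "a \<in> A" for a using Ad that by auto
  have pos: "0 < 1 - (norm a)\<^sup>2" if "a \<in> A" for a using a1[OF that] by (simp add: abs_square_less_1)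
  obtain \<phi> where hol: "\<And>a. a \<in> A \<Longrightarrow> \<phi> a holomorphic_on unit_disc"
    and val: "\<And>a b. a \<in> A \<Longrightarrow> b \<in> A \<Longrightarrow> \<phi> a b = (if a = b then 1 else 0)"
    and le: "\<And>w. w \<in> unit_disc \<Longrightarrow> (\<Sum>a\<in>A. norm (\<phi> a w)) \<le> ?M"
    using beurling_functions[OF A d n] by blast
  define e where "e = (\<lambda>a w. of_real ((1 - (norm a)\<^sup>2) powr s) * szego_power (- 2 * s) a w)"
  have hole: "e a holomorphic_on unit_disc" if "a \<in> A" for a
    unfolding e_def by (intro holomorphic_intros szego_power_holomorphic a1 that)
  define f where "f = (\<lambda>w. \<Sum>a\<in>A. \<phi> a w * (c a * e a w))"
  have holf: "f holomorphic_on unit_disc"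
    unfolding f_def by (intro holomorphic_intros hol hole)
  have "f b * of_real ((1 - (norm b)\<^sup>2) powr s) = c b" if b: "b \<in> A" for b
  proof -
    have "f b = (\<Sum>a\<in>A. if a = b then c b * e b b else 0)"
      unfolding f_def by (intro sum.cong) (auto simp: val b)
    also have "\<dots> = c b * e b b" using A b by simp
    \<comment> \<open>The exponents add up to \<open>s - 2 s = - s\<close>, which cancels the weight
      in the interpolation condition.\<close>
    also have "e b b = of_real ((1 - (norm b)\<^sup>2) powr (- s))"
      unfolding e_def szego_power_diagonal[OF a1[OF b]] of_real_mult[symmetric] powr_add[symmetric] by simp
    finally show ?thesis
      using pos[OF b] by (simp add: powr_minus flip: of_real_mult)
  qed
  moreover have "hardy_norm p f \<le> ennreal (?M * T)"
  proof (cases "p = \<infinity>")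
    case True
    then have s: "s = 0" by (simp add: s_def)
    have "norm (f w) \<le> ?M * T" if w: "w \<in> unit_disc" for w
    proof -
      have "norm (f w) \<le> (\<Sum>a\<in>A. norm (\<phi> a w) * T)"
        unfolding f_def
      proof (rule sum_norm_le)
        fix a assume a: "a \<in> A"
        have "e a w = 1"
          using pos[OF a] by (simp add: e_def s szego_power_def)
        then show "norm (\<phi> a w * (c a * e a w)) \<le> norm (\<phi> a w) * T"
          using T(2) True a by (simp add: norm_mult mult_left_mono)
      qed
      also have "\<dots> \<le> ?M * T"
        unfolding sum_distrib_right[symmetric] using le[OF w] T by (intro mult_right_mono) auto
      finally show ?thesis .
    qed
    then show ?thesis using hardy_norm_le_iff[OF p MT holf] True by simp
  next
    case False
    define q where "q = enn2real p"
    have q: "1 \<le> q" unfolding q_def using p False by (rule one_le_enn2real)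
    have s: "s = 1 / q" using False by (simp add: s_def q_def enn2real_inverse_exponent[OF p])
    have "circ_mean r (\<lambda>u. norm (f u) powr q) \<le> (?M * T) powr q" if r: "0 < r" "r < 1" for r
    proof -
      let ?P = "\<lambda>a u. (1 - (norm a)\<^sup>2) * (norm (szego_kernel a u))\<^sup>2"
      have cP: "continuous_on (sphere 0 r) (?P a)" if "a \<in> A" for a
        by (intro continuous_on_mult_left continuous_on_power continuous_on_norm
            holomorphic_on_disc_subsets(2)[OF szego_kernel_holomorphic[OF a1[OF that]]] r)
      have "circ_mean r (\<lambda>u. norm (f u) powr q) \<le>
          circ_mean r (\<lambda>u. ?M powr q * (\<Sum>a\<in>A. norm (c a) powr q * ?P a u))"
      proof (rule circ_mean_mono)
        fix u :: complex assume u: "norm u = r"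
        then have ud: "u \<in> unit_disc" using r by simp
        have eP: "norm (e a u) powr q = ?P a u" if a: "a \<in> A" for a
        proof -
          have "norm (1 - cnj a * u) > 0"
            using szego_denominator_nonzero[OF a1[OF a], of u] u r by simp
          moreover have "norm (e a u) = (1 - (norm a)\<^sup>2) powr s * norm (1 - cnj a * u) powr (- 2 * s)"
            using norm_szego_power[OF a1[OF a], of u] u r by (simp add: e_def norm_mult)
          moreover have sq: "- 2 * s * q = - 2" "s * q = 1" using q by (simp_all add: s)
          ultimately have "norm (e a u) powr q = (1 - (norm a)\<^sup>2) * norm (1 - cnj a * u) powr (- 2)"
            using pos[OF a] by (simp only: powr_mult powr_powr sq powr_one)
          then show ?thesis
            using \<open>norm (1 - cnj a * u) > 0\<close>
            by (simp add: szego_kernel_def norm_divide power_divide powr_minus powr_numeral norm_inverse power_inverse divide_inverse)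
        qed
        have "norm (f u) powr q \<le> (\<Sum>a\<in>A. norm (\<phi> a u) * norm (c a * e a u)) powr q"
          unfolding f_def using q by (intro powr_mono2 sum_norm_le) (auto simp: norm_mult)
        also have "\<dots> \<le> ?M powr (q - 1) * (\<Sum>a\<in>A. norm (\<phi> a u) * norm (c a * e a u) powr q)"
          using A le[OF ud] M q by (intro sum_powr_Jensen) auto
        \<comment> \<open>Jensen's inequality has produced \<open>M powr (q - 1)\<close>; the crude
          bound \<open>norm (\<phi> a u) \<le> M\<close> supplies the missing factor
          \<open>M\<close>.\<close>
        also have "\<dots> \<le> ?M powr (q - 1) * (\<Sum>a\<in>A. ?M * norm (c a * e a u) powr q)"
        proof (intro mult_left_mono sum_mono mult_right_mono)
          fix a assume a: "a \<in> A"
          have "norm (\<phi> a u) \<le> (\<Sum>a\<in>A. norm (\<phi> a u))"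
            using A a by (intro member_le_sum) auto
          with le[OF ud] show "norm (\<phi> a u) \<le> ?M" by linarith
        qed auto
        also have "\<dots> = ?M powr q * (\<Sum>a\<in>A. norm (c a * e a u) powr q)"
          using M by (simp add: powr_diff sum_distrib_left[symmetric])
        also have "(\<Sum>a\<in>A. norm (c a * e a u) powr q) = (\<Sum>a\<in>A. norm (c a) powr q * ?P a u)"
          by (intro sum.cong refl) (simp add: norm_mult powr_mult eP)
        finally show "norm (f u) powr q \<le> ?M powr q * (\<Sum>a\<in>A. norm (c a) powr q * ?P a u)" .
      qed (use r q in \<open>auto intro!: continuous_on_norm_powr holomorphic_on_disc_subsets(2)[OF holf]
          continuous_on_mult_left continuous_on_sum[OF continuous_on_mult_left[OF cP]]\<close>)
      also have "\<dots> = ?M powr q * circ_mean r (\<lambda>u. \<Sum>a\<in>A. norm (c a) powr q * ?P a u)"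
        using r by (intro circ_mean_mult_left continuous_on_sum[OF continuous_on_mult_left[OF cP]]) auto
      also have "circ_mean r (\<lambda>u. \<Sum>a\<in>A. norm (c a) powr q * ?P a u) =
          (\<Sum>a\<in>A. circ_mean r (\<lambda>u. norm (c a) powr q * ?P a u))"
        using r A by (intro circ_mean_sum continuous_on_mult_left[OF cP]) auto
      also have "\<dots> \<le> (\<Sum>a\<in>A. norm (c a) powr q)"
      proof (intro sum_mono)
        fix a assume a: "a \<in> A"
        have hk: "continuous_on (sphere 0 r) (\<lambda>u. (norm (szego_kernel a u))\<^sup>2)"
          by (intro continuous_on_power continuous_on_norm
              holomorphic_on_disc_subsets(2)[OF szego_kernel_holomorphic[OF a1[OF a]]] r)
        have "circ_mean r (\<lambda>u. norm (c a) powr q * ?P a u) =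
            norm (c a) powr q * ((1 - (norm a)\<^sup>2) * circ_mean r (\<lambda>u. (norm (szego_kernel a u))\<^sup>2))"
          using r by (simp add: circ_mean_mult_left hk continuous_on_mult_left)
        also have "\<dots> = norm (c a) powr q * ((1 - (norm a)\<^sup>2) * (1 / (1 - r\<^sup>2 * (norm a)\<^sup>2)))"
          unfolding circ_mean_szego_kernel_square[OF r a1[OF a]] ..
        also have "\<dots> \<le> norm (c a) powr q * 1"
        proof (intro mult_left_mono)
          have "r\<^sup>2 * (norm a)\<^sup>2 \<le> 1 * (norm a)\<^sup>2"
            using r by (intro mult_right_mono) (auto simp: abs_square_le_1)
          then show "(1 - (norm a)\<^sup>2) * (1 / (1 - r\<^sup>2 * (norm a)\<^sup>2)) \<le> 1"
            using pos[OF a] by simp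
        qed auto
        finally show "circ_mean r (\<lambda>u. norm (c a) powr q * ?P a u) \<le> norm (c a) powr q" by simp
      qed
      also have "\<dots> \<le> T powr q" using T(2) False by (simp add: q_def)
      also have "?M powr q * T powr q = (?M * T) powr q" using M T by (simp add: powr_mult)
      finally show ?thesis by (simp add: mult_left_mono)
    qed
    then show ?thesis using hardy_norm_le_iff[OF p MT holf] False q_def by simp
  qed
  ultimately show ?thesis using that[of f] holf by (simp add: s_def)
qed

section \<open>Thin sequences and interpolation\<close>

lemma blaschke_sequence_in_disc: "blaschke_sequence z \<Longrightarrow> z n \<in> unit_disc"
  by (simp add: blaschke_sequence_def)

lemma blaschke_sequence_norm_less_1: "blaschke_sequence z \<Longrightarrow> norm (z n) < 1"
  by (simp add: blaschke_sequence_def)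

lemma blaschke_sequence_weight_pos: "blaschke_sequence z \<Longrightarrow> 0 < 1 - (norm (z n))\<^sup>2"
  by (simp add: blaschke_sequence_def abs_square_less_1)

lemma blaschke_sequence_norm_tendsto_1:
  assumes "blaschke_sequence z"
  shows "(\<lambda>n. norm (z n)) \<longlonglongrightarrow> 1"
proof -
  have "(\<lambda>n. 1 - norm (z n)) \<longlonglongrightarrow> 0"
    using assms by (intro summable_LIMSEQ_zero) (simp add: blaschke_sequence_def)
  then have "(\<lambda>n. 1 - (1 - norm (z n))) \<longlonglongrightarrow> 1 - 0" by (intro tendsto_intros)
  then show ?thesis by simp
qed

lemma separation_factor: "norm ((z j - z k) / (1 - cnj (z k) * z j)) = norm (blaschke_factor (z k) (z j))"
  by (simp add: norm_blaschke_factor)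

lemma prod_blaschke_seq_antimono:
  assumes "blaschke_sequence z" "finite G" "F \<subseteq> G"
  shows "(\<Prod>k\<in>G. norm (blaschke_factor (z k) (z j))) \<le> (\<Prod>k\<in>F. norm (blaschke_factor (z k) (z j)))"
proof -
  have le1: "norm (blaschke_factor (z k) (z j)) \<le> 1" for k
    using blaschke_sequence_norm_less_1[OF assms(1)] by (intro norm_blaschke_factor_le_1) (auto intro: less_imp_le)
  have "(\<Prod>k\<in>G. norm (blaschke_factor (z k) (z j))) =
      (\<Prod>k\<in>G - F. norm (blaschke_factor (z k) (z j))) * (\<Prod>k\<in>F. norm (blaschke_factor (z k) (z j)))"
    by (rule prod.subset_diff[OF assms(3,2)])
  also have "\<dots> \<le> 1 * (\<Prod>k\<in>F. norm (blaschke_factor (z k) (z j)))"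
    using le1 by (intro mult_right_mono prod_le_1 prod_nonneg) auto
  finally show ?thesis by simp
qed

lemma separation_LIMSEQ:
  assumes "blaschke_sequence z"
  shows "(\<lambda>n. \<Prod>k\<in>{..<n} - {j}. norm (blaschke_factor (z k) (z j))) \<longlonglongrightarrow> separation z j"
proof -
  have "decseq (\<lambda>n. \<Prod>k\<in>{..<n} - {j}. norm (blaschke_factor (z k) (z j)))"
    unfolding decseq_def by (auto intro!: prod_blaschke_seq_antimono[OF assms])
  then have "convergent (\<lambda>n. \<Prod>k\<in>{..<n} - {j}. norm (blaschke_factor (z k) (z j)))"
    by (rule decseq_convergent[where B = 0]) (auto intro: prod_nonneg convergentI)
  then show ?thesis
    unfolding separation_def separation_factor by (simp add: convergent_LIMSEQ_iff)
qed

lemma separation_le_prod: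
  assumes "blaschke_sequence z" "finite F" "j \<notin> F"
  shows "separation z j \<le> (\<Prod>k\<in>F. norm (blaschke_factor (z k) (z j)))"
proof (rule tendsto_upperbound[OF separation_LIMSEQ[OF assms(1)]])
  obtain n where n: "F \<subseteq> {..<n}"
    using finite_nat_iff_bounded assms(2) by blast
  show "\<forall>\<^sub>F m in sequentially. (\<Prod>k\<in>{..<m} - {j}. norm (blaschke_factor (z k) (z j))) \<le>
      (\<Prod>k\<in>F. norm (blaschke_factor (z k) (z j)))"
    using eventually_ge_at_top[of n]
  proof eventually_elim
    case (elim m)
    then show ?case
      using n assms(3) by (intro prod_blaschke_seq_antimono[OF assms(1)]) auto
  qed
qed simp

lemma separation_ge:
  assumes "blaschke_sequence z"
    and "\<And>n. d \<le> (\<Prod>k\<in>{..<n} - {j}. norm (blaschke_factor (z k) (z j)))"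
  shows "d \<le> separation z j"
  by (rule tendsto_lowerbound[OF separation_LIMSEQ[OF assms(1)]]) (use assms(2) in auto)

lemma separation_le_1: "blaschke_sequence z \<Longrightarrow> separation z j \<le> 1"
  using separation_le_prod[of z "{}" j] by simp

text \<open>The Blaschke condition makes the numbers \<open>1 - |b|^2\<close> summable, so from some
  \<open>N\<close> on the product is at least \<open>1 / 2\<close> by Weierstrass' inequality; the
  finitely many earlier factors are nonzero since the points are distinct.\<close>

lemma separation_pos:
  assumes z: "blaschke_sequence z" and inj: "inj z"
  shows "0 < separation z j"
proof -
  have z1: "norm (z k) < 1" "norm (z k) \<le> 1" for k
    using blaschke_sequence_norm_less_1[OF z, of k] by simp_all
  define C where "C = (1 - (norm (z j))\<^sup>2) / (1 - norm (z j))\<^sup>2"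
  have C: "0 \<le> C"
    unfolding C_def using blaschke_sequence_weight_pos[OF z, of j] by simp
  have xle: "1 - (norm (blaschke_factor (z k) (z j)))\<^sup>2 \<le> 2 * C * (1 - norm (z k))" for k
  proof -
    \<comment> \<open>Exchanging the two points makes the constant depend on \<open>z j\<close> only
      and leaves \<open>1 - |z k|^2\<close> as the summable factor.\<close>
    have "1 - (norm (blaschke_factor (z k) (z j)))\<^sup>2 \<le> C * (1 - (norm (z k))\<^sup>2)"
      unfolding norm_blaschke_factor_commute[of "z k"] C_def
      by (rule one_minus_blaschke_factor_square_le[OF z1(1) z1(2)])
    also have "1 - (norm (z k))\<^sup>2 = (1 - norm (z k)) * (1 + norm (z k))"
      by (simp add: power2_eq_square algebra_simps)
    also have "C * \<dots> \<le> C * ((1 - norm (z k)) * 2)"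
      using C z1[of k] by (intro mult_left_mono) auto
    finally show ?thesis by (simp add: algebra_simps)
  qed
  have x0: "0 \<le> 1 - (norm (blaschke_factor (z k) (z j)))\<^sup>2" for k
    using norm_blaschke_factor_le_1[OF z1] by (simp add: abs_square_le_1)
  have sum: "summable (\<lambda>k. 1 - (norm (blaschke_factor (z k) (z j)))\<^sup>2)"
  proof (rule summable_comparison_test')
    show "summable (\<lambda>k. 2 * C * (1 - norm (z k)))"
      using z by (intro summable_mult) (simp add: blaschke_sequence_def)
    show "norm (1 - (norm (blaschke_factor (z k) (z j)))\<^sup>2) \<le> 2 * C * (1 - norm (z k))" if "k \<ge> 0" for k
      using xle[of k] x0[of k] by simp
  qed
  obtain N where N: "\<And>m n. m \<ge> N \<Longrightarrow> norm (\<Sum>k=m..<n. 1 - (norm (blaschke_factor (z k) (z j)))\<^sup>2) < 1 / 2"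
    using sum[unfolded summable_Cauchy, rule_format, of "1 / 2"] by auto
  define D where "D = (\<Prod>k\<in>{..<N} - {j}. norm (blaschke_factor (z k) (z j)))"
  have "blaschke_factor (z k) (z j) \<noteq> 0" if "k \<noteq> j" for k
    using that inj by (simp add: blaschke_factor_eq_0_iff[OF z1] inj_eq)
  then have D: "0 < D"
    unfolding D_def by (intro prod_pos) auto
  have "D * (1 / 2) \<le> separation z j"
  proof (rule separation_ge[OF z])
    fix n
    have "1 / 2 \<le> 1 - (\<Sum>k=N..<n. 1 - (norm (blaschke_factor (z k) (z j)))\<^sup>2)"
      using N[of N n] by simp
    also have "\<dots> \<le> 1 - (\<Sum>k\<in>{N..<n} - {j}. 1 - (norm (blaschke_factor (z k) (z j)))\<^sup>2)"
      using x0 by (intro diff_left_mono sum_mono2) auto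
    also have "\<dots> \<le> (\<Prod>k\<in>{N..<n} - {j}. norm (blaschke_factor (z k) (z j)))"
      using norm_blaschke_factor_le_1[OF z1] by (intro prod_ge_one_minus_sum_square) auto
    finally have "D * (1 / 2) \<le> D * (\<Prod>k\<in>{N..<n} - {j}. norm (blaschke_factor (z k) (z j)))"
      using D by (intro mult_left_mono) auto
    also have "\<dots> = (\<Prod>k\<in>({..<N} - {j}) \<union> ({N..<n} - {j}). norm (blaschke_factor (z k) (z j)))"
      unfolding D_def by (intro prod.union_disjoint[symmetric]) auto
    also have "\<dots> \<le> (\<Prod>k\<in>{..<n} - {j}. norm (blaschke_factor (z k) (z j)))"
      by (intro prod_blaschke_seq_antimono[OF z]) auto
    finally show "D * (1 / 2) \<le> (\<Prod>k\<in>{..<n} - {j}. norm (blaschke_factor (z k) (z j)))" .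
  qed
  with D show ?thesis by linarith
qed

text \<open>It is enough to control the product over a tail: the points before \<open>N\<close> form
  a finite Blaschke product, whose modulus at \<open>z j\<close> tends to 1 because
  \<open>norm (z j)\<close> does.\<close>

lemma thinI:
  assumes z: "blaschke_sequence z" and inj: "inj z"
    and tail: "\<And>\<epsilon>. 0 < \<epsilon> \<Longrightarrow> \<exists>N. \<forall>j\<ge>N. \<forall>M. 1 - \<epsilon> \<le> (\<Prod>k\<in>{N..<M} - {j}. norm (blaschke_factor (z k) (z j)))"
  shows "thin z"
  unfolding thin_def
proof (rule LIMSEQ_I)
  fix e :: real assume e: "0 < e"
  \<comment> \<open>\<open>3 * \<epsilon> \<le> e\<close> makes the final error
    \<open>2 * \<epsilon>\<close> strictly less than \<open>e\<close>, and
    \<open>\<epsilon> \<le> 1\<close> keeps \<open>1 - \<epsilon>\<close> nonnegative when the two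
    bounds are multiplied.\<close>
  define \<epsilon> where "\<epsilon> = min (e / 3) 1"
  have \<epsilon>: "0 < \<epsilon>" "\<epsilon> \<le> 1" "3 * \<epsilon> \<le> e" using e by (auto simp: \<epsilon>_def)
  obtain N where N: "\<And>j M. j \<ge> N \<Longrightarrow> 1 - \<epsilon> \<le> (\<Prod>k\<in>{N..<M} - {j}. norm (blaschke_factor (z k) (z j)))"
    using tail[OF \<epsilon>(1)] by blast
  have "z ` {..<N} \<subseteq> unit_disc" using blaschke_sequence_in_disc[OF z] by blast
  then obtain C where C: "\<And>w. norm w \<le> 1 \<Longrightarrow> 1 - C * (1 - (norm w)\<^sup>2) \<le> (\<Prod>a\<in>z ` {..<N}. norm (blaschke_factor a w))"
    using finite_blaschke_lower_bound[of "z ` {..<N}"] by blast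
  have "(\<lambda>j. 1 - C * (1 - (norm (z j))\<^sup>2)) \<longlonglongrightarrow> 1 - C * (1 - 1\<^sup>2)"
    by (intro tendsto_intros blaschke_sequence_norm_tendsto_1 z)
  then have "eventually (\<lambda>j. 1 - \<epsilon> < 1 - C * (1 - (norm (z j))\<^sup>2)) sequentially"
    using \<epsilon> by (intro order_tendstoD) auto
  then obtain J where J: "\<And>j. j \<ge> J \<Longrightarrow> 1 - \<epsilon> < 1 - C * (1 - (norm (z j))\<^sup>2)"
    by (auto simp: eventually_sequentially)
  have "norm (separation z j - 1) < e" if j: "j \<ge> max N J" for j
  proof -
    have "(1 - \<epsilon>) * (1 - \<epsilon>) \<le> separation z j"
    proof (rule separation_ge[OF z])
      fix n
      have "1 - \<epsilon> \<le> (\<Prod>a\<in>z ` {..<N}. norm (blaschke_factor a (z j)))"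
        using C[of "z j"] J[of j] j blaschke_sequence_norm_less_1[OF z, of j] by fastforce
      also have "\<dots> = (\<Prod>k\<in>{..<N}. norm (blaschke_factor (z k) (z j)))"
        using inj by (subst prod.reindex) (auto intro: inj_on_subset)
      finally have "(1 - \<epsilon>) * (1 - \<epsilon>) \<le> (\<Prod>k\<in>{..<N}. norm (blaschke_factor (z k) (z j))) *
          (\<Prod>k\<in>{N..<n} - {j}. norm (blaschke_factor (z k) (z j)))"
        using N[of j n] j \<epsilon> by (intro mult_mono prod_nonneg) auto
      also have "\<dots> = (\<Prod>k\<in>{..<N} \<union> ({N..<n} - {j}). norm (blaschke_factor (z k) (z j)))"
        by (intro prod.union_disjoint[symmetric]) auto
      also have "\<dots> \<le> (\<Prod>k\<in>{..<n} - {j}. norm (blaschke_factor (z k) (z j)))"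
        using j by (intro prod_blaschke_seq_antimono[OF z]) auto
      finally show "(1 - \<epsilon>) * (1 - \<epsilon>) \<le> (\<Prod>k\<in>{..<n} - {j}. norm (blaschke_factor (z k) (z j)))" .
    qed
    moreover have "1 - 2 * \<epsilon> \<le> (1 - \<epsilon>) * (1 - \<epsilon>)" by (simp add: algebra_simps)
    ultimately show ?thesis using separation_le_1[OF z, of j] \<epsilon> by simp
  qed
  then show "\<exists>n0. \<forall>j\<ge>n0. norm (separation z j - 1) < e" by blast
qed

lemma thin_tail_separation:
  assumes "thin z" "d < 1"
  obtains N where "\<And>j. j \<ge> N \<Longrightarrow> d \<le> separation z j"
proof -
  have "eventually (\<lambda>j. d < separation z j) sequentially"
    using assms unfolding thin_def by (intro order_tendstoD) auto
  then show ?thesis using that by (force simp: eventually_sequentially less_imp_le)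
qed

text \<open>Thinness handles all but finitely many \<open>j\<close>, and each remaining separation
  is positive. The conditions that are asserted for every \<open>N\<close>, and not only for large
  \<open>N\<close>, rest on this.\<close>

lemma thin_uniform_separation:
  assumes z: "blaschke_sequence z" and inj: "inj z" and thin: "thin z"
  obtains d where "0 < d" "d \<le> 1" "\<And>j. d \<le> separation z j"
proof -
  obtain N where N: "\<And>j. j \<ge> N \<Longrightarrow> 1 / 2 \<le> separation z j"
    using thin_tail_separation[OF thin, of "1 / 2"] by auto
  define d where "d = Min (insert (1 / 2) (separation z ` {..<N}))"
  have "0 < d" unfolding d_def using separation_pos[OF z inj] by (subst Min_gr_iff) auto
  moreover have "d \<le> 1 / 2" unfolding d_def by (rule Min_le) auto
  moreover have "d \<le> separation z j" for j
  proof (cases "j < N")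
    case True then show ?thesis unfolding d_def by (intro Min_le) auto
  next
    case False
    with N[of j] \<open>d \<le> 1 / 2\<close> show ?thesis by simp
  qed
  ultimately show ?thesis by (intro that[of d]) auto
qed

lemma separated_by_image:
  assumes z: "blaschke_sequence z" and inj: "inj z" and F: "finite F"
    and d: "\<And>j. j \<in> F \<Longrightarrow> d \<le> separation z j"
  shows "separated_by d (z ` F)"
  unfolding separated_by_def
proof (intro conjI ballI)
  show "z ` F \<subseteq> unit_disc" using blaschke_sequence_in_disc[OF z] by blast
  fix a assume "a \<in> z ` F"
  then obtain j where j: "j \<in> F" "a = z j" by blast
  have eq: "z ` F - {z j} = z ` (F - {j})" using inj by (auto simp: inj_eq)
  have "d \<le> (\<Prod>k\<in>F - {j}. norm (blaschke_factor (z k) (z j)))"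
    using separation_le_prod[OF z, of "F - {j}" j] F d[OF j(1)] by fastforce
  also have "\<dots> = (\<Prod>b\<in>z ` F - {a}. norm (blaschke_factor b a))"
    unfolding j(2) eq using inj by (subst prod.reindex) (auto intro: inj_on_subset)
  finally show "d \<le> (\<Prod>b\<in>z ` F - {a}. norm (blaschke_factor b a))" .
qed

section \<open>Tail norms of sequences\<close>

lemma tail_lp_norm_le_iff:
  assumes p: "1 \<le> p" and T: "0 \<le> T"
  shows "tail_lp_norm p N a \<le> ennreal T \<longleftrightarrow>
    (if p = \<infinity> then \<forall>j\<ge>N. norm (a j) \<le> T
     else \<forall>F. finite F \<longrightarrow> F \<subseteq> {N..} \<longrightarrow> (\<Sum>j\<in>F. norm (a j) powr enn2real p) \<le> T powr enn2real p)"
proof (cases "p = \<infinity>")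
  case True
  then show ?thesis using T by (auto simp: tail_lp_norm_def SUP_le_iff)
next
  case False
  define q where "q = enn2real p"
  have q: "1 \<le> q" unfolding q_def using p False by (rule one_le_enn2real)
  let ?x = "\<lambda>j. norm (a j) powr q"
  have "tail_lp_norm p N a \<le> ennreal T \<longleftrightarrow> (\<forall>F. finite F \<longrightarrow> F \<subseteq> {N..} \<longrightarrow> sum ?x F \<le> T powr q)"
  proof (cases "summable ?x")
    case sm: True
    define S where "S = (\<Sum>j. ?x (j + N))"
    have smN: "summable (\<lambda>j. ?x (j + N))" using sm summable_iff_shift[of ?x N] by simp
    have S0: "0 \<le> S" unfolding S_def using smN by (intro suminf_nonneg) auto
    have "(S powr (1 / q)) powr q = S"
      using q S0 by (simp add: powr_powr)
    moreover have "S powr (1 / q) \<le> T \<longleftrightarrow> (S powr (1 / q)) powr q \<le> T powr q"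
      using q T by (smt (verit) powr_ge_zero powr_less_mono2 powr_mono2)
    moreover have "tail_lp_norm p N a \<le> ennreal T \<longleftrightarrow> S powr (1 / q) \<le> T"
      using False sm T by (simp add: tail_lp_norm_def q_def S_def)
    moreover have "S \<le> T powr q \<longleftrightarrow> (\<forall>F. finite F \<longrightarrow> F \<subseteq> {N..} \<longrightarrow> sum ?x F \<le> T powr q)"
    proof (intro iffI allI impI)
      fix F assume le: "S \<le> T powr q" and F: "finite F" "F \<subseteq> {N..}"
      have "sum ?x F = (\<Sum>j\<in>(\<lambda>j. j - N) ` F. ?x (j + N))"
      proof (subst sum.reindex)
        show "inj_on (\<lambda>j. j - N) F"
          by (rule inj_onI) (use F(2) in \<open>metis atLeast_iff eq_diff_iff subsetD\<close>)
      qed (use F(2) in \<open>auto intro!: sum.cong simp: subset_eq\<close>)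
      also have "\<dots> \<le> S"
        unfolding S_def using F by (intro sum_le_suminf smN) auto
      finally show "sum ?x F \<le> T powr q" using le by simp
    next
      assume *: "\<forall>F. finite F \<longrightarrow> F \<subseteq> {N..} \<longrightarrow> sum ?x F \<le> T powr q"
      show "S \<le> T powr q"
        unfolding S_def
      proof (rule suminf_le_const[OF smN])
        fix n
        have "(\<Sum>j<n. ?x (j + N)) = sum ?x ((\<lambda>j. j + N) ` {..<n})"
          by (subst sum.reindex) auto
        also have "\<dots> \<le> T powr q" by (rule *[rule_format]) auto
        finally show "(\<Sum>j<n. ?x (j + N)) \<le> T powr q" .
      qed
    qed
    ultimately show ?thesis by simp
  next
    case nsm: False
    \<comment> \<open>Without summability the norm is infinite by definition, and correspondingly
      the finite sums over the tail are unbounded.\<close>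
    then have "\<not> summable (\<lambda>j. ?x (j + N))" using summable_iff_shift[of ?x N] by simp
    then have "\<not> (\<forall>n. (\<Sum>j<n. ?x (j + N)) \<le> T powr q)"
      by (metis (no_types, lifting) summableI_nonneg_bounded powr_ge_zero)
    then obtain n where n: "\<not> (\<Sum>j<n. ?x (j + N)) \<le> T powr q" by blast
    have "(\<Sum>j<n. ?x (j + N)) = sum ?x ((\<lambda>j. j + N) ` {..<n})"
      by (subst sum.reindex) auto
    with n have "\<not> sum ?x ((\<lambda>j. j + N) ` {..<n}) \<le> T powr q" by metis
    moreover have "finite ((\<lambda>j. j + N) ` {..<n})" "(\<lambda>j. j + N) ` {..<n} \<subseteq> {N..}" by auto
    ultimately have "\<not> (\<forall>F. finite F \<longrightarrow> F \<subseteq> {N..} \<longrightarrow> sum ?x F \<le> T powr q)" by blast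
    moreover have "tail_lp_norm p N a = \<infinity>"
      using nsm False by (simp add: tail_lp_norm_def q_def)
    ultimately show ?thesis by (auto simp: top_unique)
  qed
  then show ?thesis using False by (simp add: q_def)
qed

lemma sum_powr_le_tail_lp_norm:
  assumes "1 \<le> p" "0 \<le> T" "tail_lp_norm p N a \<le> ennreal T" "p \<noteq> \<infinity>" "finite F" "F \<subseteq> {N..}"
  shows "(\<Sum>j\<in>F. norm (a j) powr enn2real p) \<le> T powr enn2real p"
  using tail_lp_norm_le_iff[OF assms(1,2), of N a] assms by presburger

text \<open>The alternative \<open>b j = 0\<close> allows \<open>N'\<close> below \<open>N\<close>:
  a sequence cut off before \<open>N\<close> is estimated on a longer tail, in particular on the
  whole index set, by a norm over the shorter one.\<close>

lemma tail_lp_norm_mono: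
  assumes p: "1 \<le> p" and T: "0 \<le> T" "tail_lp_norm p N a \<le> ennreal T" and c: "0 \<le> c"
    and le: "\<And>j. N' \<le> j \<Longrightarrow> N \<le> j \<and> norm (b j) \<le> c * norm (a j) \<or> b j = 0"
  shows "tail_lp_norm p N' b \<le> ennreal (c * T)"
proof -
  have cT: "0 \<le> c * T" using c T by simp
  show ?thesis
  proof (cases "p = \<infinity>")
    case True
    then have "norm (a j) \<le> T" if "N \<le> j" for j
      using tail_lp_norm_le_iff[OF p T(1)] T(2) that by simp
    then have "norm (b j) \<le> c * T" if "N' \<le> j" for j
      using le[OF that] c cT by (metis mult_left_mono norm_zero order_trans)
    then show ?thesis using tail_lp_norm_le_iff[OF p cT] True by simp
  next
    case False
    define q where "q = enn2real p"
    have q: "1 \<le> q" unfolding q_def using p False by (rule one_le_enn2real)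
    have "(\<Sum>j\<in>F. norm (b j) powr q) \<le> (c * T) powr q" if F: "finite F" "F \<subseteq> {N'..}" for F
    proof -
      define G where "G = {j \<in> F. b j \<noteq> 0}"
      have "(\<Sum>j\<in>F. norm (b j) powr q) = (\<Sum>j\<in>G. norm (b j) powr q)"
        unfolding G_def using F q by (intro sum.mono_neutral_right) auto
      also have "\<dots> \<le> (\<Sum>j\<in>G. c powr q * norm (a j) powr q)"
      proof (intro sum_mono)
        fix j assume "j \<in> G"
        then have "norm (b j) \<le> c * norm (a j)" using le[of j] F by (auto simp: G_def)
        then have "norm (b j) powr q \<le> (c * norm (a j)) powr q" using q by (intro powr_mono2) auto
        then show "norm (b j) powr q \<le> c powr q * norm (a j) powr q" using c by (simp add: powr_mult)
      qed
      also have "\<dots> = c powr q * (\<Sum>j\<in>G. norm (a j) powr q)" by (simp add: sum_distrib_left)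
      also have "\<dots> \<le> c powr q * T powr q"
      proof (intro mult_left_mono)
        have "G \<subseteq> {N..}" "finite G" using le F by (auto simp: G_def)
        then show "(\<Sum>j\<in>G. norm (a j) powr q) \<le> T powr q"
          using tail_lp_norm_le_iff[OF p T(1)] T(2) False by (simp add: q_def)
      qed auto
      finally show ?thesis using c T by (simp add: powr_mult)
    qed
    then show ?thesis using tail_lp_norm_le_iff[OF p cT] False by (simp add: q_def)
  qed
qed

lemma norm_le_tail_lp_norm:
  assumes p: "1 \<le> p" and T: "0 \<le> T" "tail_lp_norm p N a \<le> ennreal T" and j: "N \<le> j"
  shows "norm (a j) \<le> T"
proof (cases "p = \<infinity>")
  case True then show ?thesis using tail_lp_norm_le_iff[OF p T(1)] T(2) j by simp
next
  case False
  have q: "1 \<le> enn2real p" using p False by (rule one_le_enn2real)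
  have "(\<Sum>j\<in>{j}. norm (a j) powr enn2real p) \<le> T powr enn2real p"
    using j by (intro sum_powr_le_tail_lp_norm[OF p T False]) auto
  then show ?thesis using q T(1) by (smt (verit) powr_less_mono2 sum.insert sum.empty finite.emptyI empty_iff)
qed

lemma lp_space_tail:
  assumes p: "1 \<le> p" and a: "a \<in> lp_space p"
  obtains T where "0 \<le> T" "tail_lp_norm p N a = ennreal T"
proof -
  have "tail_lp_norm p 0 a < \<infinity>" using a by (simp add: lp_space_def)
  then obtain T0 where T0: "0 \<le> T0" "tail_lp_norm p 0 a = ennreal T0"
    by (cases "tail_lp_norm p 0 a") auto
  have "tail_lp_norm p N a \<le> ennreal (1 * T0)"
    by (rule tail_lp_norm_mono[OF p T0(1), of 0 a]) (use T0 in auto)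
  then have "tail_lp_norm p N a < \<infinity>"
    by (metis ennreal_less_top infinity_ennreal_def le_less_trans)
  then show ?thesis using that by (cases "tail_lp_norm p N a") auto
qed

section \<open>Exact interpolation, approximate interpolation and thinness\<close>

theorem thin_imp_EIS:
  assumes z: "blaschke_sequence z" and inj: "inj z" and thin: "thin z" and p: "1 \<le> p"
  shows "EIS p z"
  unfolding EIS_def
proof (intro allI impI)
  fix \<epsilon> :: real assume "0 < \<epsilon>"
  then obtain n d where n: "0 < n" and d: "0 < d" "d < 1" and M: "interpolation_constant n d < 1 + \<epsilon>"
    using interpolation_constant_tends_to_1 by blast
  obtain N where N: "\<And>j. j \<ge> N \<Longrightarrow> d \<le> separation z j"
    using thin_tail_separation[OF thin d(2)] by blast
  let ?M = "interpolation_constant n d"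
  have Mpos: "0 < ?M" by (rule interpolation_constant_pos[OF n d(1)])
  have "\<exists>f\<in>hardy_space p. (\<forall>n\<ge>N. weighted_values p z f n = a n) \<and>
      hardy_norm p f \<le> ennreal (1 + \<epsilon>) * tail_lp_norm p N a" if a: "a \<in> lp_space p" for a
  proof -
    obtain T where T: "0 \<le> T" "tail_lp_norm p N a = ennreal T"
      using lp_space_tail[OF p a] by blast
    \<comment> \<open>\<open>N\<close> depends on \<open>\<epsilon>\<close> alone. For each
      \<open>m\<close> the finite theorem is applied to the nodes with \<open>N \<le> k < m\<close>,
      the data being carried over to points by \<open>inv z\<close>; the bound does not depend on
      \<open>m\<close>, so a limit function exists.\<close>
    have "\<exists>f. f holomorphic_on unit_disc \<and> (\<forall>k\<in>{N..<m}. weighted_values p z f k = a k) \<and>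
        hardy_norm p f \<le> ennreal (?M * T)" for m
    proof -
      have A: "finite (z ` {N..<m})" "separated_by d (z ` {N..<m})"
        using N by (auto intro!: separated_by_image z inj)
      have c: "(if p = \<infinity> then \<forall>b\<in>z ` {N..<m}. norm (a (inv z b)) \<le> T
          else (\<Sum>b\<in>z ` {N..<m}. norm (a (inv z b)) powr enn2real p) \<le> T powr enn2real p)"
        using norm_le_tail_lp_norm[OF p T(1), of N a] sum_powr_le_tail_lp_norm[OF p T(1), of N a "{N..<m}"] T(2) inj
        by (auto simp: sum.reindex inj_on_subset[OF inj] atLeastLessThan_def)
      obtain f where "f holomorphic_on unit_disc"
        "\<And>b. b \<in> z ` {N..<m} \<Longrightarrow> f b * of_real ((1 - (norm b)\<^sup>2) powr enn2real (1 / p)) = a (inv z b)"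
        "hardy_norm p f \<le> ennreal (?M * T)"
        using hardy_interpolation_finite[OF A d(1) less_imp_le[OF d(2)] n p T(1) c] by blast
      then show ?thesis using inj by (intro exI[of _ f]) (auto simp: weighted_values_def)
    qed
    then obtain f where f: "\<And>m. f m holomorphic_on unit_disc"
      "\<And>m k. k \<in> {N..<m} \<Longrightarrow> weighted_values p z (f m) k = a k"
      "\<And>m. hardy_norm p (f m) \<le> ennreal (?M * T)"
      by metis
    have MT: "0 \<le> ?M * T" using Mpos T by simp
    obtain g r where g: "g holomorphic_on unit_disc" "strict_mono (r :: nat \<Rightarrow> nat)"
      "\<And>w. w \<in> unit_disc \<Longrightarrow> (\<lambda>m. f (r m) w) \<longlonglongrightarrow> g w" "hardy_norm p g \<le> ennreal (?M * T)"
      by (rule hardy_norm_Montel[OF p f(1) MT f(3)]) (rule that; assumption)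
    have "weighted_values p z g k = a k" if k: "N \<le> k" for k
    proof -
      have lim: "(\<lambda>m. weighted_values p z (f (r m)) k) \<longlonglongrightarrow> weighted_values p z g k"
        unfolding weighted_values_def by (intro tendsto_intros g(3) blaschke_sequence_in_disc z)
      have "eventually (\<lambda>m. weighted_values p z (f (r m)) k = a k) sequentially"
        using eventually_gt_at_top[of k]
      proof eventually_elim
        case (elim m)
        then have "k < r m" using seq_suble[OF g(2), of m] by simp
        then show ?case using k by (intro f(2)) auto
      qed
      from LIMSEQ_unique[OF lim tendsto_eventually[OF this]] show ?thesis .
    qed
    moreover have "ennreal (?M * T) \<le> ennreal (1 + \<epsilon>) * tail_lp_norm p N a"
      unfolding T(2) using M T(1) Mpos by (subst ennreal_mult[symmetric]) (auto intro!: ennreal_leI mult_right_mono)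
    ultimately show ?thesis
      using g by (intro bexI[of _ g]) (auto simp: hardy_space_def intro: order_trans le_less_trans)
  qed
  then show "\<exists>N. \<forall>a\<in>lp_space p. \<exists>f\<in>hardy_space p. (\<forall>n\<ge>N. weighted_values p z f n = a n) \<and>
      hardy_norm p f \<le> ennreal (1 + \<epsilon>) * tail_lp_norm p N a" by blast
qed

text \<open>Dividing the exact interpolant by \<open>1 + \<epsilon>\<close> restores the norm bound;
  its values then miss \<open>a j\<close> by the proportion
  \<open>\<epsilon> / (1 + \<epsilon>)\<close>, which is at most \<open>\<epsilon>\<close>.\<close>

theorem EIS_imp_strong_AIS:
  assumes p: "1 \<le> p" and EIS: "EIS p z"
  shows "strong_AIS p z"
  unfolding strong_AIS_def
proof (intro allI impI)
  fix \<epsilon> :: real assume \<epsilon>: "0 < \<epsilon>"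
  then obtain N where N: "\<And>a. a \<in> lp_space p \<Longrightarrow> \<exists>f\<in>hardy_space p. (\<forall>n\<ge>N. weighted_values p z f n = a n) \<and>
      hardy_norm p f \<le> ennreal (1 + \<epsilon>) * tail_lp_norm p N a"
    using EIS unfolding EIS_def by blast
  have "\<exists>G\<in>hardy_space p. hardy_norm p G \<le> tail_lp_norm p N a \<and>
      tail_lp_norm p N (\<lambda>j. weighted_values p z G j - a j) \<le> ennreal \<epsilon> * tail_lp_norm p N a"
    if a: "a \<in> lp_space p" for a
  proof -
    obtain T where T: "0 \<le> T" "tail_lp_norm p N a = ennreal T"
      using lp_space_tail[OF p a] by blast
    obtain f where f: "f \<in> hardy_space p" "\<And>n. n \<ge> N \<Longrightarrow> weighted_values p z f n = a n"
      "hardy_norm p f \<le> ennreal (1 + \<epsilon>) * tail_lp_norm p N a"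
      using N[OF a] by blast
    have hol: "f holomorphic_on unit_disc" using f(1) by (simp add: hardy_space_def)
    have fT: "hardy_norm p f \<le> ennreal ((1 + \<epsilon>) * T)"
      using f(3) \<epsilon> T by (simp add: ennreal_mult)
    define c where "c = complex_of_real (1 / (1 + \<epsilon>))"
    have nc: "norm c = 1 / (1 + \<epsilon>)" using \<epsilon> by (simp only: c_def norm_of_real) simp
    define G where "G = (\<lambda>w. c * f w)"
    have "hardy_norm p G \<le> ennreal (norm c * ((1 + \<epsilon>) * T))"
      unfolding G_def using \<epsilon> T by (intro hardy_norm_cmult_le p hol fT) auto
    then have GT: "hardy_norm p G \<le> ennreal T"
      using \<epsilon> by (simp add: nc)
    have "tail_lp_norm p N (\<lambda>j. weighted_values p z G j - a j) \<le> ennreal (\<epsilon> * T)"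
    proof (rule tail_lp_norm_mono[OF p T(1), of N a])
      fix j assume j: "N \<le> j"
      have diff: "weighted_values p z G j - a j = (c - 1) * a j"
        using f(2)[OF j] by (simp add: G_def weighted_values_def algebra_simps)
      have "c - 1 = of_real (- \<epsilon> / (1 + \<epsilon>))"
      proof -
        have "1 / (1 + \<epsilon>) - 1 = - \<epsilon> / (1 + \<epsilon>)" using \<epsilon> by (simp add: field_simps)
        then show ?thesis unfolding c_def by (metis of_real_1 of_real_diff)
      qed
      then have "norm (c - 1) = \<epsilon> / (1 + \<epsilon>)" using \<epsilon> by (simp only: norm_of_real) simp
      moreover have "\<epsilon> / (1 + \<epsilon>) \<le> \<epsilon>" using \<epsilon> by (simp add: field_simps)
      ultimately have "norm (c - 1) \<le> \<epsilon>" by simp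
      then show "N \<le> j \<and> norm (weighted_values p z G j - a j) \<le> \<epsilon> * norm (a j) \<or> weighted_values p z G j - a j = 0"
        using j by (simp add: diff norm_mult mult_right_mono)
    qed (use T \<epsilon> in auto)
    then have "tail_lp_norm p N (\<lambda>j. weighted_values p z G j - a j) \<le> ennreal \<epsilon> * tail_lp_norm p N a"
      using \<epsilon> T by (simp add: ennreal_mult)
    moreover have "G holomorphic_on unit_disc" unfolding G_def by (intro holomorphic_intros hol)
    ultimately show ?thesis
      using GT T(2) by (intro bexI[of _ G]) (auto simp: hardy_space_def intro: le_less_trans)
  qed
  then show "\<exists>N. \<forall>a\<in>lp_space p. \<exists>G\<in>hardy_space p. hardy_norm p G \<le> tail_lp_norm p N a \<and>
      tail_lp_norm p N (\<lambda>j. weighted_values p z G j - a j) \<le> ennreal \<epsilon> * tail_lp_norm p N a" by blast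
qed

text \<open>The error of an approximate interpolation is interpolated again, and so on; the resulting
  series is dominated by the geometric series of ratio \<open>\<eta> = \<epsilon> / (1 + \<epsilon>)\<close>, whose sum is \<open>1 + \<epsilon>\<close>.\<close>

theorem strong_AIS_imp_EIS:
  assumes z: "blaschke_sequence z" and p: "1 \<le> p" and AIS: "strong_AIS p z"
  shows "EIS p z"
  unfolding EIS_def
proof (intro allI impI)
  fix \<epsilon> :: real assume \<epsilon>: "0 < \<epsilon>"
  define \<eta> where "\<eta> = \<epsilon> / (1 + \<epsilon>)"
  have \<eta>: "0 < \<eta>" "\<eta> < 1" "1 / (1 - \<eta>) = 1 + \<epsilon>"
    using \<epsilon> by (auto simp: \<eta>_def field_simps)
  obtain N where "\<forall>a\<in>lp_space p. \<exists>G\<in>hardy_space p. hardy_norm p G \<le> tail_lp_norm p N a \<and>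
      tail_lp_norm p N (\<lambda>j. weighted_values p z G j - a j) \<le> ennreal \<eta> * tail_lp_norm p N a"
    using AIS \<eta>(1) unfolding strong_AIS_def by blast
  then obtain S where S: "\<And>a. a \<in> lp_space p \<Longrightarrow> S a \<in> hardy_space p"
    "\<And>a. a \<in> lp_space p \<Longrightarrow> hardy_norm p (S a) \<le> tail_lp_norm p N a"
    "\<And>a. a \<in> lp_space p \<Longrightarrow> tail_lp_norm p N (\<lambda>j. weighted_values p z (S a) j - a j) \<le> ennreal \<eta> * tail_lp_norm p N a"
    by metis
  have "\<exists>f\<in>hardy_space p. (\<forall>n\<ge>N. weighted_values p z f n = a n) \<and>
      hardy_norm p f \<le> ennreal (1 + \<epsilon>) * tail_lp_norm p N a" if a: "a \<in> lp_space p" for a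
  proof -
    obtain T where T: "0 \<le> T" "tail_lp_norm p N a = ennreal T"
      using lp_space_tail[OF p a] by blast
    \<comment> \<open>The error is set to 0 before \<open>N\<close>, where nothing is known about
      it. Its norm over the whole index set is then controlled by the tail, so it lies in
      \<open>lp_space p\<close> and can be interpolated again.\<close>
    define next_error where "next_error = (\<lambda>b j. if j < N then 0 else b j - weighted_values p z (S b) j)"
    define b where "b = (\<lambda>k. (next_error ^^ k) a)"
    have b0: "b 0 = a" and bS: "b (Suc k) = next_error (b k)" for k
      by (simp_all add: b_def)
    have inv: "b k \<in> lp_space p \<and> tail_lp_norm p N (b k) \<le> ennreal (\<eta> ^ k * T)" for k
    proof (induction k)
      case 0
      then show ?case using a T by (simp add: b0)
    next
      case (Suc k)
      then have bk: "b k \<in> lp_space p" "tail_lp_norm p N (b k) \<le> ennreal (\<eta> ^ k * T)" by auto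
      have T': "0 \<le> \<eta> * (\<eta> ^ k * T)" using \<eta> T by simp
      have "tail_lp_norm p N (\<lambda>j. weighted_values p z (S (b k)) j - b k j) \<le> ennreal \<eta> * tail_lp_norm p N (b k)"
        by (rule S(3)[OF bk(1)])
      also have "\<dots> \<le> ennreal \<eta> * ennreal (\<eta> ^ k * T)" by (intro mult_left_mono bk(2)) auto
      also have "\<dots> = ennreal (\<eta> * (\<eta> ^ k * T))" using \<eta> T by (subst ennreal_mult) auto
      finally have err: "tail_lp_norm p N (\<lambda>j. weighted_values p z (S (b k)) j - b k j) \<le> ennreal (\<eta> * (\<eta> ^ k * T))" .
      have *: "tail_lp_norm p N' (b (Suc k)) \<le> ennreal (1 * (\<eta> * (\<eta> ^ k * T)))" for N'
        by (rule tail_lp_norm_mono[OF p T' err])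
           (auto simp: bS next_error_def norm_minus_commute not_less)
      show ?case using *[of 0] *[of N] by (auto simp: lp_space_def mult.assoc intro: le_less_trans)
    qed
    define f where "f = (\<lambda>n w. \<Sum>k<n. S (b k) w)"
    have holS: "S (b k) holomorphic_on unit_disc" for k
      using S(1) inv by (auto simp: hardy_space_def)
    have hol: "f n holomorphic_on unit_disc" for n
      unfolding f_def by (intro holomorphic_intros holS)
    have fn: "hardy_norm p (f n) \<le> ennreal ((\<Sum>k<n. \<eta> ^ k) * T)" for n
    proof (induction n)
      case 0
      have "hardy_norm p (\<lambda>w. 0) \<le> ennreal 0"
        using hardy_norm_le_iff[OF p, of 0 "\<lambda>w. 0"] by auto
      then show ?case by (simp add: f_def)
    next
      case (Suc n)
      have "hardy_norm p (S (b n)) \<le> ennreal (\<eta> ^ n * T)"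
        using S(2) inv[of n] order_trans by blast
      then have "hardy_norm p (\<lambda>w. f n w + S (b n) w) \<le> ennreal ((\<Sum>k<n. \<eta> ^ k) * T + \<eta> ^ n * T)"
        using \<eta> T by (intro hardy_norm_add_le p hol holS Suc mult_nonneg_nonneg sum_nonneg) auto
      then show ?case by (simp add: f_def algebra_simps)
    qed
    have fK: "hardy_norm p (f n) \<le> ennreal ((1 + \<epsilon>) * T)" for n
    proof -
      have "(\<Sum>k<n. \<eta> ^ k) = (1 - \<eta> ^ n) / (1 - \<eta>)"
        using \<eta> by (simp add: sum_gp_strict)
      also have "\<dots> \<le> 1 / (1 - \<eta>)"
        using \<eta> by (intro divide_right_mono) auto
      finally have "(\<Sum>k<n. \<eta> ^ k) * T \<le> (1 + \<epsilon>) * T"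
        unfolding \<eta>(3) using T by (intro mult_right_mono)
      then show ?thesis using fn[of n] by (meson ennreal_leI order_trans)
    qed
    \<comment> \<open>Values of the partial sum and current error always add up to
      \<open>a j\<close>, so the values converge because the errors tend to 0.\<close>
    have W: "weighted_values p z (f n) j = a j - b n j" if j: "N \<le> j" for n j
    proof (induction n)
      case 0
      then show ?case by (simp add: f_def b0 weighted_values_def)
    next
      case (Suc n)
      have "weighted_values p z (f (Suc n)) j = weighted_values p z (f n) j + weighted_values p z (S (b n)) j"
        by (simp add: f_def weighted_values_def algebra_simps)
      then show ?case using Suc j by (simp add: bS next_error_def)
    qed
    have K: "0 \<le> (1 + \<epsilon>) * T" using \<epsilon> T by simp
    obtain g r where g: "g holomorphic_on unit_disc" "strict_mono (r :: nat \<Rightarrow> nat)"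
      "\<And>w. w \<in> unit_disc \<Longrightarrow> (\<lambda>m. f (r m) w) \<longlonglongrightarrow> g w" "hardy_norm p g \<le> ennreal ((1 + \<epsilon>) * T)"
      by (rule hardy_norm_Montel[OF p hol K fK]) (rule that; assumption)
    have "weighted_values p z g j = a j" if j: "N \<le> j" for j
    proof -
      have "(\<lambda>m. weighted_values p z (f (r m)) j) \<longlonglongrightarrow> weighted_values p z g j"
        unfolding weighted_values_def by (intro tendsto_intros g(3) blaschke_sequence_in_disc z)
      moreover have "(\<lambda>m. b (r m) j) \<longlonglongrightarrow> 0"
      proof (rule Lim_null_comparison)
        have "norm (b n j) \<le> \<eta> ^ n * T" for n
          using inv[of n] \<eta> T j by (intro norm_le_tail_lp_norm[OF p]) auto
        then show "\<forall>\<^sub>F m in sequentially. norm (b (r m) j) \<le> \<eta> ^ r m * T" by simp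
        have "(\<lambda>m. \<eta> ^ m) \<longlonglongrightarrow> 0" using \<eta> by (intro LIMSEQ_power_zero) auto
        from tendsto_mult[OF LIMSEQ_subseq_LIMSEQ[OF this g(2)] tendsto_const[of T]]
        show "(\<lambda>m. \<eta> ^ r m * T) \<longlonglongrightarrow> 0" by (simp add: o_def)
      qed
      then have "(\<lambda>m. weighted_values p z (f (r m)) j) \<longlonglongrightarrow> a j - 0"
        unfolding W[OF j] by (intro tendsto_intros)
      ultimately show ?thesis by (simp add: LIMSEQ_unique)
    qed
    moreover have "hardy_norm p g \<le> ennreal (1 + \<epsilon>) * tail_lp_norm p N a"
      unfolding T(2) using \<epsilon> T(1) g(4) by (subst ennreal_mult[symmetric]) auto
    moreover have "g \<in> hardy_space p"
      using g(1,4) by (auto simp: hardy_space_def intro: le_less_trans)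
    ultimately show ?thesis by blast
  qed
  then show "\<exists>N. \<forall>a\<in>lp_space p. \<exists>f\<in>hardy_space p. (\<forall>n\<ge>N. weighted_values p z f n = a n) \<and>
      hardy_norm p f \<le> ennreal (1 + \<epsilon>) * tail_lp_norm p N a" by blast
qed

text \<open>The interpolant of a unit vector vanishes at all other points of the tail. By point
  evaluation its weighted value at \<open>z j\<close>, which is 1, is at most
  \<open>1 + \<epsilon>\<close> times the Blaschke product over finitely many of these
  zeros.\<close>

theorem EIS_imp_thin:
  assumes z: "blaschke_sequence z" and inj: "inj z" and p: "1 \<le> p" and EIS: "EIS p z"
  shows "thin z"
proof (rule thinI[OF z inj])
  fix \<epsilon> :: real assume \<epsilon>: "0 < \<epsilon>"
  then obtain N where N: "\<And>a. a \<in> lp_space p \<Longrightarrow> \<exists>f\<in>hardy_space p. (\<forall>n\<ge>N. weighted_values p z f n = a n) \<and>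
      hardy_norm p f \<le> ennreal (1 + \<epsilon>) * tail_lp_norm p N a"
    using EIS unfolding EIS_def by blast
  have "1 - \<epsilon> \<le> (\<Prod>k\<in>{N..<M} - {j}. norm (blaschke_factor (z k) (z j)))" if j: "j \<ge> N" for j M
  proof -
    define a where "a = (\<lambda>k. if k = j then 1 else 0 :: complex)"
    have tail: "tail_lp_norm p n a \<le> ennreal 1" for n
    proof (cases "p = \<infinity>")
      case True
      then show ?thesis using tail_lp_norm_le_iff[OF p, of 1 n a] by (simp add: a_def)
    next
      case False
      have q: "1 \<le> enn2real p" using p False by (rule one_le_enn2real)
      have "(\<Sum>k\<in>F. norm (a k) powr enn2real p) \<le> 1" if "finite F" for F
      proof -
        have "(\<Sum>k\<in>F. norm (a k) powr enn2real p) = (\<Sum>k\<in>F. if k = j then 1 else 0)"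
          using q by (intro sum.cong) (auto simp: a_def)
        also have "\<dots> \<le> 1" using that by simp
        finally show ?thesis .
      qed
      then show ?thesis using tail_lp_norm_le_iff[OF p, of 1 n a] False by simp
    qed
    have "a \<in> lp_space p" using tail[of 0] by (auto simp: lp_space_def intro: le_less_trans)
    then obtain f where f: "f \<in> hardy_space p" "\<And>n. n \<ge> N \<Longrightarrow> weighted_values p z f n = a n"
      "hardy_norm p f \<le> ennreal (1 + \<epsilon>) * tail_lp_norm p N a"
      using N by blast
    have "ennreal (1 + \<epsilon>) * tail_lp_norm p N a \<le> ennreal (1 + \<epsilon>) * 1"
      using tail[of N] by (intro mult_left_mono) auto
    with f(3) have fK: "hardy_norm p f \<le> ennreal (1 + \<epsilon>)" by simp
    have wpos: "(1 - (norm (z k))\<^sup>2) powr enn2real (1 / p) > 0" for k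
      using blaschke_sequence_weight_pos[OF z, of k] by simp
    let ?A = "z ` ({N..<M} - {j})"
    have zero: "f (z k) = 0" if "N \<le> k" "k \<noteq> j" for k
    proof -
      have "weighted_values p z f k = 0" using f(2)[of k] that by (simp add: a_def)
      then show ?thesis using wpos[of k] by (simp add: weighted_values_def)
    qed
    have "f b = 0" if "b \<in> ?A" for b
      using that
    proof (rule imageE)
      fix k assume "b = z k" "k \<in> {N..<M} - {j}"
      then show "f b = 0" using zero[of k] by simp
    qed
    moreover have "f holomorphic_on unit_disc" using f(1) by (simp add: hardy_space_def)
    moreover have "?A \<subseteq> unit_disc" using blaschke_sequence_in_disc[OF z] by blast
    ultimately have "norm (f (z j)) * (1 - (norm (z j))\<^sup>2) powr enn2real (1 / p) \<le> (1 + \<epsilon>) * (\<Prod>b\<in>?A. norm (blaschke_factor b (z j)))"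
      using fK \<epsilon> blaschke_sequence_in_disc[OF z, of j]
      by (intro hardy_point_evaluation[OF p]) simp_all
    also have "norm (f (z j)) * (1 - (norm (z j))\<^sup>2) powr enn2real (1 / p) = norm (weighted_values p z f j)"
      using wpos[of j] by (simp add: weighted_values_def norm_mult)
    also have "\<dots> = 1" using f(2)[OF j] by (simp add: a_def)
    also have "(\<Prod>b\<in>?A. norm (blaschke_factor b (z j))) = (\<Prod>k\<in>{N..<M} - {j}. norm (blaschke_factor (z k) (z j)))"
      using inj by (subst prod.reindex) (auto intro: inj_on_subset)
    finally have "1 / (1 + \<epsilon>) \<le> (\<Prod>k\<in>{N..<M} - {j}. norm (blaschke_factor (z k) (z j)))"
      using \<epsilon> by (simp add: field_simps)
    moreover have "1 - \<epsilon> \<le> 1 / (1 + \<epsilon>)"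
      using \<epsilon> by (simp add: field_simps)
    ultimately show ?thesis by linarith
  qed
  then show "\<exists>N. \<forall>j\<ge>N. \<forall>M. 1 - \<epsilon> \<le> (\<Prod>k\<in>{N..<M} - {j}. norm (blaschke_factor (z k) (z j)))" by blast
qed

section \<open>Taylor coefficients and the pairing on \<open>H\<^sup>2\<close>\<close>

definition taylor_coeff :: "(complex \<Rightarrow> complex) \<Rightarrow> nat \<Rightarrow> complex" where
  "taylor_coeff f n = (deriv ^^ n) f 0 / fact n"

lemma taylor_coeff_sums:
  assumes "f holomorphic_on unit_disc" "u \<in> unit_disc"
  shows "(\<lambda>n. taylor_coeff f n * u ^ n) sums f u"
  using holomorphic_power_series[OF assms] by (simp add: taylor_coeff_def)

lemma taylor_coeff_summable:
  assumes f: "f holomorphic_on unit_disc" and r: "0 \<le> r" "r < 1"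
  shows "summable (\<lambda>n. norm (taylor_coeff f n) * r ^ n)"
proof -
  define x where "x = complex_of_real ((1 + r) / 2)"
  have nx: "norm x = (1 + r) / 2"
    using r unfolding x_def by (simp only: norm_of_real) simp
  have "summable (\<lambda>n. norm (taylor_coeff f n * of_real r ^ n))"
  proof (rule powser_insidea)
    show "summable (\<lambda>n. taylor_coeff f n * x ^ n)"
      by (rule sums_summable[OF taylor_coeff_sums[OF f]]) (use r in \<open>simp add: nx\<close>)
    show "norm (complex_of_real r) < norm x"
      using r by (simp add: nx)
  qed
  then show ?thesis using r by (simp add: norm_mult norm_power)
qed

text \<open>Only \<open>g\<close> is expanded: its Taylor series converges uniformly on the circle,
  and the mean of \<open>f u * cnj u ^ n\<close> is a multiple of the Taylor coefficient of
  \<open>f\<close>.\<close>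

theorem Parseval_circle:
  assumes f: "f holomorphic_on unit_disc" and g: "g holomorphic_on unit_disc" and r: "0 < r" "r < 1"
  shows "(\<lambda>n. taylor_coeff f n * cnj (taylor_coeff g n) * of_real (r ^ (2 * n))) sums
    circ_mean r (\<lambda>u. f u * cnj (g u))"
proof -
  define S where "S = (\<lambda>N u. \<Sum>n<N. taylor_coeff g n * u ^ n)"
  have cS: "continuous_on (sphere 0 r) (S N)" for N
    unfolding S_def by (intro continuous_intros)
  note cf = holomorphic_on_disc_subsets(2)[OF f r(2)] and cg = holomorphic_on_disc_subsets(2)[OF g r(2)]
  obtain B where B: "0 < B" "\<And>u. u \<in> sphere 0 r \<Longrightarrow> norm (f u) \<le> B"
    using compact_imp_bounded[OF compact_continuous_image[OF cf compact_sphere]]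
    unfolding bounded_pos by (metis imageI)
  have unif: "uniform_limit (sphere 0 r) S (\<lambda>u. \<Sum>n. taylor_coeff g n * u ^ n) sequentially"
    unfolding S_def
    by (rule Weierstrass_m_test[OF _ taylor_coeff_summable[OF g, of r]])
       (use r in \<open>auto simp: norm_mult norm_power\<close>)
  have gS: "(\<Sum>n. taylor_coeff g n * u ^ n) = g u" if "u \<in> sphere 0 r" for u
    using taylor_coeff_sums[OF g, of u] that r by (simp add: sums_iff)
  have partial: "(\<Sum>n<N. taylor_coeff f n * cnj (taylor_coeff g n) * of_real (r ^ (2 * n))) =
      circ_mean r (\<lambda>u. f u * cnj (S N u))" for N
  proof -
    have c: "continuous_on (sphere 0 r) (\<lambda>u. f u * cnj u ^ n)" for n
      by (intro continuous_on_mult cf continuous_intros)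
    have "circ_mean r (\<lambda>u. f u * cnj (S N u)) =
        circ_mean r (\<lambda>u. \<Sum>n<N. cnj (taylor_coeff g n) * (f u * cnj u ^ n))"
      unfolding S_def by (simp add: sum_distrib_left mult_ac)
    also have "\<dots> = (\<Sum>n<N. cnj (taylor_coeff g n) * circ_mean r (\<lambda>u. f u * cnj u ^ n))"
      using r by (simp add: circ_mean_sum circ_mean_mult_left c continuous_on_mult_left)
    also have "\<dots> = (\<Sum>n<N. taylor_coeff f n * cnj (taylor_coeff g n) * of_real (r ^ (2 * n)))"
      unfolding circ_mean_power[OF f r] by (simp add: taylor_coeff_def mult_ac)
    finally show ?thesis ..
  qed
  have "(\<lambda>N. \<Sum>n<N. taylor_coeff f n * cnj (taylor_coeff g n) * of_real (r ^ (2 * n))) \<longlonglongrightarrow>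
      circ_mean r (\<lambda>u. f u * cnj (g u))"
    unfolding partial
  proof (rule LIMSEQ_I)
    fix e :: real assume e: "0 < e"
    then have "0 < e / (2 * B)" using B by simp
    from uniform_limitD[OF unif this] obtain N0 where
      N0: "\<And>N u. N \<ge> N0 \<Longrightarrow> u \<in> sphere 0 r \<Longrightarrow> dist (S N u) (\<Sum>n. taylor_coeff g n * u ^ n) < e / (2 * B)"
      unfolding eventually_sequentially by meson
    have "norm (circ_mean r (\<lambda>u. f u * cnj (S N u)) - circ_mean r (\<lambda>u. f u * cnj (g u))) < e" if N: "N \<ge> N0" for N
    proof -
      have c1: "continuous_on (sphere 0 r) (\<lambda>u. f u * cnj (S N u))" "continuous_on (sphere 0 r) (\<lambda>u. f u * cnj (g u))"
        by (intro continuous_on_mult continuous_on_cnj cf cg cS)+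
      have c2: "continuous_on (sphere 0 r) (\<lambda>u. f u * cnj (S N u) - f u * cnj (g u))"
        by (intro continuous_on_diff c1)
      have "norm (circ_mean r (\<lambda>u. f u * cnj (S N u)) - circ_mean r (\<lambda>u. f u * cnj (g u))) =
          norm (circ_mean r (\<lambda>u. f u * cnj (S N u) - f u * cnj (g u)))"
        using r c1 by (simp add: circ_mean_diff)
      also have "\<dots> \<le> circ_mean r (\<lambda>u. norm (f u * cnj (S N u) - f u * cnj (g u)))"
        using r c2 by (intro norm_circ_mean_le) auto
      also have "\<dots> \<le> B * (e / (2 * B))"
      proof (rule circ_mean_le_const)
        fix u :: complex assume "norm u = r"
        then have u: "u \<in> sphere 0 r" by simp
        have "norm (f u * cnj (S N u) - f u * cnj (g u)) = norm (f u) * norm (S N u - g u)"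
          by (metis complex_cnj_diff complex_mod_cnj norm_mult right_diff_distrib)
        also have "\<dots> \<le> B * (e / (2 * B))"
          using N0[OF N u] B(1) B(2)[OF u] unfolding gS[OF u] dist_norm by (intro mult_mono) auto
        finally show "norm (f u * cnj (S N u) - f u * cnj (g u)) \<le> B * (e / (2 * B))" .
      qed (use r c2 in \<open>auto intro: continuous_on_norm\<close>)
      also have "\<dots> < e" using B e by simp
      finally show ?thesis .
    qed
    then show "\<exists>N0. \<forall>N\<ge>N0. norm (circ_mean r (\<lambda>u. f u * cnj (S N u)) - circ_mean r (\<lambda>u. f u * cnj (g u))) < e"
      by blast
  qed
  then show ?thesis by (simp add: sums_def)
qed

lemma Parseval_circle_norm:
  assumes f: "f holomorphic_on unit_disc" and r: "0 < r" "r < 1"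
  shows "(\<lambda>n. (norm (taylor_coeff f n))\<^sup>2 * r ^ (2 * n)) sums circ_mean r (\<lambda>u. (norm (f u))\<^sup>2)"
proof -
  have "circ_mean r (\<lambda>u. f u * cnj (f u)) = circ_mean r (\<lambda>u. complex_of_real ((norm (f u))\<^sup>2))"
    by (simp only: complex_norm_square)
  also have "\<dots> = of_real (circ_mean r (\<lambda>u. (norm (f u))\<^sup>2))"
    using r by (intro circ_mean_of_real continuous_on_power continuous_on_norm holomorphic_on_disc_subsets(2)[OF f]) auto
  finally have "(\<lambda>n. complex_of_real ((norm (taylor_coeff f n))\<^sup>2 * r ^ (2 * n))) sums of_real (circ_mean r (\<lambda>u. (norm (f u))\<^sup>2))"
    using Parseval_circle[OF f f r] by (simp only: complex_norm_square of_real_mult)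
  then show ?thesis by (simp only: sums_of_real_iff)
qed

lemma hardy_norm_2_le_iff_circ_mean:
  assumes K: "0 \<le> K" and f: "f holomorphic_on unit_disc"
  shows "hardy_norm 2 f \<le> ennreal K \<longleftrightarrow> (\<forall>r\<in>{0<..<1}. circ_mean r (\<lambda>u. (norm (f u))\<^sup>2) \<le> K\<^sup>2)"
  using hardy_norm_le_iff[of 2 K f] K f by (simp add: powr_numeral)

text \<open>By Parseval's identity the circle means are power series in \<open>r\<close> with
  nonnegative coefficients \<open>|c_n|^2\<close>. Their partial sums pass to \<open>r = 1\<close>
  by continuity, and conversely the powers of \<open>r\<close> are at most 1.\<close>

lemma hardy_norm_2_le_iff:
  assumes K: "0 \<le> K" and f: "f holomorphic_on unit_disc"
  shows "hardy_norm 2 f \<le> ennreal K \<longleftrightarrow>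
    summable (\<lambda>n. (norm (taylor_coeff f n))\<^sup>2) \<and> (\<Sum>n. (norm (taylor_coeff f n))\<^sup>2) \<le> K\<^sup>2"
proof
  let ?x = "\<lambda>n. (norm (taylor_coeff f n))\<^sup>2"
  assume le: "hardy_norm 2 f \<le> ennreal K"
  have "sum ?x {..<M} \<le> K\<^sup>2" for M
  proof -
    have "eventually (\<lambda>r. (\<Sum>n<M. ?x n * r ^ (2 * n)) \<le> K\<^sup>2) (at_left (1::real))"
      using eventually_at_left_real[OF zero_less_one]
    proof eventually_elim
      case (elim r)
      then have r: "0 < r" "r < 1" by auto
      have "(\<Sum>n<M. ?x n * r ^ (2 * n)) \<le> (\<Sum>n. ?x n * r ^ (2 * n))"
        using r by (intro sum_le_suminf sums_summable[OF Parseval_circle_norm[OF f r]]) auto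
      also have "\<dots> \<le> K\<^sup>2"
        using hardy_norm_2_le_iff_circ_mean[OF K f] le r Parseval_circle_norm[OF f r] by (simp add: sums_iff)
      finally show ?case .
    qed
    moreover have "((\<lambda>r. \<Sum>n<M. ?x n * r ^ (2 * n)) \<longlongrightarrow> (\<Sum>n<M. ?x n * 1 ^ (2 * n))) (at_left (1::real))"
      by (intro tendsto_intros)
    ultimately have "(\<Sum>n<M. ?x n * 1 ^ (2 * n)) \<le> K\<^sup>2"
      by (intro tendsto_upperbound[where F = "at_left (1::real)"]) auto
    then show ?thesis by simp
  qed
  then show "summable ?x \<and> suminf ?x \<le> K\<^sup>2"
    using summableI_nonneg_bounded[of ?x "K\<^sup>2"] suminf_le_const[of ?x "K\<^sup>2"] by auto
next
  let ?x = "\<lambda>n. (norm (taylor_coeff f n))\<^sup>2"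
  assume S: "summable ?x \<and> suminf ?x \<le> K\<^sup>2"
  have "circ_mean r (\<lambda>u. (norm (f u))\<^sup>2) \<le> K\<^sup>2" if r: "0 < r" "r < 1" for r
  proof -
    have "circ_mean r (\<lambda>u. (norm (f u))\<^sup>2) = (\<Sum>n. ?x n * r ^ (2 * n))"
      using Parseval_circle_norm[OF f r] by (simp add: sums_iff)
    also have "\<dots> \<le> suminf ?x"
      using r S sums_summable[OF Parseval_circle_norm[OF f r]]
      by (intro suminf_le) (auto intro!: mult_left_le power_le_one)
    finally show ?thesis using S by simp
  qed
  then show "hardy_norm 2 f \<le> ennreal K"
    using hardy_norm_2_le_iff_circ_mean[OF K f] by simp
qed

lemma hardy_space_2_norm:
  assumes "f \<in> hardy_space 2"
  obtains K where "0 \<le> K" "hardy_norm 2 f = ennreal K"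
  using assms by (cases "hardy_norm 2 f") (auto simp: hardy_space_def)

lemma hardy_space_2_holomorphic: "f \<in> hardy_space 2 \<Longrightarrow> f holomorphic_on unit_disc"
  by (simp add: hardy_space_def)

lemma hardy_space_2I: "f holomorphic_on unit_disc \<Longrightarrow> hardy_norm 2 f \<le> ennreal K \<Longrightarrow> f \<in> hardy_space 2"
  by (auto simp: hardy_space_def intro: le_less_trans)

lemma hardy_space_2_summable:
  assumes "f \<in> hardy_space 2"
  shows "summable (\<lambda>n. (norm (taylor_coeff f n))\<^sup>2)"
proof -
  obtain K where "0 \<le> K" "hardy_norm 2 f = ennreal K" using hardy_space_2_norm[OF assms] .
  then show ?thesis using hardy_norm_2_le_iff[of K f] hardy_space_2_holomorphic[OF assms] by simp
qed

text \<open>The characterisation of upper bounds is used twice, for \<open>K\<close> itself and for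
  the square root of the sum.\<close>

lemma hardy_norm_2_eq:
  assumes f: "f \<in> hardy_space 2" and K: "0 \<le> K" "hardy_norm 2 f = ennreal K"
  shows "(\<Sum>n. (norm (taylor_coeff f n))\<^sup>2) = K\<^sup>2"
proof -
  let ?S = "\<Sum>n. (norm (taylor_coeff f n))\<^sup>2"
  note hol = hardy_space_2_holomorphic[OF f]
  have S0: "0 \<le> ?S" by (intro suminf_nonneg hardy_space_2_summable f) auto
  have "?S \<le> K\<^sup>2" using hardy_norm_2_le_iff[OF K(1) hol] K by simp
  moreover have "hardy_norm 2 f \<le> ennreal (sqrt ?S)"
    using hardy_norm_2_le_iff[OF real_sqrt_ge_zero[OF S0] hol] hardy_space_2_summable[OF f] S0 by simp
  then have "K \<le> sqrt ?S" using K S0 by simp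
  then have "K\<^sup>2 \<le> (sqrt ?S)\<^sup>2" using K by (intro power_mono) auto
  ultimately show ?thesis using S0 by simp
qed

lemma summable_product_square:
  fixes x y :: "nat \<Rightarrow> complex"
  assumes "summable (\<lambda>n. (norm (x n))\<^sup>2)" "summable (\<lambda>n. (norm (y n))\<^sup>2)"
  shows "summable (\<lambda>n. norm (x n * cnj (y n)))"
proof (rule summable_comparison_test')
  show "summable (\<lambda>n. (norm (x n))\<^sup>2 + (norm (y n))\<^sup>2)" using assms by (rule summable_add)
  fix n
  have "0 \<le> (norm (x n) - norm (y n))\<^sup>2" "0 \<le> norm (x n) * norm (y n)" by simp_all
  then have "norm (x n) * norm (y n) \<le> (norm (x n))\<^sup>2 + (norm (y n))\<^sup>2"
    unfolding power2_diff by linarith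
  then show "norm (norm (x n * cnj (y n))) \<le> (norm (x n))\<^sup>2 + (norm (y n))\<^sup>2"
    by (simp add: norm_mult)
qed

text \<open>\<open>hardy_inner\<close> is a \<open>Lim\<close>, so its value is meaningful only once
  convergence is known. The Parseval series converges uniformly for \<open>r\<close> in
  \<open>{0..1}\<close> and is therefore continuous at 1.\<close>

theorem hardy_pairing_tendsto:
  assumes f: "f \<in> hardy_space 2" and g: "g \<in> hardy_space 2"
  shows "((\<lambda>r. circ_mean r (\<lambda>u. f u * cnj (g u))) \<longlongrightarrow> (\<Sum>n. taylor_coeff f n * cnj (taylor_coeff g n))) (at_left 1)"
proof -
  let ?a = "\<lambda>n. taylor_coeff f n * cnj (taylor_coeff g n)"
  let ?\<psi> = "\<lambda>r::real. \<Sum>n. ?a n * of_real (r ^ (2 * n))"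
  have "uniform_limit {0..1} (\<lambda>N r. \<Sum>n<N. ?a n * of_real (r ^ (2 * n))) ?\<psi> sequentially"
  proof (rule Weierstrass_m_test)
    show "summable (\<lambda>n. norm (?a n))"
      by (intro summable_product_square hardy_space_2_summable f g)
    show "norm (?a n * of_real (r ^ (2 * n))) \<le> norm (?a n)" if "r \<in> {0..1}" for n and r :: real
      using that power_le_one[of r "2 * n"] unfolding norm_mult norm_of_real
      by (intro mult_left_le) (auto intro!: mult_nonneg_nonneg)
  qed
  then have "continuous_on {0..1} ?\<psi>"
    by (rule uniform_limit_theorem[rotated]) (auto intro!: always_eventually continuous_intros)
  then have "(?\<psi> \<longlongrightarrow> ?\<psi> 1) (at_left 1)"
    by (rule continuous_on_Icc_at_leftD) simp
  moreover have "eventually (\<lambda>r. ?\<psi> r = circ_mean r (\<lambda>u. f u * cnj (g u))) (at_left 1)"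
    using eventually_at_left_real[OF zero_less_one]
  proof eventually_elim
    case (elim r)
    then show ?case
      using Parseval_circle[OF hardy_space_2_holomorphic[OF f] hardy_space_2_holomorphic[OF g], of r]
      by (simp add: sums_iff)
  qed
  ultimately show ?thesis
    by (simp add: filterlim_cong[OF refl refl])
qed

lemma hardy_inner_eqI:
  assumes "((\<lambda>r. circ_mean r (\<lambda>u. f u * cnj (g u))) \<longlongrightarrow> L) (at_left 1)"
  shows "hardy_inner f g = L"
  unfolding hardy_inner_def
  using tendsto_Lim[OF trivial_limit_at_left_real assms]
  by (simp add: circ_mean_def scaleR_conv_of_real)

lemma hardy_pairing_self_tendsto:
  assumes f: "f \<in> hardy_space 2" and K: "0 \<le> K" "hardy_norm 2 f = ennreal K"
  shows "((\<lambda>r. circ_mean r (\<lambda>u. f u * cnj (f u))) \<longlongrightarrow> of_real (K\<^sup>2)) (at_left 1)"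
proof -
  have "(\<lambda>n. complex_of_real ((norm (taylor_coeff f n))\<^sup>2)) sums of_real (K\<^sup>2)"
    unfolding sums_of_real_iff using hardy_norm_2_eq[OF f K] hardy_space_2_summable[OF f] by (simp add: sums_iff)
  then have "(\<Sum>n. taylor_coeff f n * cnj (taylor_coeff f n)) = of_real (K\<^sup>2)"
    by (simp only: complex_norm_square sums_iff)
  then show ?thesis using hardy_pairing_tendsto[OF f f] by simp
qed

text \<open>The weighted inequality of arithmetic and geometric means, integrated. The ratio of the
  two bounds is the optimal weight \<open>\<tau>\<close>, and \<open>e\<close> keeps this ratio
  positive and finite.\<close>

lemma circ_mean_Cauchy_Schwarz:
  assumes r: "0 \<le> r" and f: "continuous_on (sphere 0 r) f" and g: "continuous_on (sphere 0 r) g"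
    and A: "0 \<le> A" "circ_mean r (\<lambda>u. (norm (f u))\<^sup>2) \<le> A\<^sup>2" and B: "0 \<le> B" "circ_mean r (\<lambda>u. (norm (g u))\<^sup>2) \<le> B\<^sup>2"
  shows "norm (circ_mean r (\<lambda>u. f u * cnj (g u))) \<le> A * B"
proof -
  have cf: "continuous_on (sphere 0 r) (\<lambda>u. (norm (f u))\<^sup>2)" and cg: "continuous_on (sphere 0 r) (\<lambda>u. (norm (g u))\<^sup>2)"
    using f g by (auto intro: continuous_intros)
  have *: "norm (circ_mean r (\<lambda>u. f u * cnj (g u))) \<le> (A + e) * (B + e)" if e: "0 < e" for e
  proof -
    define \<tau> where "\<tau> = (B + e) / (A + e)"
    have \<tau>: "0 < \<tau>" using A B e by (simp add: \<tau>_def)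
    have "norm (circ_mean r (\<lambda>u. f u * cnj (g u))) \<le> circ_mean r (\<lambda>u. norm (f u * cnj (g u)))"
      by (intro norm_circ_mean_le r continuous_on_mult f continuous_on_cnj g)
    also have "\<dots> \<le> circ_mean r (\<lambda>u. \<tau> / 2 * (norm (f u))\<^sup>2 + 1 / (2 * \<tau>) * (norm (g u))\<^sup>2)"
    proof (rule circ_mean_mono[OF r])
      fix u
      have "0 \<le> (\<tau> * norm (f u) - norm (g u))\<^sup>2 / (2 * \<tau>)" using \<tau> by simp
      also have "\<dots> = \<tau> / 2 * (norm (f u))\<^sup>2 + 1 / (2 * \<tau>) * (norm (g u))\<^sup>2 - norm (f u) * norm (g u)"
        using \<tau> by (simp add: power2_eq_square field_simps)
      finally show "norm (f u * cnj (g u)) \<le> \<tau> / 2 * (norm (f u))\<^sup>2 + 1 / (2 * \<tau>) * (norm (g u))\<^sup>2"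
        by (simp add: norm_mult)
    next
      show "continuous_on (sphere 0 r) (\<lambda>u. norm (f u * cnj (g u)))"
        by (intro continuous_on_norm continuous_on_mult f continuous_on_cnj g)
      show "continuous_on (sphere 0 r) (\<lambda>u. \<tau> / 2 * (norm (f u))\<^sup>2 + 1 / (2 * \<tau>) * (norm (g u))\<^sup>2)"
        by (intro continuous_on_add continuous_on_mult_left cf cg)
    qed
    also have "\<dots> = \<tau> / 2 * circ_mean r (\<lambda>u. (norm (f u))\<^sup>2) + 1 / (2 * \<tau>) * circ_mean r (\<lambda>u. (norm (g u))\<^sup>2)"
      by (simp only: circ_mean_add circ_mean_mult_left r cf cg continuous_on_mult_left)
    also have "\<dots> \<le> \<tau> / 2 * (A + e)\<^sup>2 + 1 / (2 * \<tau>) * (B + e)\<^sup>2"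
    proof -
      have "A\<^sup>2 \<le> (A + e)\<^sup>2" "B\<^sup>2 \<le> (B + e)\<^sup>2" using A B e by (auto intro!: power_mono)
      then show ?thesis using A B \<tau> by (intro add_mono mult_left_mono) auto
    qed
    also have "\<dots> = (A + e) * (B + e)"
    proof -
      have "\<tau> * (A + e) = B + e" using A e by (simp add: \<tau>_def)
      then have "(B + e)\<^sup>2 = \<tau> * (A + e) * (B + e)" "\<tau> * (A + e)\<^sup>2 = (B + e) * (A + e)"
        by (simp_all add: power2_eq_square)
      then show ?thesis using \<tau> by (simp add: field_simps)
    qed
    finally show ?thesis .
  qed
  have "((\<lambda>e. (A + e) * (B + e)) \<longlongrightarrow> (A + 0) * (B + 0)) (at_right 0)"
    by (intro tendsto_intros)
  then have "norm (circ_mean r (\<lambda>u. f u * cnj (g u))) \<le> (A + 0) * (B + 0)"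
    by (rule tendsto_lowerbound) (use * in \<open>auto intro!: eventually_at_rightI[of 0 1]\<close>)
  then show ?thesis by simp
qed

lemma hardy_pairing_le:
  assumes f: "f holomorphic_on unit_disc" and g: "g holomorphic_on unit_disc"
    and A: "0 \<le> A" "hardy_norm 2 f \<le> ennreal A" and B: "0 \<le> B" "hardy_norm 2 g \<le> ennreal B"
    and r: "0 < r" "r < 1"
  shows "norm (circ_mean r (\<lambda>u. f u * cnj (g u))) \<le> A * B"
  using r A B hardy_norm_2_le_iff_circ_mean[OF A(1) f] hardy_norm_2_le_iff_circ_mean[OF B(1) g]
  by (intro circ_mean_Cauchy_Schwarz holomorphic_on_disc_subsets(2)[OF f] holomorphic_on_disc_subsets(2)[OF g]) auto

lemma hardy_pairing_limit_le:
  assumes f: "f holomorphic_on unit_disc" and g: "g holomorphic_on unit_disc"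
    and A: "0 \<le> A" "hardy_norm 2 f \<le> ennreal A" and B: "0 \<le> B" "hardy_norm 2 g \<le> ennreal B"
    and L: "((\<lambda>r. circ_mean r (\<lambda>u. f u * cnj (g u))) \<longlongrightarrow> L) (at_left 1)"
  shows "norm L \<le> A * B"
proof (rule tendsto_upperbound[OF tendsto_norm[OF L]])
  show "\<forall>\<^sub>F r in at_left 1. norm (circ_mean r (\<lambda>u. f u * cnj (g u))) \<le> A * B"
    using eventually_at_left_real[OF zero_less_one]
    by eventually_elim (use hardy_pairing_le[OF f g A B] in auto)
qed simp

section \<open>The kernels as elements of the Hilbert space\<close>

lemma hardy_norm_szego_kernel:
  assumes w: "norm w < 1"
  shows "hardy_norm 2 (szego_kernel w) = ennreal (1 / sqrt (1 - (norm w)\<^sup>2))"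
proof (rule antisym)
  note hol = szego_kernel_holomorphic[OF w]
  have pos: "0 < 1 - (norm w)\<^sup>2" using w by (simp add: abs_square_less_1)
  let ?K = "1 / sqrt (1 - (norm w)\<^sup>2)"
  have K: "0 \<le> ?K" "?K\<^sup>2 = 1 / (1 - (norm w)\<^sup>2)" using pos by (auto simp: power_divide)
  have "1 / (1 - r\<^sup>2 * (norm w)\<^sup>2) \<le> 1 / (1 - (norm w)\<^sup>2)" if "0 < r" "r < 1" for r
  proof -
    have "r\<^sup>2 * (norm w)\<^sup>2 \<le> 1 * (norm w)\<^sup>2"
      using that by (intro mult_right_mono) (auto simp: abs_square_le_1)
    then show ?thesis using pos by (intro divide_left_mono) (auto intro!: mult_pos_pos)
  qed
  then show "hardy_norm 2 (szego_kernel w) \<le> ennreal ?K"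
    unfolding hardy_norm_2_le_iff_circ_mean[OF K(1) hol] K(2)
    by (auto simp: circ_mean_szego_kernel_square w)
  then have H2: "szego_kernel w \<in> hardy_space 2" by (rule hardy_space_2I[OF hol])
  obtain k where k: "0 \<le> k" "hardy_norm 2 (szego_kernel w) = ennreal k" using hardy_space_2_norm[OF H2] .
  have "eventually (\<lambda>r. 1 / (1 - r\<^sup>2 * (norm w)\<^sup>2) \<le> k\<^sup>2) (at_left 1)"
    using eventually_at_left_real[OF zero_less_one]
  proof eventually_elim
    case (elim r)
    then have r: "0 < r" "r < 1" by auto
    have "\<forall>r\<in>{0<..<1}. circ_mean r (\<lambda>u. (norm (szego_kernel w u))\<^sup>2) \<le> k\<^sup>2"
      using hardy_norm_2_le_iff_circ_mean[OF k(1) hol] k(2) by simp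
    from bspec[OF this, of r] show ?case
      using r circ_mean_szego_kernel_square[OF r w] by simp
  qed
  moreover have "((\<lambda>r. 1 / (1 - r\<^sup>2 * (norm w)\<^sup>2)) \<longlongrightarrow> 1 / (1 - 1\<^sup>2 * (norm w)\<^sup>2)) (at_left 1)"
    using pos by (intro tendsto_intros) auto
  ultimately have "1 / (1 - 1\<^sup>2 * (norm w)\<^sup>2) \<le> k\<^sup>2"
    by (intro tendsto_upperbound[where F = "at_left 1"]) auto
  then have "?K\<^sup>2 \<le> k\<^sup>2" using K by simp
  then have "?K \<le> k" using k(1) by (rule power2_le_imp_le)
  then show "ennreal ?K \<le> hardy_norm 2 (szego_kernel w)" using k by (simp add: ennreal_leI)
qed

lemma szego_kernel_hardy_space: "norm w < 1 \<Longrightarrow> szego_kernel w \<in> hardy_space 2"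
  by (simp add: hardy_space_def hardy_norm_szego_kernel szego_kernel_holomorphic)

lemma normalized_kernel_eq: "normalized_kernel w = (\<lambda>u. of_real (sqrt (1 - (norm w)\<^sup>2)) * szego_kernel w u)"
  by (rule ext) (simp add: normalized_kernel_def szego_kernel_def)

lemma normalized_kernel_holomorphic: "norm w < 1 \<Longrightarrow> normalized_kernel w holomorphic_on unit_disc"
  unfolding normalized_kernel_eq by (intro holomorphic_intros szego_kernel_holomorphic)

lemma normalized_kernel_hardy_space:
  assumes "norm w < 1"
  shows "normalized_kernel w \<in> hardy_space 2"
proof -
  have "hardy_norm 2 (normalized_kernel w) \<le>
      ennreal (norm (complex_of_real (sqrt (1 - (norm w)\<^sup>2))) * (1 / sqrt (1 - (norm w)\<^sup>2)))"
    unfolding normalized_kernel_eq using assms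
    by (intro hardy_norm_cmult_le szego_kernel_holomorphic)
      (auto simp: hardy_norm_szego_kernel abs_square_le_1)
  then show ?thesis by (rule hardy_space_2I[OF normalized_kernel_holomorphic[OF assms]])
qed

lemma hardy_space_2_add:
  assumes "f \<in> hardy_space 2" "g \<in> hardy_space 2"
  shows "(\<lambda>u. f u + g u) \<in> hardy_space 2"
proof -
  obtain A where A: "0 \<le> A" "hardy_norm 2 f = ennreal A" using hardy_space_2_norm[OF assms(1)] .
  obtain B where B: "0 \<le> B" "hardy_norm 2 g = ennreal B" using hardy_space_2_norm[OF assms(2)] .
  have "hardy_norm 2 (\<lambda>u. f u + g u) \<le> ennreal (A + B)"
    using A B assms by (intro hardy_norm_add_le hardy_space_2_holomorphic) auto
  then show ?thesis
    by (rule hardy_space_2I[rotated]) (intro holomorphic_intros hardy_space_2_holomorphic assms)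
qed

lemma hardy_space_2_cmult:
  assumes "f \<in> hardy_space 2"
  shows "(\<lambda>u. c * f u) \<in> hardy_space 2"
proof -
  obtain A where A: "0 \<le> A" "hardy_norm 2 f = ennreal A" using hardy_space_2_norm[OF assms] .
  have "hardy_norm 2 (\<lambda>u. c * f u) \<le> ennreal (norm c * A)"
    using A assms by (intro hardy_norm_cmult_le hardy_space_2_holomorphic) auto
  then show ?thesis
    by (rule hardy_space_2I[rotated]) (intro holomorphic_intros hardy_space_2_holomorphic assms)
qed

lemma hardy_space_2_zero: "(\<lambda>u. 0) \<in> hardy_space 2"
  using hardy_space_2_cmult[OF szego_kernel_hardy_space[of 0], of 0] by simp

lemma hardy_space_2_sum:
  assumes "\<And>i. i \<in> I \<Longrightarrow> f i \<in> hardy_space 2"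
  shows "(\<lambda>u. \<Sum>i\<in>I. f i u) \<in> hardy_space 2"
  using assms by (induction I rule: infinite_finite_induct) (auto intro: hardy_space_2_zero hardy_space_2_add)

text \<open>For \<open>r < 1\<close> the pairing is exactly the normalised value of \<open>f\<close>
  at \<open>r^2 w\<close>, so continuity of \<open>f\<close> at \<open>w\<close> gives the
  limit.\<close>

lemma hardy_pairing_kernel_tendsto:
  assumes f: "f holomorphic_on unit_disc" and w: "norm w < 1"
  shows "((\<lambda>r. circ_mean r (\<lambda>u. f u * cnj (normalized_kernel w u))) \<longlongrightarrow> of_real (sqrt (1 - (norm w)\<^sup>2)) * f w) (at_left 1)"
proof -
  let ?s = "complex_of_real (sqrt (1 - (norm w)\<^sup>2))"
  have "((\<lambda>r. ?s * f (of_real (r\<^sup>2) * w)) \<longlongrightarrow> ?s * f w) (at_left 1)"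
    using w by (intro tendsto_mult tendsto_const tendsto_dilation f) auto
  moreover have "eventually (\<lambda>r. ?s * f (of_real (r\<^sup>2) * w) = circ_mean r (\<lambda>u. f u * cnj (normalized_kernel w u))) (at_left 1)"
    using eventually_at_left_real[OF zero_less_one]
  proof eventually_elim
    case (elim r)
    then have r: "0 < r" "r < 1" by auto
    have rw: "norm w * r < 1" using mult_strict_mono[of "norm w" 1 r 1] r w by simp
    have "circ_mean r (\<lambda>u. f u * cnj (normalized_kernel w u)) = circ_mean r (\<lambda>u. ?s * (f u * cnj (szego_kernel w u)))"
      by (simp add: normalized_kernel_eq mult_ac)
    also have "\<dots> = ?s * circ_mean r (\<lambda>u. f u * cnj (szego_kernel w u))"
      using r by (intro circ_mean_mult_left continuous_on_mult continuous_on_cnj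
          holomorphic_on_disc_subsets(2)[OF f] holomorphic_on_disc_subsets(2)[OF szego_kernel_holomorphic[OF w]]) auto
    finally show ?case using circ_mean_reproducing[OF f r rw] by simp
  qed
  ultimately show ?thesis by (simp add: filterlim_cong[OF refl refl])
qed

lemma hardy_pairing_kernel_sum_tendsto:
  assumes f: "f holomorphic_on unit_disc" and S: "finite S" and z: "\<And>k. k \<in> S \<Longrightarrow> norm (z k) < 1"
  shows "((\<lambda>r. circ_mean r (\<lambda>u. f u * cnj (\<Sum>k\<in>S. a k * normalized_kernel (z k) u))) \<longlongrightarrow>
    (\<Sum>k\<in>S. cnj (a k) * (of_real (sqrt (1 - (norm (z k))\<^sup>2)) * f (z k)))) (at_left 1)"
proof -
  have "((\<lambda>r. \<Sum>k\<in>S. cnj (a k) * circ_mean r (\<lambda>u. f u * cnj (normalized_kernel (z k) u))) \<longlongrightarrow>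
      (\<Sum>k\<in>S. cnj (a k) * (of_real (sqrt (1 - (norm (z k))\<^sup>2)) * f (z k)))) (at_left 1)"
    by (intro tendsto_sum tendsto_mult tendsto_const hardy_pairing_kernel_tendsto f z)
  moreover have "eventually (\<lambda>r. (\<Sum>k\<in>S. cnj (a k) * circ_mean r (\<lambda>u. f u * cnj (normalized_kernel (z k) u))) =
      circ_mean r (\<lambda>u. f u * cnj (\<Sum>k\<in>S. a k * normalized_kernel (z k) u))) (at_left 1)"
    using eventually_at_left_real[OF zero_less_one]
  proof eventually_elim
    case (elim r)
    then have r: "0 \<le> r" "r < 1" by auto
    have c: "continuous_on (sphere 0 r) (\<lambda>u. f u * cnj (normalized_kernel (z k) u))" if "k \<in> S" for k
      by (intro continuous_on_mult continuous_on_cnj holomorphic_on_disc_subsets(2)[OF f]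
          holomorphic_on_disc_subsets(2)[OF normalized_kernel_holomorphic[OF z[OF that]]] r)
    have "circ_mean r (\<lambda>u. f u * cnj (\<Sum>k\<in>S. a k * normalized_kernel (z k) u)) =
        circ_mean r (\<lambda>u. \<Sum>k\<in>S. cnj (a k) * (f u * cnj (normalized_kernel (z k) u)))"
      by (simp add: sum_distrib_left mult_ac)
    also have "\<dots> = (\<Sum>k\<in>S. circ_mean r (\<lambda>u. cnj (a k) * (f u * cnj (normalized_kernel (z k) u))))"
      by (intro circ_mean_sum r S continuous_on_mult_left c)
    also have "\<dots> = (\<Sum>k\<in>S. cnj (a k) * circ_mean r (\<lambda>u. f u * cnj (normalized_kernel (z k) u)))"
      by (intro sum.cong refl circ_mean_mult_left r c)
    finally show ?case ..
  qed
  ultimately show ?thesis by (simp add: filterlim_cong[OF refl refl])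
qed

lemma kernel_sum_hardy_space:
  assumes "\<And>k. k \<in> S \<Longrightarrow> norm (z k) < 1"
  shows "(\<lambda>u. \<Sum>k\<in>S. a k * normalized_kernel (z k) u) \<in> hardy_space 2"
  by (intro hardy_space_2_sum hardy_space_2_cmult normalized_kernel_hardy_space assms)

section \<open>Gram matrices and Carleson constants\<close>

lemma ennreal_divide_le_iff:
  assumes "0 < k" "0 \<le> c"
  shows "x / ennreal k \<le> ennreal c \<longleftrightarrow> x \<le> ennreal (c * k)"
  using assms by (cases x) (auto simp: divide_ennreal ennreal_top_divide field_simps top_unique)

lemma ennreal_power2_le_iff:
  assumes "0 \<le> X"
  shows "x\<^sup>2 \<le> ennreal (X\<^sup>2) \<longleftrightarrow> x \<le> ennreal X"
proof (cases x)
  case (real r)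
  then show ?thesis using assms by (simp add: ennreal_power power_mono_iff)
qed (simp add: power2_eq_square ennreal_top_mult top_unique)

lemma one_le_ennrealI:
  fixes x :: ennreal
  assumes "\<And>c. 0 \<le> c \<Longrightarrow> x \<le> ennreal c \<Longrightarrow> 1 \<le> c"
  shows "1 \<le> x"
proof (cases x)
  case (real r)
  then have "1 \<le> r" using assms[of r] by simp
  then show ?thesis using real by simp
qed simp

lemma tendsto_one_ennrealI:
  fixes X :: "nat \<Rightarrow> ennreal"
  assumes "\<And>N. 1 \<le> X N" "\<And>N. X N \<le> ennreal (M N)" "M \<longlonglongrightarrow> 1"
  shows "X \<longlonglongrightarrow> 1"
proof (rule tendsto_sandwich[where f = "\<lambda>_. 1" and h = "\<lambda>N. ennreal (M N)"])
  show "(\<lambda>N. ennreal (M N)) \<longlonglongrightarrow> 1"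
    using tendsto_ennrealI[OF assms(3)] by simp
qed (use assms in auto)

lemma tendsto_one_ennrealD:
  fixes X :: "nat \<Rightarrow> ennreal"
  assumes "X \<longlonglongrightarrow> 1" "0 < \<epsilon>"
  obtains N where "X N \<le> ennreal (1 + \<epsilon>)"
proof -
  have "1 < ennreal (1 + \<epsilon>)"
    using assms(2) by (simp flip: ennreal_1 add: ennreal_less_iff)
  then have "eventually (\<lambda>N. X N < ennreal (1 + \<epsilon>)) sequentially"
    using assms(1) by (rule order_tendstoD(2)[rotated])
  from eventually_happens'[OF sequentially_bot this] show ?thesis
    using that less_imp_le by blast
qed

text \<open>Small constants are available for each \<open>\<epsilon>\<close> separately, but one
  sequence is wanted. \<open>M N\<close> is taken within \<open>1 / (N + 1)\<close> of the infimum
  of the admissible constants, and this infimum tends to 1.\<close>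

lemma convergent_selection:
  fixes P :: "nat \<Rightarrow> real \<Rightarrow> bool"
  assumes ex: "\<And>N. \<exists>M. 1 \<le> M \<and> P N M"
    and small: "\<And>\<epsilon>. 0 < \<epsilon> \<Longrightarrow> \<exists>N0. \<forall>N\<ge>N0. \<exists>M. 1 \<le> M \<and> M \<le> 1 + \<epsilon> \<and> P N M"
  obtains M where "\<And>N. 1 \<le> M N" "\<And>N. P N (M N)" "M \<longlonglongrightarrow> 1"
proof -
  define X where "X = (\<lambda>N. {M. 1 \<le> M \<and> P N M})"
  have ne: "X N \<noteq> {}" for N using ex[of N] by (auto simp: X_def)
  have "\<exists>M. M \<in> X N \<and> M < Inf (X N) + 1 / (real N + 1)" for N
    using cInf_lessD[OF ne[of N], of "Inf (X N) + 1 / (real N + 1)"] by auto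
  then obtain M where M: "\<And>N. M N \<in> X N" "\<And>N. M N < Inf (X N) + 1 / (real N + 1)" by metis
  have bdd: "bdd_below (X N)" for N by (auto simp: X_def intro: bdd_belowI)
  have ge: "1 \<le> M N" for N using M(1)[of N] by (simp add: X_def)
  have "M \<longlonglongrightarrow> 1"
  proof (rule order_tendstoI)
    fix a :: real assume "a < 1"
    then show "\<forall>\<^sub>F N in sequentially. a < M N" by (intro always_eventually allI less_le_trans[OF _ ge])
  next
    fix a :: real assume a: "1 < a"
    define \<epsilon> where "\<epsilon> = (a - 1) / 2"
    have \<epsilon>: "0 < \<epsilon>" using a by (simp add: \<epsilon>_def)
    obtain N0 where N0: "\<And>N. N \<ge> N0 \<Longrightarrow> \<exists>M. 1 \<le> M \<and> M \<le> 1 + \<epsilon> \<and> P N M" using small[OF \<epsilon>] by blast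
    have "(\<lambda>N. 1 / (real N + 1)) \<longlonglongrightarrow> 0" by real_asymp
    then have "eventually (\<lambda>N. 1 / (real N + 1) < \<epsilon>) sequentially" using \<epsilon> by (rule order_tendstoD(2))
    then show "\<forall>\<^sub>F N in sequentially. M N < a"
      using eventually_ge_at_top[of N0]
    proof eventually_elim
      case (elim N)
      obtain m where m: "m \<in> X N" "m \<le> 1 + \<epsilon>" using N0[OF elim(2)] by (auto simp: X_def)
      have "Inf (X N) \<le> m" by (rule cInf_lower[OF m(1) bdd])
      moreover have "a = 1 + 2 * \<epsilon>" by (simp add: \<epsilon>_def field_simps)
      ultimately show ?case using M(2)[of N] elim(1) m(2) by linarith
    qed
  qed
  then show ?thesis using that ge M(1) by (auto simp: X_def)
qed

text \<open>\<open>telescoping_bound n d\<close> is at most 1. The first inequality lets the same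
  constant absorb the factor \<open>1 / separation z k\<close> in the weights of the second
  measure.\<close>

lemma interpolation_constant_ge:
  assumes "0 < n" "0 < d" "d \<le> 1"
  shows "1 / d \<le> interpolation_constant n d" "1 \<le> interpolation_constant n d"
proof -
  have m: "0 < telescoping_bound n d" by (rule telescoping_bound_pos[OF assms(1,2)])
  have "telescoping_bound n d \<le> 1 * 1"
    unfolding telescoping_bound_def using assms by (intro mult_mono power_le_one) auto
  then have "(telescoping_bound n d)\<^sup>2 \<le> 1" using m by (simp add: abs_square_le_1)
  then have "(telescoping_bound n d)\<^sup>2 * d \<le> 1 * d" using assms by (intro mult_right_mono) auto
  then show le: "1 / d \<le> interpolation_constant n d"
    unfolding interpolation_constant_def using m assms by (intro divide_left_mono) auto
  have "1 \<le> 1 / d" using assms by simp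
  then show "1 \<le> interpolation_constant n d" using le by linarith
qed

text \<open>The parameters stay hidden behind one real number \<open>M\<close>. It serves at once as
  Carleson constant, as interpolation constant and, because \<open>1 / d \<le> M\<close>, as a bound
  for the reciprocals of the separations.\<close>

definition tail_constant :: "(nat \<Rightarrow> complex) \<Rightarrow> nat \<Rightarrow> real \<Rightarrow> bool" where
  "tail_constant z N M \<longleftrightarrow>
     (\<exists>n d. 0 < n \<and> 0 < d \<and> d \<le> 1 \<and> (\<forall>j\<ge>N. d \<le> separation z j) \<and> M = interpolation_constant n d)"

lemma thin_tail_constants:
  assumes z: "blaschke_sequence z" and inj: "inj z" and thin: "thin z"
  obtains M where "\<And>N. 1 \<le> M N" "\<And>N. tail_constant z N (M N)" "M \<longlonglongrightarrow> 1"
proof (rule convergent_selection[of "tail_constant z"])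
  fix N
  \<comment> \<open>No smallness is asked for here, only some constant for every \<open>N\<close>;
    hence \<open>n = 1\<close> and the uniform separation will do.\<close>
  obtain d where "0 < d" "d \<le> 1" "\<And>j. d \<le> separation z j"
    by (rule thin_uniform_separation[OF z inj thin]) (rule that; assumption)
  then show "\<exists>M. 1 \<le> M \<and> tail_constant z N M"
    unfolding tail_constant_def
    by (intro exI[of _ "interpolation_constant 1 d"] conjI exI[of _ 1] exI[of _ d] interpolation_constant_ge(2)) auto
next
  fix \<epsilon> :: real assume "0 < \<epsilon>"
  then obtain n d where nd: "0 < n" "0 < d" "d < 1" "interpolation_constant n d < 1 + \<epsilon>"
    using interpolation_constant_tends_to_1 by blast
  obtain N0 where N0: "\<And>j. j \<ge> N0 \<Longrightarrow> d \<le> separation z j" by (rule thin_tail_separation[OF thin nd(3)]) (rule that; assumption)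
  have "\<exists>M. 1 \<le> M \<and> M \<le> 1 + \<epsilon> \<and> tail_constant z N M" if "N \<ge> N0" for N
    unfolding tail_constant_def using nd N0 that
    by (intro exI[of _ "interpolation_constant n d"] conjI exI[of _ n] exI[of _ d] interpolation_constant_ge(2)) auto
  then show "\<exists>N0. \<forall>N\<ge>N0. \<exists>M. 1 \<le> M \<and> M \<le> 1 + \<epsilon> \<and> tail_constant z N M" by blast
qed (rule that)

section \<open>Riesz bounds for the normalised kernels\<close>

lemma carleson_sum_le:
  assumes z: "blaschke_sequence z" and inj: "inj z" and M: "tail_constant z N M"
    and S: "finite S" "S \<subseteq> {N..}" and f: "f holomorphic_on unit_disc" and K: "0 \<le> K" "hardy_norm 2 f \<le> ennreal K"
  shows "(\<Sum>k\<in>S. (1 - (norm (z k))\<^sup>2) * (norm (f (z k)))\<^sup>2) \<le> M * K\<^sup>2"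
proof -
  obtain n d where nd: "0 < n" "0 < d" "d \<le> 1" "\<And>j. j \<ge> N \<Longrightarrow> d \<le> separation z j" "M = interpolation_constant n d"
    using M unfolding tail_constant_def by blast
  have "separated_by d (z ` S)" using nd(4) S by (intro separated_by_image z inj) auto
  then have "(\<Sum>a\<in>z ` S. (1 - (norm a)\<^sup>2) * (norm (f a))\<^sup>2) \<le> M * K\<^sup>2"
    unfolding nd(5) using S nd by (intro carleson_embedding_finite f K) auto
  then show ?thesis using inj by (subst (asm) sum.reindex) (auto intro: inj_on_subset)
qed

text \<open>Pairing \<open>F\<close> with itself expresses \<open>K^2\<close> through the values of
  \<open>F\<close> at the nodes. Cauchy-Schwarz and the Carleson estimate, applied to
  \<open>F\<close> itself, give \<open>K^2 \<le> sqrt s * sqrt M * K\<close>, with \<open>s\<close>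
  the sum of the squares of the coefficients.\<close>

lemma gram_upper_bound:
  fixes a :: "nat \<Rightarrow> complex"
  assumes z: "blaschke_sequence z" and inj: "inj z" and M: "tail_constant z N M" "1 \<le> M"
    and S: "finite S" "S \<subseteq> {N..}"
  shows "(hardy_norm 2 (\<lambda>w. \<Sum>k\<in>S. a k * normalized_kernel (z k) w))\<^sup>2 \<le> ennreal (M * (\<Sum>k\<in>S. (norm (a k))\<^sup>2))"
proof -
  let ?F = "\<lambda>w. \<Sum>k\<in>S. a k * normalized_kernel (z k) w" and ?s = "\<Sum>k\<in>S. (norm (a k))\<^sup>2"
  let ?b = "\<lambda>k. of_real (sqrt (1 - (norm (z k))\<^sup>2)) * ?F (z k)"
  have F: "?F \<in> hardy_space 2" by (intro kernel_sum_hardy_space blaschke_sequence_norm_less_1 z)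
  note hol = hardy_space_2_holomorphic[OF F]
  obtain K where K: "0 \<le> K" "hardy_norm 2 ?F = ennreal K" using hardy_space_2_norm[OF F] .
  have "complex_of_real (K\<^sup>2) = (\<Sum>k\<in>S. cnj (a k) * ?b k)"
    by (rule tendsto_unique[OF _ hardy_pairing_self_tendsto[OF F K]
        hardy_pairing_kernel_sum_tendsto[OF hol S(1) blaschke_sequence_norm_less_1[OF z]]]) simp
  then have "K\<^sup>2 = norm (\<Sum>k\<in>S. cnj (a k) * ?b k)"
    by (metis abs_of_nonneg norm_of_real zero_le_power2)
  also have "\<dots> \<le> (\<Sum>k\<in>S. norm (cnj (a k) * ?b k))" by (rule norm_sum)
  also have "\<dots> = (\<Sum>k\<in>S. \<bar>norm (a k)\<bar> * \<bar>norm (?b k)\<bar>)"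
    by (intro sum.cong refl) (simp add: norm_mult)
  also have "\<dots> \<le> L2_set (\<lambda>k. norm (a k)) S * L2_set (\<lambda>k. norm (?b k)) S"
    by (rule L2_set_mult_ineq)
  finally have "(K\<^sup>2)\<^sup>2 \<le> (L2_set (\<lambda>k. norm (a k)) S * L2_set (\<lambda>k. norm (?b k)) S)\<^sup>2"
    by (intro power_mono) auto
  also have "\<dots> = ?s * (\<Sum>k\<in>S. (norm (?b k))\<^sup>2)"
    unfolding L2_set_def power_mult_distrib by (simp add: sum_nonneg)
  also have "(\<Sum>k\<in>S. (norm (?b k))\<^sup>2) = (\<Sum>k\<in>S. (1 - (norm (z k))\<^sup>2) * (norm (?F (z k)))\<^sup>2)"
    using blaschke_sequence_weight_pos[OF z]
    by (intro sum.cong refl) (simp add: norm_mult power_mult_distrib less_imp_le)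
  also have "?s * \<dots> \<le> ?s * (M * K\<^sup>2)"
    using K by (intro mult_left_mono carleson_sum_le[OF z inj M(1) S hol]) (auto intro: sum_nonneg)
  finally have "K\<^sup>2 * K\<^sup>2 \<le> (M * ?s) * K\<^sup>2" by (simp add: power2_eq_square mult_ac)
  then have "K\<^sup>2 \<le> M * ?s"
    using M mult_right_le_imp_le[of "K\<^sup>2" "K\<^sup>2" "M * ?s"]
    by (cases "K = 0") (auto intro!: mult_nonneg_nonneg sum_nonneg)
  then show ?thesis using K by (simp add: ennreal_power ennreal_leI)
qed

text \<open>Pairing \<open>F\<close> with an interpolant whose normalised values are the
  coefficients \<open>a k\<close> gives exactly \<open>s\<close>, the sum of their squares. The norm
  of the interpolant is at most \<open>M * sqrt s\<close>, so \<open>s \<le> M * sqrt s * K\<close>;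
  squaring explains the constant \<open>1 / M^2\<close>.\<close>

lemma gram_lower_bound:
  fixes a :: "nat \<Rightarrow> complex"
  assumes z: "blaschke_sequence z" and inj: "inj z" and M: "tail_constant z N M" "1 \<le> M"
    and S: "finite S" "S \<subseteq> {N..}"
  shows "ennreal (1 / M\<^sup>2 * (\<Sum>k\<in>S. (norm (a k))\<^sup>2)) \<le> (hardy_norm 2 (\<lambda>w. \<Sum>k\<in>S. a k * normalized_kernel (z k) w))\<^sup>2"
proof -
  let ?F = "\<lambda>w. \<Sum>k\<in>S. a k * normalized_kernel (z k) w" and ?s = "\<Sum>k\<in>S. (norm (a k))\<^sup>2"
  have F: "?F \<in> hardy_space 2" by (intro kernel_sum_hardy_space blaschke_sequence_norm_less_1 z)
  obtain K where K: "0 \<le> K" "hardy_norm 2 ?F = ennreal K" using hardy_space_2_norm[OF F] .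
  have s0: "0 \<le> ?s" by (rule sum_nonneg) auto
  obtain n d where nd: "0 < n" "0 < d" "d \<le> 1" "\<And>j. j \<ge> N \<Longrightarrow> d \<le> separation z j" "M = interpolation_constant n d"
    using M unfolding tail_constant_def by blast
  have A: "finite (z ` S)" "separated_by d (z ` S)"
    using nd(4) S by (auto intro!: separated_by_image z inj)
  have e: "enn2real (1 / 2) = 1 / 2" using enn2real_inverse_exponent[of 2] by simp
  have T: "if (2 :: ennreal) = \<infinity> then \<forall>b\<in>z ` S. norm (a (inv z b)) \<le> sqrt ?s
      else (\<Sum>b\<in>z ` S. norm (a (inv z b)) powr enn2real 2) \<le> sqrt ?s powr enn2real 2"
    using inj s0 by (simp add: sum.reindex inj_on_subset[OF inj] powr_numeral)
  obtain f where f: "f holomorphic_on unit_disc"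
    "\<And>b. b \<in> z ` S \<Longrightarrow> f b * of_real ((1 - (norm b)\<^sup>2) powr enn2real (1 / 2)) = a (inv z b)"
    "hardy_norm 2 f \<le> ennreal (interpolation_constant n d * sqrt ?s)"
    by (rule hardy_interpolation_finite[OF A nd(2,3,1) _ real_sqrt_ge_zero[OF s0] T]) auto
  have val: "of_real (sqrt (1 - (norm (z k))\<^sup>2)) * f (z k) = a k" if "k \<in> S" for k
    using f(2)[of "z k"] that inj blaschke_sequence_weight_pos[OF z, of k]
    by (simp add: e powr_half_sqrt mult.commute)
  have "(\<Sum>k\<in>S. cnj (a k) * (of_real (sqrt (1 - (norm (z k))\<^sup>2)) * f (z k))) = (\<Sum>k\<in>S. of_real ((norm (a k))\<^sup>2))"
    by (intro sum.cong refl) (simp only: val, simp only: complex_norm_square mult.commute)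
  also have "\<dots> = complex_of_real ?s" by simp
  finally have "((\<lambda>r. circ_mean r (\<lambda>u. f u * cnj (?F u))) \<longlongrightarrow> complex_of_real ?s) (at_left 1)"
    using hardy_pairing_kernel_sum_tendsto[where z = z and a = a, OF f(1) S(1) blaschke_sequence_norm_less_1[OF z]] by simp
  then have "norm (complex_of_real ?s) \<le> (M * sqrt ?s) * K"
    using f(3) K M s0 nd(5)
    by (intro hardy_pairing_limit_le[OF f(1) hardy_space_2_holomorphic[OF F]]) auto
  moreover have "norm (complex_of_real ?s) = sqrt ?s * sqrt ?s"
    using s0 by (simp only: norm_of_real) simp
  ultimately have "sqrt ?s * sqrt ?s \<le> (M * K) * sqrt ?s"
    by (simp only: mult_ac)
  then have "sqrt ?s \<le> M * K"
    using M K s0 mult_right_le_imp_le[of "sqrt ?s" "sqrt ?s" "M * K"] by (cases "?s = 0") simp_all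
  then have "(sqrt ?s)\<^sup>2 \<le> (M * K)\<^sup>2" using s0 by (intro power_mono) auto
  then have "1 / M\<^sup>2 * ?s \<le> K\<^sup>2" using s0 M by (simp add: power_mult_distrib field_simps)
  then show ?thesis using K by (simp add: ennreal_power ennreal_leI)
qed

theorem thin_imp_AOB:
  assumes z: "blaschke_sequence z" and inj: "inj z" and thin: "thin z"
  shows "AOB (\<lambda>n. normalized_kernel (z n))"
proof -
  obtain M where M: "\<And>N. 1 \<le> M N" "\<And>N. tail_constant z N (M N)" "M \<longlonglongrightarrow> 1"
    by (rule thin_tail_constants[OF z inj thin]) (rule that; assumption)
  show ?thesis
    unfolding AOB_def Let_def
  proof (rule exI[of _ "\<lambda>N. 1 / (M N)\<^sup>2"], rule exI[of _ M], intro conjI allI impI)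
    fix N
    have M0: "0 < M N" using M(1)[of N] by simp
    then show "0 < 1 / (M N)\<^sup>2" "0 < M N" by auto
    fix a :: "nat \<Rightarrow> complex" assume "finite {n. a n \<noteq> 0}"
    then have S: "finite {n. N \<le> n \<and> a n \<noteq> 0}" "{n. N \<le> n \<and> a n \<noteq> 0} \<subseteq> {N..}"
      by (auto intro: finite_subset[rotated])
    show "ennreal (1 / (M N)\<^sup>2 * (\<Sum>n | N \<le> n \<and> a n \<noteq> 0. (norm (a n))\<^sup>2)) \<le>
        (hardy_norm 2 (\<lambda>w. \<Sum>n | N \<le> n \<and> a n \<noteq> 0. a n * normalized_kernel (z n) w))\<^sup>2"
      by (rule gram_lower_bound[OF z inj M(2,1) S])
    show "(hardy_norm 2 (\<lambda>w. \<Sum>n | N \<le> n \<and> a n \<noteq> 0. a n * normalized_kernel (z n) w))\<^sup>2 \<le>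
        ennreal (M N * (\<Sum>n | N \<le> n \<and> a n \<noteq> 0. (norm (a n))\<^sup>2))"
      by (rule gram_upper_bound[OF z inj M(2,1) S])
  next
    have "(\<lambda>N. 1 / (M N)\<^sup>2) \<longlonglongrightarrow> 1 / 1\<^sup>2" using M(3) by (intro tendsto_intros) auto
    then show "(\<lambda>N. 1 / (M N)\<^sup>2) \<longlonglongrightarrow> 1" by simp
  qed (rule M(3))
qed

text \<open>The left-hand side is the squared modulus of a Gram matrix entry of the normalised
  kernels; this ties the Hilbert space conditions to the separation of the points.\<close>

lemma kernel_value_square:
  assumes "norm a < 1" "norm w < 1"
  shows "(1 - (norm a)\<^sup>2) * ((1 - (norm w)\<^sup>2) * (norm (szego_kernel a w))\<^sup>2) = 1 - (norm (blaschke_factor a w))\<^sup>2"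
  using one_minus_blaschke_factor_square[of a w] assms
  by (simp add: szego_kernel_def norm_divide power_divide)

lemma kernel_value_square_diag:
  assumes "norm a < 1"
  shows "(1 - (norm a)\<^sup>2) * ((1 - (norm a)\<^sup>2) * (norm (szego_kernel a a))\<^sup>2) = 1"
  using kernel_value_square[OF assms assms] assms blaschke_factor_eq_0_iff[of a a] by simp

text \<open>The sums are rows of squared Gram entries, and \<open>M > j\<close> ensures that the
  diagonal entry 1 is among them. The remaining entries then add up to at most
  \<open>\<epsilon>\<close>, and Weierstrass' inequality bounds the product below.\<close>

lemma thin_from_sums:
  assumes z: "blaschke_sequence z" and inj: "inj z"
    and sums: "\<And>\<epsilon>. 0 < \<epsilon> \<Longrightarrow> \<exists>N. \<forall>j\<ge>N. \<forall>M>j. (\<Sum>k\<in>{N..<M}. 1 - (norm (blaschke_factor (z j) (z k)))\<^sup>2) \<le> 1 + \<epsilon>"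
  shows "thin z"
proof (rule thinI[OF z inj])
  fix \<epsilon> :: real assume "0 < \<epsilon>"
  then obtain N where N: "\<And>j M. j \<ge> N \<Longrightarrow> M > j \<Longrightarrow> (\<Sum>k\<in>{N..<M}. 1 - (norm (blaschke_factor (z j) (z k)))\<^sup>2) \<le> 1 + \<epsilon>"
    using sums by blast
  have z1: "norm (z k) < 1" "norm (z k) \<le> 1" for k
    using blaschke_sequence_norm_less_1[OF z, of k] by simp_all
  have "1 - \<epsilon> \<le> (\<Prod>k\<in>{N..<M} - {j}. norm (blaschke_factor (z k) (z j)))" if j: "j \<ge> N" for j M
  proof -
    let ?x = "\<lambda>k. 1 - (norm (blaschke_factor (z k) (z j)))\<^sup>2"
    have x0: "0 \<le> ?x k" for k using norm_blaschke_factor_le_1[OF z1] by (simp add: abs_square_le_1)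
    define L where "L = max M (Suc j)"
    have "blaschke_factor (z j) (z j) = 0" using blaschke_factor_eq_0_iff[OF z1] by simp
    then have "1 + sum ?x ({N..<L} - {j}) = sum ?x {N..<L}"
      using j by (subst sum.remove[of _ j]) (auto simp: L_def)
    also have "\<dots> = (\<Sum>k\<in>{N..<L}. 1 - (norm (blaschke_factor (z j) (z k)))\<^sup>2)"
      by (intro sum.cong refl) (simp add: norm_blaschke_factor_commute[of "z j"])
    also have "\<dots> \<le> 1 + \<epsilon>" by (rule N[OF j]) (simp add: L_def)
    finally have "sum ?x ({N..<L} - {j}) \<le> \<epsilon>" by simp
    moreover have "sum ?x ({N..<M} - {j}) \<le> sum ?x ({N..<L} - {j})"
      using x0 by (intro sum_mono2) (auto simp: L_def)
    moreover have "1 - sum ?x ({N..<M} - {j}) \<le> (\<Prod>k\<in>{N..<M} - {j}. norm (blaschke_factor (z k) (z j)))"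
      using norm_blaschke_factor_le_1[OF z1] by (intro prod_ge_one_minus_sum_square) auto
    ultimately show ?thesis by linarith
  qed
  then show "\<exists>N. \<forall>j\<ge>N. \<forall>M. 1 - \<epsilon> \<le> (\<Prod>k\<in>{N..<M} - {j}. norm (blaschke_factor (z k) (z j)))" by blast
qed

text \<open>The upper Riesz bound is tested on the \<open>j\<close>-th row \<open>a\<close> of the Gram matrix: the combination with
  these coefficients takes the value \<open>\<Sum> |a\<^sub>k|\<^sup>2\<close> at \<open>z\<^sub>j\<close>, up to normalisation.\<close>

theorem AOB_imp_thin:
  assumes z: "blaschke_sequence z" and inj: "inj z" and AOB: "AOB (\<lambda>n. normalized_kernel (z n))"
  shows "thin z"
proof (rule thin_from_sums[OF z inj])
  fix \<epsilon> :: real assume \<epsilon>: "0 < \<epsilon>"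
  from AOB[unfolded AOB_def Let_def] obtain c C :: "nat \<Rightarrow> real" where H: "(\<forall>N. 0 < c N \<and> 0 < C N \<and>
      (\<forall>a :: nat \<Rightarrow> complex. finite {n. a n \<noteq> 0} \<longrightarrow>
        ennreal (c N * (\<Sum>n | N \<le> n \<and> a n \<noteq> 0. (norm (a n))\<^sup>2)) \<le>
          (hardy_norm 2 (\<lambda>w. \<Sum>n | N \<le> n \<and> a n \<noteq> 0. a n * normalized_kernel (z n) w))\<^sup>2 \<and>
        (hardy_norm 2 (\<lambda>w. \<Sum>n | N \<le> n \<and> a n \<noteq> 0. a n * normalized_kernel (z n) w))\<^sup>2 \<le>
          ennreal (C N * (\<Sum>n | N \<le> n \<and> a n \<noteq> 0. (norm (a n))\<^sup>2)))) \<and> c \<longlonglongrightarrow> 1 \<and> C \<longlonglongrightarrow> 1"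
    by (elim exE)
  have C: "\<And>N. 0 < C N" "C \<longlonglongrightarrow> 1"
    using H by auto
  have upper: "(hardy_norm 2 (\<lambda>w. \<Sum>n | N \<le> n \<and> a n \<noteq> 0. a n * normalized_kernel (z n) w))\<^sup>2 \<le>
      ennreal (C N * (\<Sum>n | N \<le> n \<and> a n \<noteq> 0. (norm (a n))\<^sup>2))" if "finite {n. a n \<noteq> 0}" for N a
    using H[THEN conjunct1, rule_format, of N, THEN conjunct2, THEN conjunct2, rule_format, OF that] by (rule conjunct2)
  have "eventually (\<lambda>N. C N < 1 + \<epsilon>) sequentially"
    using C(2) \<epsilon> by (intro order_tendstoD) auto
  then obtain N where N: "C N < 1 + \<epsilon>" using eventually_happens'[OF sequentially_bot] by blast
  have z1: "norm (z k) < 1" for k by (rule blaschke_sequence_norm_less_1[OF z])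
  have pos: "0 < 1 - (norm (z k))\<^sup>2" for k by (rule blaschke_sequence_weight_pos[OF z])
  have "(\<Sum>k\<in>{N..<M}. 1 - (norm (blaschke_factor (z j) (z k)))\<^sup>2) \<le> 1 + \<epsilon>" if j: "j \<ge> N" "M > j" for j M
  proof -
    let ?s = "\<lambda>k. complex_of_real (sqrt (1 - (norm (z k))\<^sup>2))"
    define S where "S = {N..<M}"
    define a where "a = (\<lambda>k. if k \<in> S then ?s k * (?s j * szego_kernel (z j) (z k)) else 0)"
    define F where "F = (\<lambda>w. \<Sum>k\<in>S. a k * normalized_kernel (z k) w)"
    have knz: "szego_kernel (z j) (z k) \<noteq> 0" for k
      using szego_denominator_nonzero[OF z1 less_imp_le[OF z1]] by (simp add: szego_kernel_def)
    have snz: "?s k \<noteq> 0" for k using pos[of k] by (simp del: of_real_diff)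
    \<comment> \<open>No entry of the row vanishes, so the index set over which \<open>AOB\<close>
      sums is exactly \<open>S\<close>.\<close>
    have supp: "{n. a n \<noteq> 0} = S"
      unfolding a_def using knz snz by auto
    then have supp': "{n. N \<le> n \<and> a n \<noteq> 0} = S" by (auto simp: S_def)
    have a2: "(norm (a k))\<^sup>2 = 1 - (norm (blaschke_factor (z j) (z k)))\<^sup>2" if "k \<in> S" for k
      using kernel_value_square[OF z1[of j] z1[of k]] that pos[of k] pos[of j]
      by (simp add: a_def norm_mult power_mult_distrib mult_ac less_imp_le del: of_real_diff)
    define T where "T = (\<Sum>k\<in>S. (norm (a k))\<^sup>2)"
    have "a j = 1"
    proof -
      have "?s j * ?s j = of_real (1 - (norm (z j))\<^sup>2)"
        using pos[of j] by (simp only: of_real_mult[symmetric]) simp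
      also have "\<dots> = 1 - cnj (z j) * z j"
        unfolding of_real_diff complex_norm_square by (simp add: mult.commute)
      finally have "?s j * (?s j * szego_kernel (z j) (z j)) = 1"
        using szego_denominator_nonzero[OF z1 less_imp_le[OF z1], of j j]
        by (simp add: szego_kernel_def flip: mult.assoc)
      then show ?thesis using j by (simp add: a_def S_def)
    qed
    then have T1: "1 \<le> T"
      unfolding T_def using j member_le_sum[of j S "\<lambda>k. (norm (a k))\<^sup>2"] by (auto simp: S_def)
    have F2: "F \<in> hardy_space 2" unfolding F_def by (intro kernel_sum_hardy_space z1)
    obtain K where K: "0 \<le> K" "hardy_norm 2 F = ennreal K" using hardy_space_2_norm[OF F2] .
    have "ennreal (K\<^sup>2) \<le> ennreal (C N * T)"
      using upper[of a N] K unfolding supp supp' F_def[symmetric] T_def[symmetric]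
      by (simp add: S_def ennreal_power)
    then have KT: "K\<^sup>2 \<le> C N * T"
      using C(1)[of N] T1 by (subst (asm) ennreal_le_iff) auto
    have "?s j * F (z j) = (\<Sum>k\<in>S. complex_of_real ((norm (a k))\<^sup>2))"
      unfolding F_def sum_distrib_left
    proof (intro sum.cong refl)
      fix k assume k: "k \<in> S"
      have "cnj (a k) = ?s k * (?s j * szego_kernel (z k) (z j))"
        using k by (simp add: a_def szego_kernel_def mult.commute)
      then have "?s j * (a k * normalized_kernel (z k) (z j)) = a k * cnj (a k)"
        by (simp add: normalized_kernel_eq mult_ac)
      then show "?s j * (a k * normalized_kernel (z k) (z j)) = complex_of_real ((norm (a k))\<^sup>2)"
        by (simp only: complex_norm_square)
    qed
    also have "\<dots> = of_real T" by (simp add: T_def)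
    finally have "norm (?s j * F (z j)) = T" using T1 by simp
    then have "T = norm (F (z j)) * sqrt (1 - (norm (z j))\<^sup>2)"
      using pos[of j] by (simp add: norm_mult mult.commute less_imp_le del: of_real_diff)
    also have "\<dots> \<le> K"
      using hardy_point_evaluation[of 2 F K "{}" "z j"] hardy_space_2_holomorphic[OF F2] K z1[of j] pos[of j]
        enn2real_inverse_exponent[of 2]
      by (simp add: powr_half_sqrt)
    \<comment> \<open>Point evaluation gives \<open>T \<le> K\<close> and the Riesz bound gives
      \<open>K^2 \<le> C N * T\<close>; dividing by \<open>T \<ge> 1\<close> leaves
      \<open>T \<le> C N\<close>.\<close>
    finally have "T\<^sup>2 \<le> K\<^sup>2" using T1 by (intro power_mono) auto
    with KT have "T * T \<le> C N * T" by (simp add: power2_eq_square)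
    then have "T \<le> C N" using T1 by simp
    then show ?thesis using N a2 by (simp add: T_def S_def)
  qed
  then show "\<exists>N. \<forall>j\<ge>N. \<forall>M>j. (\<Sum>k\<in>{N..<M}. 1 - (norm (blaschke_factor (z j) (z k)))\<^sup>2) \<le> 1 + \<epsilon>" by blast
qed

section \<open>Point masses and their embedding constants\<close>

lemma L2_norm_square: "(L2_norm \<mu> f)\<^sup>2 = (\<integral>\<^sup>+ w. ennreal ((norm (f w))\<^sup>2) \<partial>\<mu>)"
proof (cases "(\<integral>\<^sup>+ w. ennreal ((norm (f w))\<^sup>2) \<partial>\<mu>)")
  case (real r)
  then show ?thesis by (simp add: L2_norm_def ennreal_power)
qed (simp add: L2_norm_def ennreal_top_mult power2_eq_square)

lemma nn_integral_tail_point_masses: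
  assumes z: "\<And>k. z k \<in> unit_disc" and f: "continuous_on unit_disc f" and m: "\<And>k. 0 \<le> m k"
  shows "(\<integral>\<^sup>+ w. ennreal ((norm (f w))\<^sup>2) \<partial>tail_point_masses m z N) =
    (\<Sum>k. ennreal (m (k + N) * (norm (f (z (k + N))))\<^sup>2))"
proof -
  let ?P = "point_measure {N..} (\<lambda>k. ennreal (m k))"
  have meas: "z \<in> measurable ?P (restrict_space borel unit_disc)"
    using z by (auto simp: measurable_def point_measure_def space_restrict_space)
  have "(\<lambda>w. (norm (f w))\<^sup>2) \<in> borel_measurable (restrict_space borel unit_disc)"
    using f by (intro borel_measurable_continuous_on_restrict continuous_intros)
  then have fm: "(\<lambda>w. ennreal ((norm (f w))\<^sup>2)) \<in> borel_measurable (restrict_space borel unit_disc)"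
    by measurable
  have "(\<integral>\<^sup>+ w. ennreal ((norm (f w))\<^sup>2) \<partial>tail_point_masses m z N) = (\<integral>\<^sup>+ k. ennreal ((norm (f (z k)))\<^sup>2) \<partial>?P)"
    unfolding tail_point_masses_def using fm by (intro nn_integral_distr meas) simp
  also have "\<dots> = (\<integral>\<^sup>+ k. ennreal (m k) * ennreal ((norm (f (z k)))\<^sup>2) \<partial>count_space {N..})"
    unfolding point_measure_def by (subst nn_integral_density) auto
  also have "\<dots> = (\<integral>\<^sup>+ k. ennreal (m k * (norm (f (z k)))\<^sup>2) \<partial>count_space {N..})"
    using m by (simp add: ennreal_mult)
  also have "\<dots> = (\<integral>\<^sup>+ k. ennreal (m (k + N) * (norm (f (z (k + N))))\<^sup>2) \<partial>count_space UNIV)"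
    by (rule nn_integral_bij_count_space[symmetric])
       (rule bij_betwI[where g = "\<lambda>k. k - N"], auto)
  finally show ?thesis by (simp add: nn_integral_count_space_nat)
qed

lemma L2_norm_tail_le_iff:
  assumes z: "\<And>k. z k \<in> unit_disc" and f: "continuous_on unit_disc f" and m: "\<And>k. 0 \<le> m k" and Y: "0 \<le> Y"
  shows "(L2_norm (tail_point_masses m z N) f)\<^sup>2 \<le> ennreal Y \<longleftrightarrow>
    (\<forall>M. (\<Sum>k\<in>{N..<M}. m k * (norm (f (z k)))\<^sup>2) \<le> Y)"
proof -
  let ?x = "\<lambda>k. m k * (norm (f (z k)))\<^sup>2"
  have x0: "0 \<le> ?x k" for k using m by simp
  have "(L2_norm (tail_point_masses m z N) f)\<^sup>2 = (SUP n. \<Sum>k<n. ennreal (?x (k + N)))"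
    unfolding L2_norm_square nn_integral_tail_point_masses[OF z f m] by (rule suminf_eq_SUP)
  also have "\<dots> = (SUP n. ennreal (\<Sum>k\<in>{N..<n + N}. ?x k))"
    using x0 sum.shift_bounds_nat_ivl[of ?x 0 N] by (simp add: atLeast0LessThan)
  finally have "(L2_norm (tail_point_masses m z N) f)\<^sup>2 \<le> ennreal Y \<longleftrightarrow> (\<forall>n. (\<Sum>k\<in>{N..<n + N}. ?x k) \<le> Y)"
    using Y by (simp add: SUP_le_iff)
  also have "\<dots> \<longleftrightarrow> (\<forall>M. (\<Sum>k\<in>{N..<M}. ?x k) \<le> Y)"
  proof (intro iffI allI)
    fix M assume *: "\<forall>n. (\<Sum>k\<in>{N..<n + N}. ?x k) \<le> Y"
    show "(\<Sum>k\<in>{N..<M}. ?x k) \<le> Y"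
    proof (cases "N \<le> M")
      case True
      then show ?thesis using *[rule_format, of "M - N"] by simp
    qed (use Y in simp)
  qed blast
  finally show ?thesis .
qed

text \<open>Replaces a bound on a supremum of extended real quotients by inequalities between finite
  real sums. Estimates of the Carleson constants from either side use this form; the kernel
  constants have an analogue.\<close>

lemma carleson_constant_tail_le_iff:
  assumes z: "\<And>k. z k \<in> unit_disc" and m: "\<And>k. 0 \<le> m k" and C: "0 \<le> C"
  shows "carleson_constant (tail_point_masses m z N) \<le> ennreal C \<longleftrightarrow>
    (\<forall>f\<in>hardy_space 2. \<forall>K>0. hardy_norm 2 f = ennreal K \<longrightarrow> (\<forall>M. (\<Sum>k\<in>{N..<M}. m k * (norm (f (z k)))\<^sup>2) \<le> C * K\<^sup>2))"
proof -
  have eq: "(L2_norm (tail_point_masses m z N) f)\<^sup>2 / (hardy_norm 2 f)\<^sup>2 \<le> ennreal C \<longleftrightarrow>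
      (\<forall>M. (\<Sum>k\<in>{N..<M}. m k * (norm (f (z k)))\<^sup>2) \<le> C * K\<^sup>2)"
    if f: "f \<in> hardy_space 2" "0 < K" "hardy_norm 2 f = ennreal K" for f K
  proof -
    have "(hardy_norm 2 f)\<^sup>2 = ennreal (K\<^sup>2)" using f by (simp add: ennreal_power)
    moreover have "0 < K\<^sup>2" "0 \<le> C * K\<^sup>2" using f C by auto
    ultimately show ?thesis
      using ennreal_divide_le_iff[of "K\<^sup>2" C] C
        L2_norm_tail_le_iff[OF z holomorphic_on_imp_continuous_on[OF hardy_space_2_holomorphic[OF f(1)]] m] by simp
  qed
  have "carleson_constant (tail_point_masses m z N) \<le> ennreal C \<longleftrightarrow>
      (\<forall>f\<in>hardy_space 2. hardy_norm 2 f \<noteq> 0 \<longrightarrow> (L2_norm (tail_point_masses m z N) f)\<^sup>2 / (hardy_norm 2 f)\<^sup>2 \<le> ennreal C)"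
    by (auto simp: carleson_constant_def SUP_le_iff)
  also have "\<dots> \<longleftrightarrow> (\<forall>f\<in>hardy_space 2. \<forall>K>0. hardy_norm 2 f = ennreal K \<longrightarrow>
      (L2_norm (tail_point_masses m z N) f)\<^sup>2 / (hardy_norm 2 f)\<^sup>2 \<le> ennreal C)"
  proof (intro ball_cong refl iffI allI impI)
    fix f K assume "hardy_norm 2 f \<noteq> 0 \<longrightarrow> (L2_norm (tail_point_masses m z N) f)\<^sup>2 / (hardy_norm 2 f)\<^sup>2 \<le> ennreal C"
      "0 < K" "hardy_norm 2 f = ennreal K"
    then show "(L2_norm (tail_point_masses m z N) f)\<^sup>2 / (hardy_norm 2 f)\<^sup>2 \<le> ennreal C" by simp
  next
    fix f assume f: "f \<in> hardy_space 2" "hardy_norm 2 f \<noteq> 0" and *: "\<forall>K>0. hardy_norm 2 f = ennreal K \<longrightarrow>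
      (L2_norm (tail_point_masses m z N) f)\<^sup>2 / (hardy_norm 2 f)\<^sup>2 \<le> ennreal C"
    obtain K where K: "0 \<le> K" "hardy_norm 2 f = ennreal K" using hardy_space_2_norm[OF f(1)] .
    with f(2) have "0 < K" by (cases "K = 0") auto
    with * K(2) show "(L2_norm (tail_point_masses m z N) f)\<^sup>2 / (hardy_norm 2 f)\<^sup>2 \<le> ennreal C" by blast
  qed
  also have "\<dots> \<longleftrightarrow> (\<forall>f\<in>hardy_space 2. \<forall>K>0. hardy_norm 2 f = ennreal K \<longrightarrow> (\<forall>M. (\<Sum>k\<in>{N..<M}. m k * (norm (f (z k)))\<^sup>2) \<le> C * K\<^sup>2))"
    using eq by (intro ball_cong refl all_cong imp_cong) auto
  finally show ?thesis .
qed

lemma kernel_constant_tail_le_iff: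
  assumes z: "\<And>k. z k \<in> unit_disc" and m: "\<And>k. 0 \<le> m k" and R: "0 \<le> R"
  shows "kernel_constant (tail_point_masses m z N) \<le> ennreal R \<longleftrightarrow>
    (\<forall>w\<in>unit_disc. \<forall>M. (1 - (norm w)\<^sup>2) * (\<Sum>k\<in>{N..<M}. m k * (norm (szego_kernel w (z k)))\<^sup>2) \<le> R\<^sup>2)"
proof -
  have "L2_norm (tail_point_masses m z N) (szego_kernel w) / hardy_norm 2 (szego_kernel w) \<le> ennreal R \<longleftrightarrow>
      (\<forall>M. (1 - (norm w)\<^sup>2) * (\<Sum>k\<in>{N..<M}. m k * (norm (szego_kernel w (z k)))\<^sup>2) \<le> R\<^sup>2)"
    if w: "w \<in> unit_disc" for w
  proof -
    have w1: "norm w < 1" using w by simp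
    have pos: "0 < 1 - (norm w)\<^sup>2" using w1 by (simp add: abs_square_less_1)
    let ?K = "1 / sqrt (1 - (norm w)\<^sup>2)"
    have K: "0 < ?K" "(R * ?K)\<^sup>2 = R\<^sup>2 / (1 - (norm w)\<^sup>2)" "0 \<le> R * ?K" "0 \<le> R\<^sup>2 / (1 - (norm w)\<^sup>2)"
      using pos R by (auto simp: power_mult_distrib power_divide)
    have "L2_norm (tail_point_masses m z N) (szego_kernel w) / hardy_norm 2 (szego_kernel w) \<le> ennreal R \<longleftrightarrow>
        L2_norm (tail_point_masses m z N) (szego_kernel w) \<le> ennreal (R * ?K)"
      unfolding hardy_norm_szego_kernel[OF w1] by (rule ennreal_divide_le_iff[OF K(1) R])
    also have "\<dots> \<longleftrightarrow> (L2_norm (tail_point_masses m z N) (szego_kernel w))\<^sup>2 \<le> ennreal (R\<^sup>2 / (1 - (norm w)\<^sup>2))"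
      unfolding K(2)[symmetric] by (rule ennreal_power2_le_iff[OF K(3), symmetric])
    also have "\<dots> \<longleftrightarrow> (\<forall>M. (\<Sum>k\<in>{N..<M}. m k * (norm (szego_kernel w (z k)))\<^sup>2) \<le> R\<^sup>2 / (1 - (norm w)\<^sup>2))"
      by (rule L2_norm_tail_le_iff[OF z holomorphic_on_imp_continuous_on[OF szego_kernel_holomorphic[OF w1]] m K(4)])
    also have "\<dots> \<longleftrightarrow> (\<forall>M. (1 - (norm w)\<^sup>2) * (\<Sum>k\<in>{N..<M}. m k * (norm (szego_kernel w (z k)))\<^sup>2) \<le> R\<^sup>2)"
      using pos by (simp add: le_divide_eq mult.commute)
    finally show ?thesis .
  qed
  then show ?thesis unfolding kernel_constant_def SUP_le_iff by auto
qed

lemma carleson_constant_tail_szego_le: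
  assumes z: "\<And>k. z k \<in> unit_disc" and m: "\<And>k. 0 \<le> m k" and C: "0 \<le> C"
    and le: "carleson_constant (tail_point_masses m z N) \<le> ennreal C" and w: "norm w < 1"
  shows "(1 - (norm w)\<^sup>2) * (\<Sum>k\<in>{N..<M}. m k * (norm (szego_kernel w (z k)))\<^sup>2) \<le> C"
proof -
  have pos: "0 < 1 - (norm w)\<^sup>2" using w by (simp add: abs_square_less_1)
  have "(\<Sum>k\<in>{N..<M}. m k * (norm (szego_kernel w (z k)))\<^sup>2) \<le> C * (1 / sqrt (1 - (norm w)\<^sup>2))\<^sup>2"
    using le[unfolded carleson_constant_tail_le_iff[OF z m C], rule_format,
        OF szego_kernel_hardy_space[OF w] _ hardy_norm_szego_kernel[OF w]] pos by simp
  then show ?thesis using pos by (simp add: power_divide le_divide_eq mult.commute)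
qed

text \<open>In the second measure the weights grow by \<open>1 / separation z k \<le> M N\<close>,
  so its Carleson constant is at most \<open>(M N)^2\<close>. \<open>kernel_constant\<close> is a
  quotient of norms and not of their squares, and is therefore at most \<open>M N\<close>. Testing
  on the kernel at \<open>z N\<close>, with the point mass at \<open>z N\<close> alone, gives the
  lower bound 1 in both limits.\<close>

theorem thin_imp_carleson:
  assumes z: "blaschke_sequence z" and inj: "inj z" and thin: "thin z"
  shows "\<forall>N. carleson_measure (tail_point_masses (\<lambda>k. 1 - (norm (z k))\<^sup>2) z N)"
    and "(\<lambda>N. carleson_constant (tail_point_masses (\<lambda>k. 1 - (norm (z k))\<^sup>2) z N)) \<longlonglongrightarrow> 1"
    and "\<forall>N. carleson_measure (tail_point_masses (\<lambda>k. (1 - (norm (z k))\<^sup>2) / separation z k) z N)"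
    and "(\<lambda>N. kernel_constant (tail_point_masses (\<lambda>k. (1 - (norm (z k))\<^sup>2) / separation z k) z N)) \<longlonglongrightarrow> 1"
proof -
  obtain M where M: "\<And>N. 1 \<le> M N" "\<And>N. tail_constant z N (M N)" "M \<longlonglongrightarrow> 1"
    by (rule thin_tail_constants[OF z inj thin]) (rule that; assumption)
  have M0: "0 \<le> M N" for N using M(1)[of N] by simp
  have pos: "0 < 1 - (norm (z k))\<^sup>2" for k by (rule blaschke_sequence_weight_pos[OF z])
  note disc = blaschke_sequence_in_disc[OF z] and z1 = blaschke_sequence_norm_less_1[OF z]
  have sep: "0 < separation z k" "separation z k \<le> 1" for k
    using separation_pos[OF z inj] separation_le_1[OF z] by auto
  let ?m = "\<lambda>k. 1 - (norm (z k))\<^sup>2" and ?n = "\<lambda>k. (1 - (norm (z k))\<^sup>2) / separation z k"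
  have m0: "0 \<le> ?m k" for k using pos[of k] by simp
  have n0: "0 \<le> ?n k" for k using pos[of k] sep[of k] by simp
  have mle: "carleson_constant (tail_point_masses ?m z N) \<le> ennreal (M N)" for N
    unfolding carleson_constant_tail_le_iff[OF disc m0 M0]
    by (auto intro!: carleson_sum_le[OF z inj M(2)] hardy_space_2_holomorphic)
  have nsum: "(\<Sum>k\<in>{N..<L}. ?n k * (norm (f (z k)))\<^sup>2) \<le> (M N)\<^sup>2 * K\<^sup>2"
    if f: "f holomorphic_on unit_disc" "0 \<le> K" "hardy_norm 2 f \<le> ennreal K" for f K N L
  proof -
    obtain n d where nd: "0 < n" "0 < d" "d \<le> 1" "\<And>j. j \<ge> N \<Longrightarrow> d \<le> separation z j" "M N = interpolation_constant n d"
      using M(2)[of N] unfolding tail_constant_def by blast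
    have dM: "1 / d \<le> M N" unfolding nd(5) by (rule interpolation_constant_ge[OF nd(1-3)])
    have "(\<Sum>k\<in>{N..<L}. ?n k * (norm (f (z k)))\<^sup>2) \<le> (\<Sum>k\<in>{N..<L}. M N * (?m k * (norm (f (z k)))\<^sup>2))"
    proof (intro sum_mono)
      fix k assume "k \<in> {N..<L}"
      then have "1 / separation z k \<le> 1 / d" using nd sep[of k] by (intro divide_left_mono) auto
      with dM have "1 / separation z k \<le> M N" by linarith
      then have "1 / separation z k * (?m k * (norm (f (z k)))\<^sup>2) \<le> M N * (?m k * (norm (f (z k)))\<^sup>2)"
        using m0[of k] by (intro mult_right_mono) auto
      then show "?n k * (norm (f (z k)))\<^sup>2 \<le> M N * (?m k * (norm (f (z k)))\<^sup>2)" by simp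
    qed
    also have "\<dots> = M N * (\<Sum>k\<in>{N..<L}. ?m k * (norm (f (z k)))\<^sup>2)" by (simp add: sum_distrib_left)
    also have "\<dots> \<le> M N * (M N * K\<^sup>2)"
      using M0 f by (intro mult_left_mono carleson_sum_le[OF z inj M(2)]) auto
    finally show ?thesis by (simp add: power2_eq_square mult_ac)
  qed
  show "\<forall>N. carleson_measure (tail_point_masses ?m z N)"
    unfolding carleson_measure_def using le_less_trans[OF mle ennreal_less_top] by simp
  show "(\<lambda>N. carleson_constant (tail_point_masses ?m z N)) \<longlonglongrightarrow> 1"
  proof (rule tendsto_one_ennrealI[OF _ mle M(3)])
    fix N
    show "1 \<le> carleson_constant (tail_point_masses ?m z N)"
    proof (rule one_le_ennrealI)
      fix c assume "0 \<le> c" "carleson_constant (tail_point_masses ?m z N) \<le> ennreal c"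
      from carleson_constant_tail_szego_le[OF disc m0 this z1[of N], where M = "Suc N"]
      show "1 \<le> c" using kernel_value_square_diag[OF z1, of N] by simp
    qed
  qed
  have nle: "carleson_constant (tail_point_masses ?n z N) \<le> ennreal ((M N)\<^sup>2)" for N
    unfolding carleson_constant_tail_le_iff[OF disc n0 zero_le_power2]
  proof (intro ballI allI impI)
    fix f K L assume "f \<in> hardy_space 2" "0 < K" "hardy_norm 2 f = ennreal K"
    then show "(\<Sum>k\<in>{N..<L}. ?n k * (norm (f (z k)))\<^sup>2) \<le> (M N)\<^sup>2 * K\<^sup>2"
      by (intro nsum hardy_space_2_holomorphic) simp_all
  qed
  show "\<forall>N. carleson_measure (tail_point_masses ?n z N)"
    unfolding carleson_measure_def using le_less_trans[OF nle ennreal_less_top] by simp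
  show "(\<lambda>N. kernel_constant (tail_point_masses ?n z N)) \<longlonglongrightarrow> 1"
  proof (rule tendsto_one_ennrealI[OF _ _ M(3)])
    fix N
    show "kernel_constant (tail_point_masses ?n z N) \<le> ennreal (M N)"
      unfolding kernel_constant_tail_le_iff[OF disc n0 M0]
    proof (intro ballI allI)
      fix w :: complex and L assume w: "w \<in> unit_disc"
      then have w1: "norm w < 1" by simp
      have wpos: "0 < 1 - (norm w)\<^sup>2" using w1 by (simp add: abs_square_less_1)
      have "(\<Sum>k\<in>{N..<L}. ?n k * (norm (szego_kernel w (z k)))\<^sup>2) \<le> (M N)\<^sup>2 * (1 / sqrt (1 - (norm w)\<^sup>2))\<^sup>2"
        using wpos by (intro nsum szego_kernel_holomorphic w1) (auto simp: hardy_norm_szego_kernel[OF w1])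
      then show "(1 - (norm w)\<^sup>2) * (\<Sum>k\<in>{N..<L}. ?n k * (norm (szego_kernel w (z k)))\<^sup>2) \<le> (M N)\<^sup>2"
        using wpos by (simp add: power_divide le_divide_eq mult.commute)
    qed
    show "1 \<le> kernel_constant (tail_point_masses ?n z N)"
    proof (rule one_le_ennrealI)
      fix c assume c: "0 \<le> c" "kernel_constant (tail_point_masses ?n z N) \<le> ennreal c"
      have "1 * 1 \<le> 1 / separation z N * (?m N * (?m N * (norm (szego_kernel (z N) (z N)))\<^sup>2))"
        unfolding kernel_value_square_diag[OF z1] using sep[of N] by simp
      also have "\<dots> \<le> c\<^sup>2"
        using c(2)[unfolded kernel_constant_tail_le_iff[OF disc n0 c(1)], rule_format, OF disc[of N], of "Suc N"]
        by (simp add: mult_ac)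
      finally show "1 \<le> c" using c(1) power2_le_imp_le[of 1 c] by simp
    qed
  qed
qed

text \<open>The embedding inequality for the kernel at \<open>z j\<close> is, by the formula for
  squared Gram entries, precisely a bound on the \<open>j\<close>-th row sum.\<close>

theorem carleson_imp_thin:
  assumes z: "blaschke_sequence z" and inj: "inj z"
    and lim: "(\<lambda>N. carleson_constant (tail_point_masses (\<lambda>k. 1 - (norm (z k))\<^sup>2) z N)) \<longlonglongrightarrow> 1"
  shows "thin z"
proof (rule thin_from_sums[OF z inj])
  fix \<epsilon> :: real assume \<epsilon>: "0 < \<epsilon>"
  note disc = blaschke_sequence_in_disc[OF z] and z1 = blaschke_sequence_norm_less_1[OF z]
  have m0: "0 \<le> 1 - (norm (z k))\<^sup>2" for k using blaschke_sequence_weight_pos[OF z, of k] by simp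
  obtain N where N: "carleson_constant (tail_point_masses (\<lambda>k. 1 - (norm (z k))\<^sup>2) z N) \<le> ennreal (1 + \<epsilon>)"
    using tendsto_one_ennrealD[OF lim \<epsilon>] .
  have "(\<Sum>k\<in>{N..<M}. 1 - (norm (blaschke_factor (z j) (z k)))\<^sup>2) \<le> 1 + \<epsilon>" for j M
  proof -
    have "(\<Sum>k\<in>{N..<M}. 1 - (norm (blaschke_factor (z j) (z k)))\<^sup>2) =
        (1 - (norm (z j))\<^sup>2) * (\<Sum>k\<in>{N..<M}. (1 - (norm (z k))\<^sup>2) * (norm (szego_kernel (z j) (z k)))\<^sup>2)"
      unfolding sum_distrib_left by (intro sum.cong refl) (simp add: kernel_value_square[OF z1 z1])
    also have "\<dots> \<le> 1 + \<epsilon>"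
      using \<epsilon> by (intro carleson_constant_tail_szego_le[OF disc m0 _ N z1]) simp
    finally show ?thesis .
  qed
  then show "\<exists>N. \<forall>j\<ge>N. \<forall>M>j. (\<Sum>k\<in>{N..<M}. 1 - (norm (blaschke_factor (z j) (z k)))\<^sup>2) \<le> 1 + \<epsilon>" by blast
qed

text \<open>For the kernel at \<open>z j\<close> only the point mass at \<open>z j\<close> is kept;
  it contributes exactly \<open>1 / separation z j\<close>, so the reciprocal separation is at most
  the square of the kernel constant.\<close>

theorem kernel_constant_imp_thin:
  assumes z: "blaschke_sequence z" and inj: "inj z"
    and lim: "(\<lambda>N. kernel_constant (tail_point_masses (\<lambda>k. (1 - (norm (z k))\<^sup>2) / separation z k) z N)) \<longlonglongrightarrow> 1"
  shows "thin z"
proof -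
  note disc = blaschke_sequence_in_disc[OF z] and z1 = blaschke_sequence_norm_less_1[OF z]
  have sep: "0 < separation z k" "separation z k \<le> 1" for k
    using separation_pos[OF z inj] separation_le_1[OF z] by auto
  let ?m = "\<lambda>k. 1 - (norm (z k))\<^sup>2" and ?n = "\<lambda>k. (1 - (norm (z k))\<^sup>2) / separation z k"
  have n0: "0 \<le> ?n k" for k using blaschke_sequence_weight_pos[OF z, of k] sep[of k] by simp
  have ge: "1 \<le> separation z j * (1 + \<epsilon>)\<^sup>2"
    if "0 < \<epsilon>" "kernel_constant (tail_point_masses ?n z N) \<le> ennreal (1 + \<epsilon>)" "N \<le> j" for \<epsilon> N j
  proof -
    have e: "0 \<le> 1 + \<epsilon>" using that(1) by simp
    have "1 / separation z j = ?m j * (?n j * (norm (szego_kernel (z j) (z j)))\<^sup>2)"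
      using kernel_value_square_diag[OF z1, of j] by simp
    also have "\<dots> \<le> ?m j * (\<Sum>k\<in>{N..<Suc j}. ?n k * (norm (szego_kernel (z j) (z k)))\<^sup>2)"
      using that n0 blaschke_sequence_weight_pos[OF z, of j]
      by (intro mult_left_mono member_le_sum mult_nonneg_nonneg) auto
    also have "\<dots> \<le> (1 + \<epsilon>)\<^sup>2"
      using that(2)[unfolded kernel_constant_tail_le_iff[OF disc n0 e]] disc[of j] by blast
    finally show ?thesis using sep[of j] by (simp add: field_simps)
  qed
  show ?thesis
    unfolding thin_def
  proof (rule order_tendstoI)
    fix a :: real assume "1 < a"
    then show "\<forall>\<^sub>F j in sequentially. separation z j < a"
      by (intro always_eventually allI le_less_trans[OF sep(2)])
  next
    fix a :: real assume a: "a < 1"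
    have "((\<lambda>\<epsilon>. a * (1 + \<epsilon>)\<^sup>2) \<longlongrightarrow> a * (1 + 0)\<^sup>2) (at_right (0::real))" by (intro tendsto_intros)
    then have "eventually (\<lambda>\<epsilon>. a * (1 + \<epsilon>)\<^sup>2 < 1) (at_right (0::real))"
      using a by (intro order_tendstoD) auto
    then have "eventually (\<lambda>\<epsilon>. a * (1 + \<epsilon>)\<^sup>2 < 1 \<and> 0 < \<epsilon>) (at_right (0::real))"
      using eventually_at_right_less[of "0::real"] by (rule eventually_conj)
    from eventually_happens'[OF trivial_limit_at_right_real this]
    obtain \<epsilon> where \<epsilon>: "a * (1 + \<epsilon>)\<^sup>2 < 1" "0 < \<epsilon>" by blast
    obtain N where N: "kernel_constant (tail_point_masses ?n z N) \<le> ennreal (1 + \<epsilon>)"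
      using tendsto_one_ennrealD[OF lim \<epsilon>(2)] .
    show "\<forall>\<^sub>F j in sequentially. a < separation z j"
      using eventually_ge_at_top[of N]
    proof eventually_elim
      case (elim j)
      have "a * (1 + \<epsilon>)\<^sup>2 < separation z j * (1 + \<epsilon>)\<^sup>2"
        using ge[OF \<epsilon>(2) N elim] \<epsilon>(1) by linarith
      then show ?case by (rule mult_right_less_imp_less) simp
    qed
  qed
qed

section \<open>Completeness in the model space\<close>

text \<open>This is what the factor \<open>norm a / a\<close> is for:
  \<open>1 - blaschke_factor a w\<close> becomes a multiple of \<open>1 - norm a\<close>, and the
  Blaschke condition yields absolute convergence of the product on the disc.\<close>

lemma norm_one_minus_blaschke_factor_le:
  assumes a: "norm a < 1" and w: "norm w < 1"
  shows "norm (blaschke_factor a w - 1) \<le> 2 / (1 - norm w) * (1 - norm a)"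
proof (cases "a = 0")
  case True
  have "norm (w - 1) \<le> 2" using norm_triangle_ineq4[of w 1] w by simp
  moreover have "2 \<le> 2 / (1 - norm w)" using w by (simp add: field_simps)
  ultimately show ?thesis using True by (simp add: blaschke_factor_def)
next
  case False
  let ?n = "complex_of_real (norm a)"
  have nz: "1 - cnj a * w \<noteq> 0" using szego_denominator_nonzero[OF a] w by simp
  have "a * (1 - cnj a * w) - ?n * (a - w) = (1 - ?n) * (a + ?n * w)"
  proof -
    have "a * cnj a = ?n * ?n" using complex_norm_square[of a] by (simp add: power2_eq_square)
    then have "a * (cnj a * w) = ?n * (?n * w)" by (simp add: mult.assoc[symmetric])
    then show ?thesis by (simp only: algebra_simps mult_1 mult_1_right)
  qed
  then have "1 - blaschke_factor a w = (1 - ?n) * (a + ?n * w) / (a * (1 - cnj a * w))"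
    using False nz by (simp add: blaschke_factor_def field_simps)
  then have "norm (blaschke_factor a w - 1) = (1 - norm a) * norm (a + ?n * w) / (norm a * norm (1 - cnj a * w))"
    using a by (simp add: norm_minus_commute[of "blaschke_factor a w"] norm_mult norm_divide)
      (metis abs_of_nonneg diff_ge_0_iff_ge less_imp_le norm_of_real of_real_1 of_real_diff)
  also have "\<dots> \<le> (1 - norm a) * (norm a * 2) / (norm a * (1 - norm w))"
  proof (intro frac_le mult_left_mono mult_nonneg_nonneg mult_pos_pos)
    have "norm (a + ?n * w) \<le> norm a + norm a * norm w"
      using norm_triangle_ineq[of a "?n * w"] by (simp add: norm_mult)
    also have "\<dots> \<le> norm a * 2" using w by (simp add: mult_left_le)
    finally show "norm (a + ?n * w) \<le> norm a * 2" .
    have "norm (cnj a * w) \<le> norm w" using a by (simp add: norm_mult mult_left_le_one_le)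
    then show "1 - norm w \<le> norm (1 - cnj a * w)" using norm_triangle_ineq2[of 1 "cnj a * w"] by simp
  qed (use a w False in auto)
  also have "\<dots> = 2 / (1 - norm w) * (1 - norm a)" using False w by simp
  finally show ?thesis .
qed

lemma blaschke_product_LIMSEQ:
  assumes z: "blaschke_sequence z" and w: "w \<in> unit_disc"
  shows "(\<lambda>M. \<Prod>k<M. blaschke_factor (z k) w) \<longlonglongrightarrow> blaschke_product z w"
proof -
  have "summable (\<lambda>k. norm (blaschke_factor (z k) w - 1))"
  proof (rule summable_comparison_test')
    show "summable (\<lambda>k. 2 / (1 - norm w) * (1 - norm (z k)))"
      using z by (intro summable_mult) (simp add: blaschke_sequence_def)
    show "norm (norm (blaschke_factor (z k) w - 1)) \<le> 2 / (1 - norm w) * (1 - norm (z k))" for k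
      using norm_one_minus_blaschke_factor_le[OF blaschke_sequence_norm_less_1[OF z], of w k] w by simp
  qed
  then have "convergent_prod (\<lambda>k. blaschke_factor (z k) w)"
    by (intro abs_convergent_prod_imp_convergent_prod) (simp add: abs_convergent_prod_conv_summable)
  then show ?thesis
    unfolding blaschke_product_def by (subst LIMSEQ_lessThan_iff_atMost) (rule convergent_prod_LIMSEQ)
qed

lemma norm_blaschke_product_le_1:
  assumes z: "blaschke_sequence z" and w: "w \<in> unit_disc"
  shows "norm (blaschke_product z w) \<le> 1"
proof (rule tendsto_upperbound[OF tendsto_norm[OF blaschke_product_LIMSEQ[OF z w]]])
  show "\<forall>\<^sub>F M in sequentially. norm (\<Prod>k<M. blaschke_factor (z k) w) \<le> 1"
    unfolding prod_norm[symmetric] using w blaschke_sequence_norm_less_1[OF z]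
    by (intro always_eventually allI prod_le_1) (simp add: norm_blaschke_factor_le_1 less_imp_le)
qed simp

lemma blaschke_product_zero:
  assumes z: "blaschke_sequence z"
  shows "blaschke_product z (z n) = 0"
proof (rule LIMSEQ_unique[OF blaschke_product_LIMSEQ[OF z blaschke_sequence_in_disc[OF z]]])
  have zero: "blaschke_factor (z n) (z n) = 0"
    using blaschke_factor_eq_0_iff[of "z n" "z n"] blaschke_sequence_norm_less_1[OF z, of n] by simp
  have "eventually (\<lambda>M. (\<Prod>k<M. blaschke_factor (z k) (z n)) = 0) sequentially"
    using eventually_gt_at_top[of n]
  proof eventually_elim
    case (elim M)
    then show ?case
      using zero by (intro prod_zero bexI[of _ n]) auto
  qed
  then show "(\<lambda>M. \<Prod>k<M. blaschke_factor (z k) (z n)) \<longlonglongrightarrow> 0" by (rule tendsto_eventually)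
qed

text \<open>The partial products are bounded by 1, so a subsequence has a holomorphic limit; the
  known pointwise limit identifies it with the product.\<close>

lemma blaschke_product_holomorphic:
  assumes z: "blaschke_sequence z"
  shows "blaschke_product z holomorphic_on unit_disc"
proof -
  let ?f = "\<lambda>M w. \<Prod>k<M. blaschke_factor (z k) w"
  have hol: "?f M holomorphic_on unit_disc" for M
    by (intro holomorphic_on_prod blaschke_factor_holomorphic blaschke_sequence_in_disc z)
  have le: "hardy_norm \<infinity> (?f M) \<le> ennreal 1" for M
  proof -
    have "norm (?f M w) \<le> 1" if "w \<in> unit_disc" for w
      unfolding prod_norm[symmetric] using that blaschke_sequence_norm_less_1[OF z]
      by (intro prod_le_1) (simp add: norm_blaschke_factor_le_1 less_imp_le)
    then show ?thesis using hardy_norm_le_iff[of \<infinity> 1 "?f M"] hol by simp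
  qed
  obtain g r where g: "g holomorphic_on unit_disc" "strict_mono (r :: nat \<Rightarrow> nat)"
    "\<And>w. w \<in> unit_disc \<Longrightarrow> (\<lambda>M. ?f (r M) w) \<longlonglongrightarrow> g w"
    by (rule hardy_norm_Montel[where f = ?f and p = \<infinity>, OF _ hol zero_le_one le], simp)
      (rule that; assumption)
  have "g w = blaschke_product z w" if w: "w \<in> unit_disc" for w
    using LIMSEQ_unique[OF g(3)[OF w]] LIMSEQ_subseq_LIMSEQ[OF blaschke_product_LIMSEQ[OF z w] g(2)]
    by (simp add: o_def)
  then show ?thesis using holomorphic_transform[OF g(1)] by blast
qed

lemma blaschke_product_mult_hardy_space:
  assumes z: "blaschke_sequence z" and g: "g \<in> hardy_space 2"
  shows "(\<lambda>w. blaschke_product z w * g w) \<in> hardy_space 2"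
proof -
  obtain K where K: "0 \<le> K" "hardy_norm 2 g = ennreal K" using hardy_space_2_norm[OF g] .
  have hol: "(\<lambda>w. blaschke_product z w * g w) holomorphic_on unit_disc"
    by (intro holomorphic_on_mult blaschke_product_holomorphic z hardy_space_2_holomorphic g)
  have "hardy_norm 2 (\<lambda>w. blaschke_product z w * g w) \<le> ennreal K"
    using norm_blaschke_product_le_1[OF z] K
    by (intro hardy_norm_mono[OF _ hol hardy_space_2_holomorphic[OF g]])
      (auto simp: norm_mult mult_left_le_one_le)
  then show ?thesis by (rule hardy_space_2I[OF hol])
qed

section \<open>Limits of pairings and the first inclusion\<close>

lemma circ_mean_pairing_commute:
  assumes "0 \<le> r" "r < 1" "f holomorphic_on unit_disc" "g holomorphic_on unit_disc"
  shows "circ_mean r (\<lambda>u. g u * cnj (f u)) = cnj (circ_mean r (\<lambda>u. f u * cnj (g u)))"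
proof -
  have "circ_mean r (\<lambda>u. cnj (f u * cnj (g u))) = cnj (circ_mean r (\<lambda>u. f u * cnj (g u)))"
    by (intro circ_mean_bounded_linear bounded_linear_cnj continuous_on_mult continuous_on_cnj assms
        holomorphic_on_disc_subsets(2)[OF assms(3)] holomorphic_on_disc_subsets(2)[OF assms(4)])
  then show ?thesis by (simp add: mult.commute)
qed

lemma pairing_commute_tendsto:
  assumes f: "f holomorphic_on unit_disc" and g: "g holomorphic_on unit_disc"
    and L: "((\<lambda>r. circ_mean r (\<lambda>u. f u * cnj (g u))) \<longlongrightarrow> L) (at_left 1)"
  shows "((\<lambda>r. circ_mean r (\<lambda>u. g u * cnj (f u))) \<longlongrightarrow> cnj L) (at_left 1)"
proof (rule Lim_transform_eventually[OF tendsto_cnj[OF L]])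
  show "\<forall>\<^sub>F r in at_left 1. cnj (circ_mean r (\<lambda>u. f u * cnj (g u))) = circ_mean r (\<lambda>u. g u * cnj (f u))"
    using eventually_at_left_real[OF zero_less_one]
    by eventually_elim (simp add: circ_mean_pairing_commute[OF _ _ f g])
qed

lemma pairing_diff_tendsto:
  assumes f: "f holomorphic_on unit_disc" and g: "g holomorphic_on unit_disc" and h: "h holomorphic_on unit_disc"
    and L: "((\<lambda>r. circ_mean r (\<lambda>u. f u * cnj (h u))) \<longlongrightarrow> L) (at_left 1)"
    and L': "((\<lambda>r. circ_mean r (\<lambda>u. g u * cnj (h u))) \<longlongrightarrow> L') (at_left 1)"
  shows "((\<lambda>r. circ_mean r (\<lambda>u. (f u - g u) * cnj (h u))) \<longlongrightarrow> L - L') (at_left 1)"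
proof (rule Lim_transform_eventually[OF tendsto_diff[OF L L']])
  show "\<forall>\<^sub>F r in at_left 1. circ_mean r (\<lambda>u. f u * cnj (h u)) - circ_mean r (\<lambda>u. g u * cnj (h u)) =
      circ_mean r (\<lambda>u. (f u - g u) * cnj (h u))"
    using eventually_at_left_real[OF zero_less_one]
  proof eventually_elim
    case (elim r)
    then have r: "0 \<le> r" "r < 1" by auto
    show ?case
      unfolding left_diff_distrib
      by (intro circ_mean_diff[symmetric] r continuous_on_mult continuous_on_cnj
        holomorphic_on_disc_subsets(2)[OF f] holomorphic_on_disc_subsets(2)[OF g] holomorphic_on_disc_subsets(2)[OF h])
  qed
qed

lemma normalized_kernel_in_model_space:
  assumes z: "blaschke_sequence z"
  shows "normalized_kernel (z n) \<in> model_space (blaschke_product z)"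
  unfolding model_space_def
proof (intro CollectI conjI ballI)
  have zn: "norm (z n) < 1" by (rule blaschke_sequence_norm_less_1[OF z])
  show "normalized_kernel (z n) \<in> hardy_space 2" by (rule normalized_kernel_hardy_space[OF zn])
  fix g assume "g \<in> hardy_space 2"
  then have G: "(\<lambda>w. blaschke_product z w * g w) holomorphic_on unit_disc"
    by (intro hardy_space_2_holomorphic blaschke_product_mult_hardy_space z)
  have "hardy_inner (normalized_kernel (z n)) (\<lambda>w. blaschke_product z w * g w) =
      cnj (of_real (sqrt (1 - (norm (z n))\<^sup>2)) * (blaschke_product z (z n) * g (z n)))"
    by (intro hardy_inner_eqI pairing_commute_tendsto[OF G normalized_kernel_holomorphic[OF zn]]
        hardy_pairing_kernel_tendsto[OF G zn])
  then show "hardy_inner (normalized_kernel (z n)) (\<lambda>w. blaschke_product z w * g w) = 0"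
    by (simp add: blaschke_product_zero[OF z])
qed

text \<open>A product \<open>B g\<close> pairs to 0 with every combination of kernels, as
  \<open>B\<close> vanishes at the nodes. For a limit of combinations the Cauchy-Schwarz inequality
  leaves \<open>norm L \<le> e * A\<close> for every positive \<open>e\<close>.\<close>

lemma closed_span_subset_model_space:
  assumes z: "blaschke_sequence z"
  shows "closed_span (\<lambda>n. normalized_kernel (z n)) \<subseteq> model_space (blaschke_product z)"
proof
  fix f assume fs: "f \<in> closed_span (\<lambda>n. normalized_kernel (z n))"
  then have f: "f \<in> hardy_space 2" by (simp add: closed_span_def)
  have approx: "\<exists>M c. hardy_norm 2 (\<lambda>w. f w - (\<Sum>n<M. c n * normalized_kernel (z n) w)) < ennreal e" if "0 < e" for e
    using fs that by (simp add: closed_span_def)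
  note holf = hardy_space_2_holomorphic[OF f]
  have "hardy_inner f (\<lambda>w. blaschke_product z w * g w) = 0" if g: "g \<in> hardy_space 2" for g
  proof -
    define G where "G = (\<lambda>w. blaschke_product z w * g w)"
    have G: "G \<in> hardy_space 2" unfolding G_def by (rule blaschke_product_mult_hardy_space[OF z g])
    note holG = hardy_space_2_holomorphic[OF G]
    obtain A where A: "0 \<le> A" "hardy_norm 2 G = ennreal A" using hardy_space_2_norm[OF G] .
    define L where "L = (\<Sum>n. taylor_coeff f n * cnj (taylor_coeff G n))"
    have L: "((\<lambda>r. circ_mean r (\<lambda>u. f u * cnj (G u))) \<longlongrightarrow> L) (at_left 1)"
      unfolding L_def by (rule hardy_pairing_tendsto[OF f G])
    have "norm L \<le> e * A" if e: "0 < e" for e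
    proof -
      obtain M c where Mc: "hardy_norm 2 (\<lambda>w. f w - (\<Sum>n<M. c n * normalized_kernel (z n) w)) < ennreal e"
        using approx[OF e] by (elim exE)
      let ?S = "\<lambda>w. \<Sum>n<M. c n * normalized_kernel (z n) w"
      have holS: "?S holomorphic_on unit_disc"
        by (intro hardy_space_2_holomorphic kernel_sum_hardy_space blaschke_sequence_norm_less_1 z)
      have "((\<lambda>r. circ_mean r (\<lambda>u. G u * cnj (?S u))) \<longlongrightarrow>
          (\<Sum>n<M. cnj (c n) * (of_real (sqrt (1 - (norm (z n))\<^sup>2)) * G (z n)))) (at_left 1)"
        by (intro hardy_pairing_kernel_sum_tendsto holG blaschke_sequence_norm_less_1 z) simp
      then have "((\<lambda>r. circ_mean r (\<lambda>u. G u * cnj (?S u))) \<longlongrightarrow> 0) (at_left 1)"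
        by (simp add: G_def blaschke_product_zero[OF z])
      from pairing_commute_tendsto[OF holG holS this]
      have "((\<lambda>r. circ_mean r (\<lambda>u. ?S u * cnj (G u))) \<longlongrightarrow> 0) (at_left 1)" by simp
      from pairing_diff_tendsto[OF holf holS holG L this]
      have "((\<lambda>r. circ_mean r (\<lambda>u. (f u - ?S u) * cnj (G u))) \<longlongrightarrow> L) (at_left 1)" by simp
      then show ?thesis
        using Mc A e by (intro hardy_pairing_limit_le[OF holomorphic_on_diff[OF holf holS] holG]) auto
    qed
    have "((\<lambda>e. e * A) \<longlongrightarrow> 0 * A) (at_right 0)" by (intro tendsto_intros)
    then have "norm L \<le> 0 * A"
      by (rule tendsto_lowerbound) (use \<open>\<And>e. 0 < e \<Longrightarrow> norm L \<le> e * A\<close> in \<open>auto intro!: eventually_at_rightI[of 0 1]\<close>)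
    then show ?thesis using hardy_inner_eqI[OF L] by (simp add: G_def)
  qed
  then show "f \<in> model_space (blaschke_product z)"
    using f by (simp add: model_space_def)
qed

section \<open>Algebra in the span of the kernels\<close>

lemma blaschke_factor_mult_kernel:
  assumes a: "norm a < 1" and c: "norm c < 1" and ac: "a \<noteq> c"
  obtains \<alpha> \<beta> where "\<And>w. w \<in> unit_disc \<Longrightarrow>
    blaschke_factor c w * normalized_kernel a w = \<alpha> * normalized_kernel a w + \<beta> * normalized_kernel c w"
proof -
  \<comment> \<open>For \<open>c = 0\<close> the factor is \<open>w\<close>, that is
    \<open>- 1\<close> times \<open>(c - w) / (1 - cnj c * w)\<close>.\<close>
  define \<gamma> where "\<gamma> = (if c = 0 then - 1 else of_real (norm c) / c)"
  \<comment> \<open>Partial fractions: \<open>p\<close> solves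
    \<open>p * (1 - cnj c * w) + (c - p) * (1 - cnj a * w) = c - w\<close>, where
    \<open>a \<noteq> c\<close> permits the division.\<close>
  define p where "p = (1 - c * cnj a) / (cnj c - cnj a)"
  let ?s = "\<lambda>a. complex_of_real (sqrt (1 - (norm a)\<^sup>2))"
  have "0 < 1 - (norm c)\<^sup>2" using c by (simp add: abs_square_less_1)
  then have s: "?s c \<noteq> 0" by (simp del: of_real_diff)
  have pac: "p * (cnj c - cnj a) = 1 - c * cnj a" using ac by (simp add: p_def)
  have "blaschke_factor c w * normalized_kernel a w =
      (\<gamma> * p) * normalized_kernel a w + (\<gamma> * (c - p) * ?s a / ?s c) * normalized_kernel c w"
    if w: "w \<in> unit_disc" for w
  proof -
    have nz: "1 - cnj a * w \<noteq> 0" "1 - cnj c * w \<noteq> 0"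
      using szego_denominator_nonzero[OF a, of w] szego_denominator_nonzero[OF c, of w] w by auto
    have b: "blaschke_factor c w = \<gamma> * ((c - w) / (1 - cnj c * w))"
      by (simp add: blaschke_factor_def \<gamma>_def)
    have "p * (1 - cnj c * w) + (c - p) * (1 - cnj a * w) = c - (p * (cnj c - cnj a) + c * cnj a) * w"
      by (simp add: algebra_simps)
    then have "p * (1 - cnj c * w) + (c - p) * (1 - cnj a * w) = c - w"
      unfolding pac by simp
    then have "(c - w) / ((1 - cnj c * w) * (1 - cnj a * w)) = p / (1 - cnj a * w) + (c - p) / (1 - cnj c * w)"
      using nz by (simp add: field_simps)
    then have eq: "\<gamma> * ?s a * ((c - w) / ((1 - cnj c * w) * (1 - cnj a * w))) =
        \<gamma> * ?s a * (p / (1 - cnj a * w) + (c - p) / (1 - cnj c * w))" by simp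
    have "blaschke_factor c w * normalized_kernel a w = \<gamma> * ?s a * ((c - w) / ((1 - cnj c * w) * (1 - cnj a * w)))"
      by (simp add: b normalized_kernel_def)
    also have "\<dots> = (\<gamma> * p) * normalized_kernel a w + (\<gamma> * (c - p) * ?s a / ?s c) * normalized_kernel c w"
      unfolding eq normalized_kernel_def distrib_left using s by (simp add: mult_ac del: of_real_diff)
    finally show ?thesis .
  qed
  then show ?thesis by (rule that)
qed

text \<open>The factor of \<open>z M\<close> sends each kernel of another index into the span of
  that kernel and the kernel at \<open>z M\<close>. The kernels present before this step have
  indices below \<open>M\<close> or equal to \<open>L > M\<close>, so no factor ever meets the
  kernel of its own point.\<close>

lemma blaschke_prod_mult_kernel:
  assumes z: "blaschke_sequence z" and inj: "inj z" and "M \<le> L"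
  shows "\<exists>a b. \<forall>w\<in>unit_disc. (\<Prod>k<M. blaschke_factor (z k) w) * normalized_kernel (z L) w =
    (\<Sum>k<M. a k * normalized_kernel (z k) w) + b * normalized_kernel (z L) w"
  using assms(3)
proof (induction M)
  case 0
  show ?case by (intro exI[of _ "\<lambda>_. 0"] exI[of _ 1]) simp
next
  case (Suc M)
  let ?h = "\<lambda>k. normalized_kernel (z k)"
  from Suc.IH[OF Suc_leD[OF Suc.prems]] obtain a b where ab: "\<forall>w\<in>unit_disc. (\<Prod>k<M. blaschke_factor (z k) w) * ?h L w =
    (\<Sum>k<M. a k * ?h k w) + b * ?h L w" by (elim exE)
  note z1 = blaschke_sequence_norm_less_1[OF z]
  have "\<exists>\<alpha> \<beta>. \<forall>w\<in>unit_disc. blaschke_factor (z M) w * ?h k w = \<alpha> * ?h k w + \<beta> * ?h M w" if "k \<noteq> M" for k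
  proof -
    have "z k \<noteq> z M" using that inj by (simp add: inj_eq)
    then obtain \<alpha> \<beta> where
      "\<And>w. w \<in> unit_disc \<Longrightarrow> blaschke_factor (z M) w * ?h k w = \<alpha> * ?h k w + \<beta> * ?h M w"
      by (rule blaschke_factor_mult_kernel[OF z1 z1]) (rule that; assumption)
    then show ?thesis by (intro exI[of _ \<alpha>] exI[of _ \<beta>]) simp
  qed
  then obtain \<alpha> \<beta> where \<alpha>\<beta>: "\<And>k w. k \<noteq> M \<Longrightarrow> w \<in> unit_disc \<Longrightarrow>
      blaschke_factor (z M) w * ?h k w = \<alpha> k * ?h k w + \<beta> k * ?h M w"
    by metis
  define a' where "a' = (\<lambda>k. if k = M then (\<Sum>k<M. a k * \<beta> k) + b * \<beta> L else a k * \<alpha> k)"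
  have "(\<Prod>k<Suc M. blaschke_factor (z k) w) * ?h L w = (\<Sum>k<Suc M. a' k * ?h k w) + (b * \<alpha> L) * ?h L w"
    if w: "w \<in> unit_disc" for w
  proof -
    have "(\<Prod>k<Suc M. blaschke_factor (z k) w) * ?h L w =
        blaschke_factor (z M) w * ((\<Prod>k<M. blaschke_factor (z k) w) * ?h L w)"
      by (simp add: mult_ac)
    also have "\<dots> = (\<Sum>k<M. a k * (blaschke_factor (z M) w * ?h k w)) + b * (blaschke_factor (z M) w * ?h L w)"
      using ab w by (simp add: sum_distrib_left algebra_simps)
    also have "\<dots> = (\<Sum>k<M. a k * (\<alpha> k * ?h k w + \<beta> k * ?h M w)) + b * (\<alpha> L * ?h L w + \<beta> L * ?h M w)"
      using \<alpha>\<beta>[OF _ w] Suc.prems by (intro arg_cong2[where f = "(+)"] sum.cong) auto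
    also have "\<dots> = (\<Sum>k<M. a k * \<alpha> k * ?h k w) + ((\<Sum>k<M. a k * \<beta> k) + b * \<beta> L) * ?h M w + (b * \<alpha> L) * ?h L w"
      by (simp add: algebra_simps sum.distrib sum_distrib_right sum_distrib_left)
    also have "\<dots> = (\<Sum>k<Suc M. a' k * ?h k w) + (b * \<alpha> L) * ?h L w"
      by (simp add: a'_def)
    finally show ?thesis .
  qed
  then show ?case by (intro exI[of _ a'] exI[of _ "b * \<alpha> L"]) simp
qed

text \<open>Newton interpolation: the finite Blaschke product times the next kernel lies in the span
  of the first \<open>M + 1\<close> kernels, vanishes at the earlier nodes and is nonzero at
  \<open>z M\<close>. For \<open>f\<close> in the Hardy space, matching it at the nodes amounts to
  projecting it orthogonally onto the span, so no projection theorem is invoked.\<close>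

lemma kernel_interpolation:
  assumes z: "blaschke_sequence z" and inj: "inj z"
  shows "\<exists>a. \<forall>j<M. (\<Sum>k<M. a k * normalized_kernel (z k) (z j)) = f (z j)"
proof (induction M)
  case (Suc M)
  let ?h = "\<lambda>k. normalized_kernel (z k)"
  from Suc obtain a where a: "\<forall>j<M. (\<Sum>k<M. a k * ?h k (z j)) = f (z j)" ..
  from blaschke_prod_mult_kernel[OF z inj order_refl, of M]
  obtain b c where bc: "\<forall>w\<in>unit_disc. (\<Prod>k<M. blaschke_factor (z k) w) * ?h M w = (\<Sum>k<M. b k * ?h k w) + c * ?h M w"
    by (elim exE)
  note z1 = blaschke_sequence_norm_less_1[OF z]
  define e where "e = (\<lambda>w. (\<Prod>k<M. blaschke_factor (z k) w) * ?h M w)"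
  have bf: "blaschke_factor (z k) (z j) = 0 \<longleftrightarrow> j = k" for j k
    using blaschke_factor_eq_0_iff[OF z1 less_imp_le[OF z1]] inj by (simp add: inj_eq)
  have e0: "e (z j) = 0" if "j < M" for j
    using that bf[of j j] by (auto simp: e_def intro!: prod_zero)
  have "?h M (z M) \<noteq> 0"
    using szego_denominator_nonzero[OF z1 less_imp_le[OF z1], of M M] blaschke_sequence_weight_pos[OF z, of M]
    by (simp add: normalized_kernel_def del: of_real_diff)
  then have eM: "e (z M) \<noteq> 0" using bf by (simp add: e_def)
  define t where "t = (f (z M) - (\<Sum>k<M. a k * ?h k (z M))) / e (z M)"
  define a' where "a' = (\<lambda>k. if k = M then t * c else a k + t * b k)"
  have eq: "(\<Sum>k<Suc M. a' k * ?h k (z j)) = (\<Sum>k<M. a k * ?h k (z j)) + t * e (z j)" for j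
  proof -
    have "e (z j) = (\<Sum>k<M. b k * ?h k (z j)) + c * ?h M (z j)"
      using bc blaschke_sequence_in_disc[OF z, of j] by (simp add: e_def)
    moreover have "(\<Sum>k<Suc M. a' k * ?h k (z j)) = (\<Sum>k<M. (a k + t * b k) * ?h k (z j)) + t * c * ?h M (z j)"
      by (simp add: a'_def)
    ultimately show ?thesis by (simp add: algebra_simps sum.distrib sum_distrib_left)
  qed
  have "(\<Sum>k<Suc M. a' k * ?h k (z j)) = f (z j)" if "j < Suc M" for j
    unfolding eq using that a e0 eM by (cases "j = M") (auto simp: t_def)
  then show ?case by (intro exI[of _ a']) simp
qed simp

text \<open>On circles of radius \<open>R\<close> near 1 the product is close to modulus 1 and
  \<open>g\<close> is controlled by \<open>f\<close>. The means of \<open>|g|^2\<close> increase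
  with the radius, so the bound descends to every smaller \<open>r\<close>.\<close>

lemma hardy_norm_2_divide_blaschke:
  assumes A: "finite A" "A \<subseteq> unit_disc" and g: "g holomorphic_on unit_disc" and f: "f holomorphic_on unit_disc"
    and fg: "\<And>w. w \<in> unit_disc \<Longrightarrow> f w = (\<Prod>a\<in>A. blaschke_factor a w) * g w"
    and K: "0 \<le> K" "hardy_norm 2 f \<le> ennreal K"
  shows "hardy_norm 2 g \<le> ennreal K"
proof -
  obtain C where C: "0 \<le> C" and bC: "\<And>w. norm w \<le> 1 \<Longrightarrow> 1 - C * (1 - (norm w)\<^sup>2) \<le> (\<Prod>a\<in>A. norm (blaschke_factor a w))"
    using finite_blaschke_lower_bound[OF A] by blast
  have "circ_mean r (\<lambda>u. (norm (g u))\<^sup>2) \<le> K\<^sup>2" if r: "0 < r" "r < 1" for r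
  proof -
    have lim: "((\<lambda>R. 1 - C * (1 - R\<^sup>2)) \<longlongrightarrow> 1 - C * (1 - 1\<^sup>2)) (at_left (1::real))"
      by (intro tendsto_intros)
    have "eventually (\<lambda>R. 0 < 1 - C * (1 - R\<^sup>2)) (at_left (1::real))"
      using order_tendstoD(1)[OF lim, of 0] by simp
    then have "eventually (\<lambda>R. (1 - C * (1 - R\<^sup>2))\<^sup>2 * circ_mean r (\<lambda>u. (norm (g u))\<^sup>2) \<le> K\<^sup>2) (at_left (1::real))"
      using eventually_at_left_real[OF r(2)]
    proof eventually_elim
      case (elim R)
      then have R: "r < R" "0 < R" "R < 1" using r by auto
      have cg: "continuous_on (sphere 0 R) (\<lambda>u. (norm (g u))\<^sup>2)" and cf: "continuous_on (sphere 0 R) (\<lambda>u. (norm (f u))\<^sup>2)"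
        by (intro continuous_on_power continuous_on_norm holomorphic_on_disc_subsets(2)[OF g]
            holomorphic_on_disc_subsets(2)[OF f] R)+
      have "circ_mean r (\<lambda>u. (norm (g u))\<^sup>2) \<le> circ_mean R (\<lambda>u. (norm (g u))\<^sup>2)"
        using r R by (intro sums_le[OF _ Parseval_circle_norm[OF g r] Parseval_circle_norm[OF g R(2,3)]]
            mult_left_mono power_mono) auto
      then have "(1 - C * (1 - R\<^sup>2))\<^sup>2 * circ_mean r (\<lambda>u. (norm (g u))\<^sup>2) \<le> (1 - C * (1 - R\<^sup>2))\<^sup>2 * circ_mean R (\<lambda>u. (norm (g u))\<^sup>2)"
        by (intro mult_left_mono) auto
      also have "\<dots> = circ_mean R (\<lambda>u. (1 - C * (1 - R\<^sup>2))\<^sup>2 * (norm (g u))\<^sup>2)"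
        using R cg by (intro circ_mean_mult_left[symmetric]) auto
      also have "\<dots> \<le> circ_mean R (\<lambda>u. (norm (f u))\<^sup>2)"
      proof (rule circ_mean_mono)
        fix u :: complex assume u: "norm u = R"
        have "(1 - C * (1 - R\<^sup>2)) * norm (g u) \<le> (\<Prod>a\<in>A. norm (blaschke_factor a u)) * norm (g u)"
          using bC[of u] u R by (intro mult_right_mono) auto
        also have "\<dots> = norm (f u)" using fg[of u] u R by (simp add: norm_mult prod_norm)
        finally have "((1 - C * (1 - R\<^sup>2)) * norm (g u))\<^sup>2 \<le> (norm (f u))\<^sup>2"
          using elim by (intro power_mono) auto
        then show "(1 - C * (1 - R\<^sup>2))\<^sup>2 * (norm (g u))\<^sup>2 \<le> (norm (f u))\<^sup>2" by (simp add: power_mult_distrib)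
      qed (use R cf cg in \<open>auto intro: continuous_on_mult_left\<close>)
      also have "\<dots> \<le> K\<^sup>2" using hardy_norm_2_le_iff_circ_mean[OF K(1) f] K R by simp
      finally show ?case .
    qed
    moreover have "((\<lambda>R. (1 - C * (1 - R\<^sup>2))\<^sup>2 * circ_mean r (\<lambda>u. (norm (g u))\<^sup>2)) \<longlongrightarrow>
        (1 - C * (1 - 1\<^sup>2))\<^sup>2 * circ_mean r (\<lambda>u. (norm (g u))\<^sup>2)) (at_left (1::real))"
      by (intro tendsto_intros)
    ultimately have "(1 - C * (1 - 1\<^sup>2))\<^sup>2 * circ_mean r (\<lambda>u. (norm (g u))\<^sup>2) \<le> K\<^sup>2"
      by (intro tendsto_upperbound[where F = "at_left (1::real)"]) auto
    then show ?thesis by simp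
  qed
  then show ?thesis using hardy_norm_2_le_iff_circ_mean[OF K(1) g] by simp
qed

text \<open>Bounded sequences that converge coefficientwise converge weakly. The head is a finite
  sum; in the tail \<open>|d y| \<le> \<eta> |d|^2 + |y|^2 / (4 \<eta>)\<close>, where the bound
  \<open>K\<close> handles the first summand and square-summability of \<open>y\<close> the
  second.\<close>

lemma weak_convergence_l2:
  fixes x :: "nat \<Rightarrow> nat \<Rightarrow> complex"
  assumes sx: "\<And>M. summable (\<lambda>n. (norm (x M n))\<^sup>2)" "\<And>M. (\<Sum>n. (norm (x M n))\<^sup>2) \<le> K"
    and lim: "\<And>n. (\<lambda>M. x M n) \<longlonglongrightarrow> x0 n"
    and sx0: "summable (\<lambda>n. (norm (x0 n))\<^sup>2)" "(\<Sum>n. (norm (x0 n))\<^sup>2) \<le> K"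
    and sy: "summable (\<lambda>n. (norm (y n))\<^sup>2)"
  shows "(\<lambda>M. \<Sum>n. x M n * cnj (y n)) \<longlonglongrightarrow> (\<Sum>n. x0 n * cnj (y n))"
proof (rule LIMSEQ_I)
  fix e :: real assume e: "0 < e"
  define d where "d = (\<lambda>M n. x M n - x0 n)"
  have dle: "(norm (d M n))\<^sup>2 \<le> 2 * (norm (x M n))\<^sup>2 + 2 * (norm (x0 n))\<^sup>2" for M n
  proof -
    have "(norm (d M n))\<^sup>2 \<le> (norm (x M n) + norm (x0 n))\<^sup>2"
      unfolding d_def by (intro power_mono norm_triangle_ineq4) auto
    moreover have "0 \<le> (norm (x M n) - norm (x0 n))\<^sup>2" by simp
    ultimately show ?thesis unfolding power2_diff power2_sum by linarith
  qed
  have sb: "summable (\<lambda>n. 2 * (norm (x M n))\<^sup>2 + 2 * (norm (x0 n))\<^sup>2)" for M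
    by (intro summable_add summable_mult sx sx0)
  have sd: "summable (\<lambda>n. (norm (d M n))\<^sup>2)" for M
    by (rule summable_comparison_test'[OF sb[of M], of 0]) (use dle in simp)
  have dK: "(\<Sum>n. (norm (d M n))\<^sup>2) \<le> 4 * K" for M
  proof -
    have "(\<Sum>n. (norm (d M n))\<^sup>2) \<le> (\<Sum>n. 2 * (norm (x M n))\<^sup>2 + 2 * (norm (x0 n))\<^sup>2)"
      by (intro suminf_le dle sd sb)
    also have "\<dots> = 2 * (\<Sum>n. (norm (x M n))\<^sup>2) + 2 * (\<Sum>n. (norm (x0 n))\<^sup>2)"
      using sx sx0 by (simp add: suminf_add[symmetric] suminf_mult summable_mult)
    finally show ?thesis using sx(2)[of M] sx0(2) by linarith
  qed
  have K0: "0 \<le> K" using suminf_nonneg[OF sx0(1)] sx0(2) by simp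
  \<comment> \<open>The differences have squared norm at most \<open>4 * K\<close>, so this
    \<open>\<eta>\<close> makes their share less than \<open>e / 3\<close>; \<open>K + 1\<close>
    avoids a division by 0.\<close>
  define \<eta> where "\<eta> = e / (12 * (K + 1))"
  have \<eta>: "0 < \<eta>" "\<eta> * (4 * K) < e / 3"
    using e K0 by (auto simp: \<eta>_def field_simps)
  obtain L where L: "(\<Sum>n. (norm (y (n + L)))\<^sup>2) < 4 * \<eta> * (e / 3)"
  proof -
    have "0 < 4 * \<eta> * (e / 3)" using \<eta> e by simp
    from suminf_exist_split[OF this sy] obtain L where "\<forall>n\<ge>L. norm (\<Sum>i. (norm (y (i + n)))\<^sup>2) < 4 * \<eta> * (e / 3)"
      by (elim exE)
    then have "norm (\<Sum>i. (norm (y (i + L)))\<^sup>2) < 4 * \<eta> * (e / 3)" by blast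
    then show ?thesis by (intro that[of L]) simp
  qed
  have "(\<lambda>M. \<Sum>n<L. norm (d M n) * norm (y n)) \<longlonglongrightarrow> (\<Sum>n<L. norm (x0 n - x0 n) * norm (y n))"
    unfolding d_def by (intro tendsto_intros lim)
  then have "eventually (\<lambda>M. (\<Sum>n<L. norm (d M n) * norm (y n)) < e / 3) sequentially"
    using e by (intro order_tendstoD) auto
  then obtain M0 where M0: "\<And>M. M \<ge> M0 \<Longrightarrow> (\<Sum>n<L. norm (d M n) * norm (y n)) < e / 3"
    unfolding eventually_sequentially by blast
  have "norm ((\<Sum>n. x M n * cnj (y n)) - (\<Sum>n. x0 n * cnj (y n))) < e" if M: "M \<ge> M0" for M
  proof -
    let ?t = "\<lambda>n. norm (d M n * cnj (y n))"
    have st: "summable ?t" by (rule summable_product_square[OF sd sy])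
    have s1: "summable (\<lambda>n. x M n * cnj (y n))" "summable (\<lambda>n. x0 n * cnj (y n))"
      using summable_product_square[OF sx(1) sy] summable_product_square[OF sx0(1) sy]
      by (auto intro: summable_norm_cancel)
    have "(\<Sum>n. x M n * cnj (y n)) - (\<Sum>n. x0 n * cnj (y n)) = (\<Sum>n. d M n * cnj (y n))"
      unfolding suminf_diff[OF s1] d_def by (simp add: left_diff_distrib)
    then have "norm ((\<Sum>n. x M n * cnj (y n)) - (\<Sum>n. x0 n * cnj (y n))) \<le> suminf ?t"
      using summable_norm[OF st] by simp
    also have "suminf ?t = (\<Sum>n. ?t (n + L)) + (\<Sum>n<L. ?t n)"
      by (rule suminf_split_initial_segment[OF st])
    also have "(\<Sum>n. ?t (n + L)) \<le> (\<Sum>n. \<eta> * (norm (d M (n + L)))\<^sup>2 + 1 / (4 * \<eta>) * (norm (y (n + L)))\<^sup>2)"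
    proof (rule suminf_le)
      fix n
      let ?a = "norm (d M (n + L))" and ?b = "norm (y (n + L))"
      have "0 \<le> (2 * \<eta> * ?a - ?b)\<^sup>2 / (4 * \<eta>)" using \<eta> by simp
      also have "\<dots> = \<eta> * ?a\<^sup>2 + 1 / (4 * \<eta>) * ?b\<^sup>2 - ?a * ?b"
        using \<eta> by (simp add: power2_eq_square field_simps)
      finally show "?t (n + L) \<le> \<eta> * ?a\<^sup>2 + 1 / (4 * \<eta>) * ?b\<^sup>2" by (simp add: norm_mult)
    next
      show "summable (\<lambda>n. ?t (n + L))" by (rule summable_ignore_initial_segment[OF st])
      show "summable (\<lambda>n. \<eta> * (norm (d M (n + L)))\<^sup>2 + 1 / (4 * \<eta>) * (norm (y (n + L)))\<^sup>2)"
        by (intro summable_add summable_mult summable_ignore_initial_segment[OF sd] summable_ignore_initial_segment[OF sy])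
    qed
    also have "\<dots> = \<eta> * (\<Sum>n. (norm (d M (n + L)))\<^sup>2) + 1 / (4 * \<eta>) * (\<Sum>n. (norm (y (n + L)))\<^sup>2)"
      using summable_ignore_initial_segment[OF sd, of M L] summable_ignore_initial_segment[OF sy, of L]
      by (simp add: suminf_add[symmetric] suminf_mult[symmetric] summable_mult summable_divide suminf_divide[symmetric])
    also have "\<dots> < e / 3 + e / 3"
    proof (intro add_less_le_mono)
      have "(\<Sum>n. (norm (d M (n + L)))\<^sup>2) \<le> (\<Sum>n. (norm (d M n))\<^sup>2)"
        using suminf_split_initial_segment[OF sd[of M], of L] sum_nonneg[of "{..<L}" "\<lambda>n. (norm (d M n))\<^sup>2"] by simp
      also have "\<dots> \<le> 4 * K" by (rule dK)
      finally have "\<eta> * (\<Sum>n. (norm (d M (n + L)))\<^sup>2) \<le> \<eta> * (4 * K)" using \<eta> by (intro mult_left_mono) auto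
      then show "\<eta> * (\<Sum>n. (norm (d M (n + L)))\<^sup>2) < e / 3" using \<eta>(2) by linarith
      show "1 / (4 * \<eta>) * (\<Sum>n. (norm (y (n + L)))\<^sup>2) \<le> e / 3"
        using L \<eta>(1) by (simp add: field_simps)
    qed
    also have "(\<Sum>n<L. ?t n) < e / 3" using M0[OF M] by (simp add: norm_mult)
    finally show ?thesis by simp
  qed
  then show "\<exists>M0. \<forall>M\<ge>M0. norm ((\<Sum>n. x M n * cnj (y n)) - (\<Sum>n. x0 n * cnj (y n))) < e" by blast
qed

lemma taylor_coeff_tendsto:
  assumes f: "\<And>M::nat. f M holomorphic_on unit_disc"
    and lim: "\<And>X. compact X \<Longrightarrow> X \<subseteq> unit_disc \<Longrightarrow> uniform_limit X f g sequentially"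
  shows "(\<lambda>M. taylor_coeff (f M) n) \<longlonglongrightarrow> taylor_coeff g n"
proof -
  have sub: "cball 0 (1 / 2) \<subseteq> unit_disc" "ball 0 (1 / 2) \<subseteq> (cball 0 (1 / 2) :: complex set)" by auto
  have "uniform_limit (ball 0 (1 / 2)) f g sequentially"
    by (rule uniform_limit_on_subset[OF lim[OF compact_cball sub(1)] sub(2)])
  moreover have "f M holomorphic_on ball 0 (1 / 2)" for M
    by (rule holomorphic_on_subset[OF f subset_trans[OF sub(2,1)]])
  ultimately have "(\<lambda>M. (deriv ^^ n) (f M) 0) \<longlonglongrightarrow> (deriv ^^ n) g 0"
    by (intro higher_deriv_complex_uniform_limit[where A = "ball 0 (1 / 2)"]) auto
  then show ?thesis unfolding taylor_coeff_def by (intro tendsto_intros) auto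
qed

text \<open>Let \<open>r\<^sub>M\<close> be the component of \<open>f\<close> orthogonal to the first \<open>M\<close> kernels. It vanishes at the first
  \<open>M\<close> nodes, so it is divisible by the partial products and weakly subconverges to some \<open>B g\<close>;
  hence \<open>\<parallel>r\<^sub>M\<parallel>\<^sup>2 = \<langle>r\<^sub>M, f\<rangle>\<close> tends to \<open>\<langle>B g, f\<rangle> = 0\<close> along a subsequence.\<close>

lemma model_space_subset_closed_span:
  assumes z: "blaschke_sequence z" and inj: "inj z"
  shows "model_space (blaschke_product z) \<subseteq> closed_span (\<lambda>n. normalized_kernel (z n))"
proof
  fix f assume fm: "f \<in> model_space (blaschke_product z)"
  then have f: "f \<in> hardy_space 2" by (simp add: model_space_def)
  have orth: "hardy_inner f (\<lambda>w. blaschke_product z w * g w) = 0" if "g \<in> hardy_space 2" for g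
    using fm that by (simp add: model_space_def)
  note holf = hardy_space_2_holomorphic[OF f] and z1 = blaschke_sequence_norm_less_1[OF z]
  obtain K where K: "0 \<le> K" "hardy_norm 2 f = ennreal K" using hardy_space_2_norm[OF f] .
  have "\<forall>M. \<exists>a. \<forall>j<M. (\<Sum>k<M. a k * normalized_kernel (z k) (z j)) = f (z j)"
    using kernel_interpolation[OF z inj] by blast
  from choice[OF this] obtain a where
    a: "\<forall>M. \<forall>j<M. (\<Sum>k<M. a M k * normalized_kernel (z k) (z j)) = f (z j)" ..
  \<comment> \<open>Agreeing with \<open>f\<close> at the first \<open>M\<close> nodes,
    \<open>F M\<close> is the orthogonal projection of \<open>f\<close> onto the span of the first
    \<open>M\<close> kernels.\<close>
  define F where "F = (\<lambda>M w. \<Sum>k<M. a M k * normalized_kernel (z k) w)"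
  define r where "r = (\<lambda>M w. f w - F M w)"
  have F: "F M \<in> hardy_space 2" for M unfolding F_def by (intro kernel_sum_hardy_space z1)
  have r: "r M \<in> hardy_space 2" for M
    using hardy_space_2_add[OF f hardy_space_2_cmult[OF F[of M], of "- 1"]] by (simp add: r_def)
  note holF = hardy_space_2_holomorphic[OF F] and holr = hardy_space_2_holomorphic[OF r]
  have rz: "r M (z j) = 0" if "j < M" for M j using a that by (simp add: r_def F_def)
  have "\<forall>M. \<exists>R. 0 \<le> R \<and> hardy_norm 2 (r M) = ennreal R"
  proof
    fix M
    obtain R where "0 \<le> R" "hardy_norm 2 (r M) = ennreal R" using hardy_space_2_norm[OF r] .
    then show "\<exists>R. 0 \<le> R \<and> hardy_norm 2 (r M) = ennreal R" by blast
  qed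
  from choice[OF this] obtain R where R: "\<And>M. 0 \<le> R M" "\<And>M. hardy_norm 2 (r M) = ennreal (R M)" by auto
  have R2: "((\<lambda>s. circ_mean s (\<lambda>u. r M u * cnj (f u))) \<longlongrightarrow> of_real ((R M)\<^sup>2)) (at_left 1)" for M
  proof -
    \<comment> \<open>The pairing with \<open>F M\<close> sees only the values of \<open>r M\<close>
      at the nodes, which vanish; hence \<open>r M\<close> has the same pairing with
      \<open>f\<close> as with itself.\<close>
    have "((\<lambda>s. circ_mean s (\<lambda>u. r M u * cnj (F M u))) \<longlongrightarrow>
        (\<Sum>k<M. cnj (a M k) * (of_real (sqrt (1 - (norm (z k))\<^sup>2)) * r M (z k)))) (at_left 1)"
      unfolding F_def by (intro hardy_pairing_kernel_sum_tendsto holr z1) simp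
    then have "((\<lambda>s. circ_mean s (\<lambda>u. r M u * cnj (F M u))) \<longlongrightarrow> 0) (at_left 1)" by (simp add: rz)
    from pairing_commute_tendsto[OF holr holF this]
    have rF: "((\<lambda>s. circ_mean s (\<lambda>u. F M u * cnj (r M u))) \<longlongrightarrow> 0) (at_left 1)" by simp
    have "((\<lambda>s. circ_mean s (\<lambda>u. f u * cnj (r M u))) \<longlongrightarrow> (\<Sum>n. taylor_coeff f n * cnj (taylor_coeff (r M) n))) (at_left 1)"
      by (rule hardy_pairing_tendsto[OF f r])
    from pairing_diff_tendsto[OF holf holF holr this rF]
    have "((\<lambda>s. circ_mean s (\<lambda>u. r M u * cnj (r M u))) \<longlongrightarrow> (\<Sum>n. taylor_coeff f n * cnj (taylor_coeff (r M) n))) (at_left 1)"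
      by (simp add: r_def)
    from tendsto_unique[OF _ this hardy_pairing_self_tendsto[OF r R]]
    have eq: "(\<Sum>n. taylor_coeff f n * cnj (taylor_coeff (r M) n)) = of_real ((R M)\<^sup>2)" by simp
    from pairing_commute_tendsto[OF holf holr hardy_pairing_tendsto[OF f r[of M]]]
    show ?thesis unfolding eq by simp
  qed
  have RK: "R M \<le> K" for M
  proof -
    have "norm (complex_of_real ((R M)\<^sup>2)) \<le> R M * K"
      using R K by (intro hardy_pairing_limit_le[OF holr holf _ _ _ _ R2]) auto
    then have "R M * R M \<le> R M * K" unfolding norm_of_real by (simp add: power2_eq_square)
    then show ?thesis using R(1)[of M] K by (cases "R M = 0") auto
  qed
  have rK: "hardy_norm 2 (r M) \<le> ennreal K" for M using R(2)[of M] RK[of M] by (simp add: ennreal_leI)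
  have "\<forall>M. \<exists>g. g holomorphic_on unit_disc \<and> hardy_norm 2 g \<le> ennreal K \<and>
      (\<forall>w\<in>unit_disc. r M w = (\<Prod>k<M. blaschke_factor (z k) w) * g w)"
  proof
    fix M
    have A: "finite (z ` {..<M})" "z ` {..<M} \<subseteq> unit_disc" using blaschke_sequence_in_disc[OF z] by auto
    have prod: "(\<Prod>b\<in>z ` {..<M}. blaschke_factor b w) = (\<Prod>k<M. blaschke_factor (z k) w)" for w
      using inj by (subst prod.reindex) (auto intro: inj_on_subset)
    obtain g where g: "g holomorphic_on unit_disc"
      "\<And>w. w \<in> unit_disc \<Longrightarrow> r M w = (\<Prod>b\<in>z ` {..<M}. blaschke_factor b w) * g w"
      by (rule holomorphic_divide_blaschke[OF A holr]) (use rz in auto)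
    have "hardy_norm 2 g \<le> ennreal K"
      by (rule hardy_norm_2_divide_blaschke[OF A g(1) holr g(2) K(1) rK])
    then show "\<exists>g. g holomorphic_on unit_disc \<and> hardy_norm 2 g \<le> ennreal K \<and>
        (\<forall>w\<in>unit_disc. r M w = (\<Prod>k<M. blaschke_factor (z k) w) * g w)"
      using g by (intro exI[of _ g]) (simp add: prod)
  qed
  from choice[OF this] obtain g where
    g: "\<forall>M. g M holomorphic_on unit_disc \<and> hardy_norm 2 (g M) \<le> ennreal K \<and>
      (\<forall>w\<in>unit_disc. r M w = (\<Prod>k<M. blaschke_factor (z k) w) * g M w)" ..
  have holg: "g M holomorphic_on unit_disc" and gK: "hardy_norm 2 (g M) \<le> ennreal K" for M
    using g by auto
  \<comment> \<open>The quotients and the remainders both need convergent subsequences; the second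
    extraction is made along the first, so that \<open>\<rho> (\<sigma> M)\<close> serves
    both.\<close>
  obtain g0 \<rho> where g0: "g0 holomorphic_on unit_disc" "strict_mono (\<rho> :: nat \<Rightarrow> nat)"
    "\<And>w. w \<in> unit_disc \<Longrightarrow> (\<lambda>M. g (\<rho> M) w) \<longlonglongrightarrow> g0 w" "hardy_norm 2 g0 \<le> ennreal K"
    by (rule hardy_norm_Montel[where f = g and p = 2, OF _ holg K(1) gK], simp) (rule that; assumption)
  obtain r0 \<sigma> where r0: "r0 holomorphic_on unit_disc" "strict_mono (\<sigma> :: nat \<Rightarrow> nat)"
    "\<And>w. w \<in> unit_disc \<Longrightarrow> (\<lambda>M. r (\<rho> (\<sigma> M)) w) \<longlonglongrightarrow> r0 w"
    "\<And>X. compact X \<Longrightarrow> X \<subseteq> unit_disc \<Longrightarrow> uniform_limit X (\<lambda>M. r (\<rho> (\<sigma> M))) r0 sequentially"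
    "hardy_norm 2 r0 \<le> ennreal K"
    by (rule hardy_norm_Montel[where f = "\<lambda>M. r (\<rho> M)" and p = 2, OF _ holr K(1) rK], simp)
      (rule that; assumption)
  have g02: "g0 \<in> hardy_space 2" by (rule hardy_space_2I[OF g0(1,4)])
  have r02: "r0 \<in> hardy_space 2" by (rule hardy_space_2I[OF r0(1,5)])
  let ?\<tau> = "\<lambda>M. \<rho> (\<sigma> M)"
  have \<tau>: "strict_mono ?\<tau>" using strict_mono_o[OF g0(2) r0(2)] by (simp add: o_def)
  have r0B: "r0 w = blaschke_product z w * g0 w" if w: "w \<in> unit_disc" for w
  proof (rule LIMSEQ_unique[OF r0(3)[OF w]])
    have "(\<lambda>M. \<Prod>k<?\<tau> M. blaschke_factor (z k) w) \<longlonglongrightarrow> blaschke_product z w"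
      using LIMSEQ_subseq_LIMSEQ[OF blaschke_product_LIMSEQ[OF z w] \<tau>] by (simp add: o_def)
    moreover have "(\<lambda>M. g (?\<tau> M) w) \<longlonglongrightarrow> g0 w"
      using LIMSEQ_subseq_LIMSEQ[OF g0(3)[OF w] r0(2)] by (simp add: o_def)
    ultimately have "(\<lambda>M. (\<Prod>k<?\<tau> M. blaschke_factor (z k) w) * g (?\<tau> M) w) \<longlonglongrightarrow> blaschke_product z w * g0 w"
      by (rule tendsto_mult)
    then show "(\<lambda>M. r (?\<tau> M) w) \<longlonglongrightarrow> blaschke_product z w * g0 w"
      using g w by simp
  qed
  define L where "L = (\<Sum>n. taylor_coeff r0 n * cnj (taylor_coeff f n))"
  have "((\<lambda>s. circ_mean s (\<lambda>u. f u * cnj (r0 u))) \<longlongrightarrow> cnj L) (at_left 1)"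
    unfolding L_def by (rule pairing_commute_tendsto[OF r0(1) holf hardy_pairing_tendsto[OF r02 f]])
  \<comment> \<open>\<open>r0\<close> and the product are known to agree on the disc only, which
    contains every circle of radius below 1.\<close>
  then have "((\<lambda>s. circ_mean s (\<lambda>u. f u * cnj (blaschke_product z u * g0 u))) \<longlongrightarrow> cnj L) (at_left 1)"
  proof (rule Lim_transform_eventually)
    show "\<forall>\<^sub>F s in at_left 1. circ_mean s (\<lambda>u. f u * cnj (r0 u)) = circ_mean s (\<lambda>u. f u * cnj (blaschke_product z u * g0 u))"
      using eventually_at_left_real[OF zero_less_one]
    proof eventually_elim
      case (elim s)
      then show ?case by (intro circ_mean_cong) (auto simp: r0B)
    qed
  qed
  from hardy_inner_eqI[OF this] orth[OF g02] have L0: "L = 0" by simp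
  \<comment> \<open>Weak convergence is enough for convergence in norm, because the pairing with the
    fixed \<open>f\<close> is already the squared norm of the remainder.\<close>
  have "(\<lambda>M. \<Sum>n. taylor_coeff (r (?\<tau> M)) n * cnj (taylor_coeff f n)) \<longlonglongrightarrow> L"
    unfolding L_def
  proof (rule weak_convergence_l2)
    show "summable (\<lambda>n. (norm (taylor_coeff (r (?\<tau> M)) n))\<^sup>2)" for M by (rule hardy_space_2_summable[OF r])
    show "(\<Sum>n. (norm (taylor_coeff (r (?\<tau> M)) n))\<^sup>2) \<le> K\<^sup>2" for M
      using hardy_norm_2_le_iff[OF K(1) holr] rK by blast
    show "(\<lambda>M. taylor_coeff (r (?\<tau> M)) n) \<longlonglongrightarrow> taylor_coeff r0 n" for n
      by (rule taylor_coeff_tendsto[OF holr r0(4)])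
    show "summable (\<lambda>n. (norm (taylor_coeff r0 n))\<^sup>2)" "summable (\<lambda>n. (norm (taylor_coeff f n))\<^sup>2)"
      by (rule hardy_space_2_summable[OF r02] hardy_space_2_summable[OF f])+
    show "(\<Sum>n. (norm (taylor_coeff r0 n))\<^sup>2) \<le> K\<^sup>2"
      using hardy_norm_2_le_iff[OF K(1) r0(1)] r0(5) by blast
  qed
  moreover have "(\<Sum>n. taylor_coeff (r M) n * cnj (taylor_coeff f n)) = of_real ((R M)\<^sup>2)" for M
    using tendsto_unique[OF _ hardy_pairing_tendsto[OF r f] R2] by simp
  ultimately have "(\<lambda>M. complex_of_real ((R (?\<tau> M))\<^sup>2)) \<longlonglongrightarrow> of_real 0"
    unfolding L0 by simp
  then have lim: "(\<lambda>M. (R (?\<tau> M))\<^sup>2) \<longlonglongrightarrow> 0" by (simp only: tendsto_of_real_iff)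
  have "\<exists>M c. hardy_norm 2 (\<lambda>w. f w - (\<Sum>n<M. c n * normalized_kernel (z n) w)) < ennreal e" if e: "0 < e" for e
  proof -
    have "0 < e\<^sup>2" using e by simp
    from eventually_happens'[OF sequentially_bot order_tendstoD(2)[OF lim this]]
    obtain M where "(R (?\<tau> M))\<^sup>2 < e\<^sup>2" by blast
    then have "R (?\<tau> M) < e" using e by (intro power2_less_imp_less[of _ e]) auto
    then have "hardy_norm 2 (r (?\<tau> M)) < ennreal e"
      unfolding R(2) using R(1) by (simp add: ennreal_less_iff)
    then show ?thesis
      unfolding r_def F_def by (intro exI[of _ "?\<tau> M"] exI[of _ "a (?\<tau> M)"])
  qed
  then show "f \<in> closed_span (\<lambda>n. normalized_kernel (z n))"
    using f by (simp add: closed_span_def)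
qed

section \<open>Assembly of the equivalences\<close>

theorem theorem4p6:
  fixes z :: "nat \<Rightarrow> complex"
  assumes "blaschke_sequence z" and "inj z"
  defines "\<mu> \<equiv> tail_point_masses (\<lambda>k. 1 - (norm (z k))\<^sup>2) z"
    and "\<nu> \<equiv> tail_point_masses (\<lambda>k. (1 - (norm (z k))\<^sup>2) / separation z k) z"
  shows "((\<exists>p\<ge>1. EIS p z) \<longleftrightarrow> thin z) \<and>
    (thin z \<longleftrightarrow>
      complete_AOB_in (model_space (blaschke_product z)) (\<lambda>n. normalized_kernel (z n))) \<and>
    (thin z \<longleftrightarrow> (\<exists>p\<ge>1. strong_AIS p z)) \<and>
    (thin z \<longleftrightarrow> (\<forall>N. carleson_measure (\<mu> N)) \<and> (\<lambda>N. carleson_constant (\<mu> N)) \<longlonglongrightarrow> 1) \<and>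
    (thin z \<longleftrightarrow> (\<forall>N. carleson_measure (\<nu> N)) \<and> (\<lambda>N. kernel_constant (\<nu> N)) \<longlonglongrightarrow> 1) \<and>
    ((\<exists>p\<ge>1. EIS p z) \<longrightarrow> (\<forall>p\<ge>1. EIS p z)) \<and>
    ((\<exists>p\<ge>1. strong_AIS p z) \<longrightarrow> (\<forall>p\<ge>1. strong_AIS p z))"
proof -
  note z = assms(1,2)
  \<comment> \<open>The equivalence is established for each exponent separately; passing from one
    exponent to all others then goes through \<open>thin z\<close>, which does not mention
    \<open>p\<close>.\<close>
  have EIS: "EIS p z \<longleftrightarrow> thin z" if "1 \<le> p" for p
    using thin_imp_EIS[OF z _ that] EIS_imp_thin[OF z that] by blast
  have AIS: "strong_AIS p z \<longleftrightarrow> thin z" if "1 \<le> p" for p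
    using EIS_imp_strong_AIS[OF that] strong_AIS_imp_EIS[OF z(1) that] EIS[OF that] by blast
  \<comment> \<open>A concrete exponent, as witness for the existential statements when thinness is
    given.\<close>
  have "1 \<le> (1 :: ennreal)" by simp
  then have exEIS: "(\<exists>p\<ge>1. EIS p z) \<longleftrightarrow> thin z" and exAIS: "(\<exists>p\<ge>1. strong_AIS p z) \<longleftrightarrow> thin z"
    using EIS AIS by blast+
  have "closed_span (\<lambda>n. normalized_kernel (z n)) = model_space (blaschke_product z)"
    using closed_span_subset_model_space[OF z(1)] model_space_subset_closed_span[OF z] by (rule equalityI)
  then have AOB: "complete_AOB_in (model_space (blaschke_product z)) (\<lambda>n. normalized_kernel (z n)) \<longleftrightarrow> thin z"
    unfolding complete_AOB_in_def
    using normalized_kernel_in_model_space[OF z(1)] thin_imp_AOB[OF z] AOB_imp_thin[OF z] by blast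
  have "thin z \<longleftrightarrow> (\<forall>N. carleson_measure (\<mu> N)) \<and> (\<lambda>N. carleson_constant (\<mu> N)) \<longlonglongrightarrow> 1"
    unfolding \<mu>_def using thin_imp_carleson(1,2)[OF z] carleson_imp_thin[OF z] by blast
  moreover have "thin z \<longleftrightarrow> (\<forall>N. carleson_measure (\<nu> N)) \<and> (\<lambda>N. kernel_constant (\<nu> N)) \<longlonglongrightarrow> 1"
    unfolding \<nu>_def using thin_imp_carleson(3,4)[OF z] kernel_constant_imp_thin[OF z] by blast
  ultimately show ?thesis using exEIS exAIS AOB EIS AIS by blast
qed

end
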